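(* Let $R>1$, $M=\mathbb{S}^1$ (unit circle in $\mathbb{R}^2$), $N=\mathbb{S}^1_R$ (concentric circle of radius $R$), and $P>0$. If the constant $A=A(P)>\log^2R$, then there exists a unique minimal distortion morph (minimizer of the distortion energy $\Psi$) $H(p,t)=\psi(t)p$, $\psi\in Q_+$, between $\mathbb{S}^1$ and $\mathbb{S}^1_R$ among all the morphs $F\in\mathcal{M}^{3,\mathrm{ac}}(M,N)$ of the form $$F(p,t)=\phi(t)p,\qquad\phi\in Q_+,$$ that generate the time-dependent vector field $$v(x,t)=\frac{\phi'(t)}{\phi(t)}\rho(x)x,\qquad(x,t)\in\Omega\times[0,1],$$ such that $\|v\|_{\mathcal{H}^5}\le P$. Moreover, the radial function $\psi\in Q_+$ of the distortion minimal morph $H$ is the unique solution of the optimization problem $$\text{minimize }J(\psi)=\int_0^1(\psi^2-1)^2\,dt+\int_0^1(\psi-1)^2\,dt\ \text{ for }\psi\in Q_+\ \text{ subject to }\int_0^1\Big(\frac{\psi'}{\psi}\Big)^2dt\le A,$$ and solves the initial value problem $$\psi'=\frac{1}{\sqrt{\lambda}}\,\psi\sqrt{\mu+(\psi^2-1)^2+(\psi-1)^2},\qquad\psi(0)=1,$$ where the pair of positive constants $\lambda$ and $\mu$ is the unique solution of the system of equations $$\int_1^R\frac{ds}{s\sqrt{\mu+(s^2-1)^2+(s-1)^2}}=\frac{1}{\sqrt{\lambda}},\qquad \frac{1}{\sqrt{\lambda}}\int_1^R\frac{\sqrt{\mu+(s^2-1)^2+(s-1)^2}}{s}\,ds=A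.$$
   Context: $Q_+=\{\phi\in C^2(0,1)\cap C[0,1]:\ \phi(0)=1,\ \phi(1)=R,\ \phi\text{ is (strictly) increasing}\}$. $\Omega$ is the open ball in $\mathbb{R}^2$ of radius $R+2$ centered at the origin; $\rho:\mathbb{R}^2\to\mathbb{R}$ is a fixed smooth bump function with $0\le\rho\le1$, $\rho\equiv1$ on the open ball $B(0,R+1)$ and $\rho\equiv0$ on $\Omega^c$. $\mathcal{H}^5=L^2(0,1;W^{5,2}_0(\Omega;\mathbb{R}^2))$ with norm $\|v\|_{\mathcal{H}^5}=(\int_0^1\|v(\cdot,t)\|^2_{W^{5,2}_0}dt)^{1/2}$, where $\|f\|^2_{W^{5,2}_0}=\sum_i\sum_{|\alpha|\le5}\int_\Omega|D^\alpha f_i|^2dx$. Set $A(P)=\|\rho\,\mathrm{id}_\Omega\|^{-2}_{W^{5,2}_0(\Omega;\mathbb{R}^2)}P^2$. $\mathcal{M}^{3,\mathrm{ac}}(M,N)$ is the set of continuous isotopies $F:M\times[0,1]\to\mathbb{R}^2$ between $M$ and $N$ such that $t\mapsto F(p,t)$ is absolutely continuous for each $p\in M$ and $F(\cdot,t)$ is a $C^3$ diffeomorphism from $M$ onto its image $M^t$ for each $t$. With $f^t=F(\cdot,t)$, the distortion energy is $$\Psi(F)=\int_0^1\!\!\int_M\|(f^t)^*g_t-g_0\|^2\,\omega_M\,dt+\int_0^1\!\!\int_M\|(f^t)^*\mathrm{II}_t-\mathrm{II}_0\|^2\,\omega_M\,dt,$$ where $g_t$ and $\mathrm{II}_t$ are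 the first and second fundamental forms of $M^t\subset\mathbb{R}^2$ ($M^t$ carries the orientation induced by $f^t$ from $M$, and $\mathrm{II}(X,Y)=\langle\bar\nabla_X\mathcal{N},Y\rangle$ with $\mathcal{N}$ the unit normal such that $(X,\mathcal{N})$ is positively oriented for positively oriented tangent $X$), $g_0=g_M$, $\mathrm{II}_0=\mathrm{II}_M$, $\omega_M$ is the volume form of $M$, and $\|\cdot\|$ is the fiber norm on $(0,2)$-tensors on $M$ induced by $g_M^*\otimes g_M^*$. *)

theory Defs
  imports "HOL-Analysis.Analysis"
begin

section \<open>Differentiability classes\<close>

fun Ck_on :: "nat \<Rightarrow> ('a::euclidean_space \<Rightarrow> 'b::euclidean_space) \<Rightarrow> 'a set \<Rightarrow> bool" where
  "Ck_on 0 f U \<longleftrightarrow> continuous_on U f"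
| "Ck_on (Suc k) f U \<longleftrightarrow>
     (\<forall>x\<in>U. f differentiable (at x)) \<and>
     (\<forall>v. Ck_on k (\<lambda>x. frechet_derivative f (at x) v) U)"

text \<open>On a set that need not be open (such as an embedded curve), being of class \<open>C\<^sup>k\<close> means
  having local \<open>C\<^sup>k\<close> extensions to open subsets of the ambient space.\<close>

definition Ck_map :: "nat \<Rightarrow> ('a::euclidean_space \<Rightarrow> 'b::euclidean_space) \<Rightarrow> 'a set \<Rightarrow> bool" where
  "Ck_map k f S \<longleftrightarrow>
     (\<forall>x\<in>S. \<exists>U g. open U \<and> x \<in> U \<and> Ck_on k g U \<and> (\<forall>y\<in>U \<inter> S. g y = f y))"

definition Ck_diffeo_onto_image ::
    "nat \<Rightarrow> ('a::euclidean_space \<Rightarrow> 'b::euclidean_space) \<Rightarrow> 'a set \<Rightarrow> bool" where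
  "Ck_diffeo_onto_image k f S \<longleftrightarrow>
     inj_on f S \<and> Ck_map k f S \<and> Ck_map k (inv_into S f) (f ` S)"

definition absolutely_continuous_on :: "real set \<Rightarrow> (real \<Rightarrow> 'b::metric_space) \<Rightarrow> bool" where
  "absolutely_continuous_on S f \<longleftrightarrow>
     (\<forall>\<epsilon>>0. \<exists>\<delta>>0. \<forall>I :: (real \<times> real) set.
        finite I \<and> (\<forall>(a,b)\<in>I. a \<le> b \<and> {a..b} \<subseteq> S) \<and>
        disjoint_family_on (\<lambda>(a,b). {a<..<b}) I \<and>
        (\<Sum>(a,b)\<in>I. b - a) < \<delta>
        \<longrightarrow> (\<Sum>(a,b)\<in>I. dist (f a) (f b)) < \<epsilon>)"


section \<open>The radial functions\<close>

text \<open>Only the values on \<open>[0,1]\<close> of an element of \<open>Q_plus R\<close> are meaningful.\<close>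

definition Q_plus :: "real \<Rightarrow> (real \<Rightarrow> real) set" where
  "Q_plus R = {\<phi>. Ck_on 2 \<phi> {0<..<1} \<and> continuous_on {0..1} \<phi> \<and>
                  \<phi> 0 = 1 \<and> \<phi> 1 = R \<and> strict_mono_on {0..1} \<phi>}"


section \<open>Sobolev spaces and time-dependent vector fields\<close>

definition multi_indices :: "nat \<Rightarrow> (nat \<times> nat) set" where
  "multi_indices k = {(a, b). a + b \<le> k}"

definition partial_deriv :: "2 \<Rightarrow> (real^2 \<Rightarrow> real) \<Rightarrow> real^2 \<Rightarrow> real" where
  "partial_deriv i f x = frechet_derivative f (at x) (axis i 1)"

definition multi_deriv :: "nat \<times> nat \<Rightarrow> (real^2 \<Rightarrow> real) \<Rightarrow> real^2 \<Rightarrow> real" where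
  "multi_deriv \<alpha> f = (partial_deriv 1 ^^ fst \<alpha>) ((partial_deriv 2 ^^ snd \<alpha>) f)"

definition test_fields :: "(real^2) set \<Rightarrow> (real^2 \<Rightarrow> real^2) set" where
  "test_fields \<Omega> = {u. (\<forall>k. Ck_on k u UNIV) \<and>
                       (\<exists>K. compact K \<and> K \<subseteq> \<Omega> \<and> (\<forall>x. x \<notin> K \<longrightarrow> u x = 0))}"

text \<open>\<open>W\<^sub>0\<^sup>k\<^sup>,\<^sup>2(\<Omega>;\<real>\<^sup>2)\<close> is the closure of the test fields in the \<open>W\<^sup>k\<^sup>,\<^sup>2\<close> norm.
  The predicate says that \<open>f\<close> lies in this closure and that the family \<open>g\<close> consists of its weak
  derivatives: \<open>g \<alpha>\<close> is the \<open>L\<^sup>2(\<Omega>)\<close> limit of \<open>D\<^sup>\<alpha> u\<^sub>n\<close>, for one sequence of test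
  fields converging to \<open>f\<close>.  Such \<open>g\<close> is unique almost everywhere (for \<open>|\<alpha>| \<le> k\<close>), because
  differentiation of test fields is a closable operator.\<close>

definition sobolev0_derivs ::
    "nat \<Rightarrow> (real^2) set \<Rightarrow> (real^2 \<Rightarrow> real^2) \<Rightarrow> (nat \<times> nat \<Rightarrow> real^2 \<Rightarrow> real^2) \<Rightarrow> bool" where
  "sobolev0_derivs k \<Omega> f g \<longleftrightarrow>
     (AE x in lebesgue_on \<Omega>. g (0,0) x = f x) \<and>
     (\<forall>\<alpha>\<in>multi_indices k. \<forall>i. (\<lambda>x. g \<alpha> x $ i) \<in> borel_measurable (lebesgue_on \<Omega>) \<and>
                                integrable (lebesgue_on \<Omega>) (\<lambda>x. (g \<alpha> x $ i)\<^sup>2)) \<and>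
     (\<exists>u. (\<forall>n. u n \<in> test_fields \<Omega>) \<and>
        (\<forall>\<alpha>\<in>multi_indices k. \<forall>i.
           (\<lambda>n. \<integral>\<^sup>+ x. ennreal ((multi_deriv \<alpha> (\<lambda>y. u n y $ i) x - g \<alpha> x $ i)\<^sup>2)
                  \<partial>lebesgue_on \<Omega>) \<longlonglongrightarrow> 0))"

definition W0 :: "nat \<Rightarrow> (real^2) set \<Rightarrow> (real^2 \<Rightarrow> real^2) set" where
  "W0 k \<Omega> = {f. \<exists>g. sobolev0_derivs k \<Omega> f g}"

definition weak_deriv ::
    "nat \<Rightarrow> (real^2) set \<Rightarrow> (real^2 \<Rightarrow> real^2) \<Rightarrow> nat \<times> nat \<Rightarrow> real^2 \<Rightarrow> real^2" where
  "weak_deriv k \<Omega> f = (SOME g. sobolev0_derivs k \<Omega> f g)"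

definition W0_norm :: "nat \<Rightarrow> (real^2) set \<Rightarrow> (real^2 \<Rightarrow> real^2) \<Rightarrow> real" where
  "W0_norm k \<Omega> f =
     sqrt (\<Sum>i\<in>UNIV. \<Sum>\<alpha>\<in>multi_indices k. LINT x|lebesgue_on \<Omega>. (weak_deriv k \<Omega> f \<alpha> x $ i)\<^sup>2)"

text \<open>The Bochner space \<open>L\<^sup>2(0,1; W\<^sub>0\<^sup>k\<^sup>,\<^sup>2(\<Omega>;\<real>\<^sup>2))\<close>: strongly measurable maps (almost
  everywhere limits of simple maps) with square integrable norm.  A time-dependent field takes the
  time as its first argument.\<close>

definition bochner_L2_W0 :: "nat \<Rightarrow> (real^2) set \<Rightarrow> (real \<Rightarrow> real^2 \<Rightarrow> real^2) set" where
  "bochner_L2_W0 k \<Omega> = {v.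
     (AE t in lebesgue_on {0<..<1}. v t \<in> W0 k \<Omega>) \<and>
     (\<exists>s. (\<forall>n. simple_function (lebesgue_on {0<..<1}) (s n)) \<and>
          (\<forall>n. \<forall>t\<in>{0<..<1}. s n t \<in> W0 k \<Omega>) \<and>
          (AE t in lebesgue_on {0<..<1}. (\<lambda>n. W0_norm k \<Omega> (\<lambda>x. s n t x - v t x)) \<longlonglongrightarrow> 0)) \<and>
     integrable (lebesgue_on {0<..<1}) (\<lambda>t. (W0_norm k \<Omega> (v t))\<^sup>2)}"

definition bochner_L2_W0_norm :: "nat \<Rightarrow> (real^2) set \<Rightarrow> (real \<Rightarrow> real^2 \<Rightarrow> real^2) \<Rightarrow> real" where
  "bochner_L2_W0_norm k \<Omega> v = sqrt (LINT t|lebesgue_on {0<..<1}. (W0_norm k \<Omega> (v t))\<^sup>2)"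

definition Omega :: "real \<Rightarrow> (real^2) set" where
  "Omega R = ball 0 (R + 2)"

definition is_bump :: "real \<Rightarrow> (real^2 \<Rightarrow> real) \<Rightarrow> bool" where
  "is_bump R \<rho> \<longleftrightarrow> (\<forall>k. Ck_on k \<rho> UNIV) \<and> (\<forall>x. 0 \<le> \<rho> x \<and> \<rho> x \<le> 1) \<and>
     (\<forall>x\<in>ball 0 (R + 1). \<rho> x = 1) \<and> (\<forall>x. x \<notin> Omega R \<longrightarrow> \<rho> x = 0)"

abbreviation H5 :: "real \<Rightarrow> (real \<Rightarrow> real^2 \<Rightarrow> real^2) set" where
  "H5 R \<equiv> bochner_L2_W0 5 (Omega R)"

abbreviation H5_norm :: "real \<Rightarrow> (real \<Rightarrow> real^2 \<Rightarrow> real^2) \<Rightarrow> real" where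
  "H5_norm R \<equiv> bochner_L2_W0_norm 5 (Omega R)"

definition A_const :: "real \<Rightarrow> (real^2 \<Rightarrow> real) \<Rightarrow> real \<Rightarrow> real" where
  "A_const R \<rho> P = P\<^sup>2 / (W0_norm 5 (Omega R) (\<lambda>x. \<rho> x *\<^sub>R x))\<^sup>2"

text \<open>The values at \<open>t = 0\<close> and \<open>t = 1\<close>, where \<open>\<phi>\<close> need not be differentiable, are irrelevant:
  fields are only considered up to null sets of times.\<close>

definition radial_field :: "(real^2 \<Rightarrow> real) \<Rightarrow> (real \<Rightarrow> real) \<Rightarrow> real \<Rightarrow> real^2 \<Rightarrow> real^2" where
  "radial_field \<rho> \<phi> t x = (deriv \<phi> t / \<phi> t * \<rho> x) *\<^sub>R x"


section \<open>Morphs\<close>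

text \<open>A morph \<open>F\<close> is applied as \<open>F p t\<close>; only its values on \<open>M \<times> [0,1]\<close> are meaningful.\<close>

definition morphs_3ac ::
    "(real^2) set \<Rightarrow> (real^2) set \<Rightarrow> (real^2 \<Rightarrow> real \<Rightarrow> real^2) set" where
  "morphs_3ac M N = {F.
     continuous_on (M \<times> {0..1}) (\<lambda>(p, t). F p t) \<and>
     (\<forall>p\<in>M. F p 0 = p) \<and> (\<lambda>p. F p 1) ` M = N \<and>
     (\<forall>p\<in>M. absolutely_continuous_on {0..1} (F p)) \<and>
     (\<forall>t\<in>{0..1}. Ck_diffeo_onto_image 3 (\<lambda>p. F p t) M)}"

definition generates ::
    "(real^2) set \<Rightarrow> (real^2 \<Rightarrow> real \<Rightarrow> real^2) \<Rightarrow> (real \<Rightarrow> real^2 \<Rightarrow> real^2) \<Rightarrow> bool" where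
  "generates M F v \<longleftrightarrow>
     (\<forall>p\<in>M. F p 0 = p \<and>
        (AE t in lebesgue_on {0<..<1}. (F p has_vector_derivative v t (F p t)) (at t)))"


section \<open>Geometry of oriented plane curves\<close>

text \<open>For a differentiable map \<open>f\<close> on an embedded curve \<open>S\<close>,
  \<open>frechet_derivative f (at p within S)\<close> is an arbitrary linear map, but its values on tangent
  vectors of \<open>S\<close> at \<open>p\<close> are determined; they are the differential of \<open>f\<close> along \<open>S\<close>.\<close>

abbreviation tangent_map ::
    "(real^2) set \<Rightarrow> (real^2 \<Rightarrow> real^2) \<Rightarrow> real^2 \<Rightarrow> real^2 \<Rightarrow> real^2" where
  "tangent_map S f p \<equiv> frechet_derivative f (at p within S)"

definition tangent_space :: "(real^2) set \<Rightarrow> real^2 \<Rightarrow> (real^2) set" where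
  "tangent_space S p = {X. \<exists>\<gamma> :: real \<Rightarrow> real^2.
     (\<forall>s. \<gamma> s \<in> S) \<and> \<gamma> 0 = p \<and> (\<gamma> has_vector_derivative X) (at 0)}"

text \<open>Rotation by \<open>\<pi>/2\<close>: \<open>(X, rot90 X)\<close> is a positively oriented basis of the plane.\<close>

definition rot90 :: "real^2 \<Rightarrow> real^2" where
  "rot90 X = vector [- X $ 2, X $ 1]"

text \<open>An orientation of a curve is given by its positively oriented unit tangent field \<open>\<tau>\<close>.\<close>

definition push_orientation ::
    "(real^2) set \<Rightarrow> (real^2 \<Rightarrow> real^2) \<Rightarrow> (real^2 \<Rightarrow> real^2) \<Rightarrow> real^2 \<Rightarrow> real^2" where
  "push_orientation M \<tau> f q =
     (let p = inv_into M f q; X = tangent_map M f p (\<tau> p) in X /\<^sub>R norm X)"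

definition first_form :: "real^2 \<Rightarrow> real^2 \<Rightarrow> real" where
  "first_form X Y = X \<bullet> Y"

definition second_form ::
    "(real^2) set \<Rightarrow> (real^2 \<Rightarrow> real^2) \<Rightarrow> real^2 \<Rightarrow> real^2 \<Rightarrow> real^2 \<Rightarrow> real" where
  "second_form S \<tau> q X Y = tangent_map S (\<lambda>q. rot90 (\<tau> q)) q X \<bullet> Y"

text \<open>The squared norm of a \<open>(0,2)\<close>-tensor \<open>B\<close> on a subspace \<open>V\<close> induced by the Euclidean inner
  product; the result does not depend on the choice of the orthonormal basis.\<close>

definition tensor_norm_sq :: "(real^2) set \<Rightarrow> (real^2 \<Rightarrow> real^2 \<Rightarrow> real) \<Rightarrow> real" where
  "tensor_norm_sq V B =
     (let E = (SOME E. pairwise orthogonal E \<and> (\<forall>e\<in>E. norm e = 1) \<and> span E = V)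
      in \<Sum>e\<in>E. \<Sum>e'\<in>E. (B e e')\<^sup>2)"


section \<open>The distortion energy of morphs of the unit circle\<close>

abbreviation S1 :: "(real^2) set" where
  "S1 \<equiv> sphere 0 1"

text \<open>The circle carries the counterclockwise orientation \<open>p \<mapsto> rot90 p\<close>; its volume form is
  represented by the arc length measure.\<close>

definition arc_measure :: "(real^2) measure" where
  "arc_measure = distr (lebesgue_on {0..<2*pi}) (restrict_space borel S1)
                   (\<lambda>\<theta>. vector [cos \<theta>, sin \<theta>])"

definition metric_distortion :: "(real^2 \<Rightarrow> real^2) \<Rightarrow> real^2 \<Rightarrow> real" where
  "metric_distortion f p = tensor_norm_sq (tangent_space S1 p)
     (\<lambda>X Y. first_form (tangent_map S1 f p X) (tangent_map S1 f p Y) - first_form X Y)"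

definition curvature_distortion :: "(real^2 \<Rightarrow> real^2) \<Rightarrow> real^2 \<Rightarrow> real" where
  "curvature_distortion f p = tensor_norm_sq (tangent_space S1 p)
     (\<lambda>X Y. second_form (f ` S1) (push_orientation S1 rot90 f) (f p)
              (tangent_map S1 f p X) (tangent_map S1 f p Y)
            - second_form S1 rot90 p X Y)"

text \<open>The energy may be infinite, hence the nonnegative extended reals.\<close>

definition distortion_energy :: "(real^2 \<Rightarrow> real \<Rightarrow> real^2) \<Rightarrow> ennreal" where
  "distortion_energy F =
     (\<integral>\<^sup>+ t. (\<integral>\<^sup>+ p. ennreal (metric_distortion (\<lambda>p. F p t) p) \<partial>arc_measure) \<partial>lebesgue_on {0..1})
   + (\<integral>\<^sup>+ t. (\<integral>\<^sup>+ p. ennreal (curvature_distortion (\<lambda>p. F p t) p) \<partial>arc_measure) \<partial>lebesgue_on {0..1})"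

definition admissible_morphs ::
    "real \<Rightarrow> (real^2 \<Rightarrow> real) \<Rightarrow> real \<Rightarrow> (real^2 \<Rightarrow> real \<Rightarrow> real^2) set" where
  "admissible_morphs R \<rho> P = {F \<in> morphs_3ac S1 (sphere 0 R).
     \<exists>\<phi>\<in>Q_plus R. (\<forall>p\<in>S1. \<forall>t\<in>{0..1}. F p t = \<phi> t *\<^sub>R p) \<and>
        generates S1 F (radial_field \<rho> \<phi>) \<and>
        radial_field \<rho> \<phi> \<in> H5 R \<and> H5_norm R (radial_field \<rho> \<phi>) \<le> P}"


section \<open>The reduced optimization problem\<close>

definition J :: "(real \<Rightarrow> real) \<Rightarrow> real" where
  "J \<psi> = integral {0..1} (\<lambda>t. ((\<psi> t)\<^sup>2 - 1)\<^sup>2) + integral {0..1} (\<lambda>t. (\<psi> t - 1)\<^sup>2)"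

text \<open>For \<open>\<psi> \<in> Q_plus R\<close> the constraint integral may be infinite.\<close>

definition J_feasible :: "real \<Rightarrow> real \<Rightarrow> (real \<Rightarrow> real) set" where
  "J_feasible R A = {\<psi> \<in> Q_plus R.
     (\<integral>\<^sup>+ t. ennreal ((deriv \<psi> t / \<psi> t)\<^sup>2) \<partial>lebesgue_on {0<..<1}) \<le> ennreal A}"

definition root_term :: "real \<Rightarrow> real \<Rightarrow> real" where
  "root_term \<mu> s = sqrt (\<mu> + (s\<^sup>2 - 1)\<^sup>2 + (s - 1)\<^sup>2)"

definition solves_multiplier_system :: "real \<Rightarrow> real \<Rightarrow> real \<Rightarrow> real \<Rightarrow> bool" where
  "solves_multiplier_system R A l \<mu> \<longleftrightarrow>
     integral {1..R} (\<lambda>s. 1 / (s * root_term \<mu> s)) = 1 / sqrt l \<and>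
     1 / sqrt l * integral {1..R} (\<lambda>s. root_term \<mu> s / s) = A"

end

theory Submission
  imports Defs
begin

text \<open>
  For a radial morph \<open>F(p, t) = \<phi>(t) p\<close> the energy is \<open>2 \<pi> J(\<phi>)\<close>, and, since
  the generated field is \<open>(\<phi>'/\<phi>)(t)\<close> times the fixed field \<open>\<rho> id\<close>, the norm
  constraint says that the integral of \<open>(\<phi>'/\<phi>)\<^sup>2\<close> is at most \<open>A\<close>.  With
  \<open>r(s) = root_term \<mu> s\<close>, integrating
  \<open>(\<surd>\<lambda> \<phi>'/\<phi> - r(\<phi>))\<^sup>2 \<ge> 0\<close> gives
  \<open>J(\<phi>) \<ge> 2 \<surd>\<lambda> \<integral> r(s)/s ds - \<mu> - \<lambda> A\<close> for every admissible \<open>\<phi>\<close>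
  (the cross term is an exact derivative), with equality only along the differential equation; for
  a pair \<open>(\<lambda>, \<mu>)\<close> solving the multiplier system the solution of the initial value problem
  is admissible and attains the bound.  Such a pair exists by the intermediate value theorem, and it
  is unique because the minimiser determines it.
\<close>

section \<open>The reduced variational problem\<close>

text \<open>The pair of multipliers has a mechanical origin. With the potential V(s) = (s^2-1)^2 +
  (s-1)^2 and the Lagrangian V(phi) + \<lambda> (phi'/phi)^2, the Euler-Lagrange equation has the
  first integral \<lambda> (phi'/phi)^2 - V(phi). The constant \<mu> is its value, so
  \<open>root_term\<close> is sqrt(\<mu> + V), and the initial value problem is the first integral
  solved for phi'. The bound A > (ln R)^2 is Cauchy-Schwarz made strict, because phi'/phi has
  integral ln R. The same number is the limit, as \<mu> grows, of the product of the two multiplier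
  integrals, and this is why a positive \<mu> exists. Two obstacles shape the rest. Functions in
  \<open>Q_plus\<close> are differentiable only inside (0,1), with derivatives possibly unbounded at
  the ends, so their integrals are evaluated from continuity alone at 0 and 1. And
  \<open>W0_norm\<close> goes through an arbitrary choice of weak derivatives, so even its
  homogeneity, on which the reduction to phi'/phi rests, requires their uniqueness, that is,
  closability of differentiation on test fields.\<close>

lemma Ck_on_cong:
  assumes "open U" "\<And>x. x \<in> U \<Longrightarrow> f x = g x"
  shows "Ck_on k f U \<longleftrightarrow> Ck_on k g U"
  using assms(2)
proof (induction k arbitrary: f g)
  case 0
  then show ?case by (simp cong: continuous_on_cong)
next
  case (Suc k)
  have fd: "(f has_derivative D) (at x) \<longleftrightarrow> (g has_derivative D) (at x)" if "x \<in> U" for x D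
    using that Suc.prems \<open>open U\<close> by (metis has_derivative_transform_within_open)
  have d: "f differentiable (at x) \<longleftrightarrow> g differentiable (at x)" if "x \<in> U" for x
    unfolding differentiable_def using fd[OF that] by simp
  have e: "frechet_derivative f (at x) = frechet_derivative g (at x)" if "x \<in> U" for x
    unfolding frechet_derivative_def using fd[OF that] by simp
  have "Ck_on k (\<lambda>x. frechet_derivative f (at x) v) U \<longleftrightarrow>
      Ck_on k (\<lambda>x. frechet_derivative g (at x) v) U" for v
    by (rule Suc.IH) (simp add: e)
  moreover have "(\<forall>x\<in>U. f differentiable (at x)) \<longleftrightarrow> (\<forall>x\<in>U. g differentiable (at x))"
    by (rule ball_cong) (simp_all add: d)
  ultimately show ?case
    by (simp only: Ck_on.simps)
qed

lemma Ck_on_const: "Ck_on k (\<lambda>x. c) U"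
  by (induction k arbitrary: c) auto

lemma frechet_derivative_real:
  assumes "(f has_real_derivative D) (at x)"
  shows "frechet_derivative f (at x) = (\<lambda>v. D * v)"
  using frechet_derivative_at[OF assms[unfolded has_field_derivative_def]] by (simp add: fun_eq_iff)

lemma Q_plusD:
  assumes "\<phi> \<in> Q_plus R"
  shows "continuous_on {0..1} \<phi>" "\<phi> 0 = 1" "\<phi> 1 = R" "strict_mono_on {0..1} \<phi>"
    and "\<And>t. t \<in> {0<..<1} \<Longrightarrow> (\<phi> has_real_derivative deriv \<phi> t) (at t)"
    and "continuous_on {0<..<1} (deriv \<phi>)"
    and "\<And>t. t \<in> {0..1} \<Longrightarrow> 1 \<le> \<phi> t \<and> \<phi> t \<le> R"
proof -
  show "continuous_on {0..1} \<phi>" "\<phi> 0 = 1" "\<phi> 1 = R" "strict_mono_on {0..1} \<phi>"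
    using assms by (auto simp: Q_plus_def)
  have C: "Ck_on (Suc (Suc 0)) \<phi> {0<..<1}"
    using assms by (simp only: Q_plus_def mem_Collect_eq numeral_2_eq_2)
  show D: "(\<phi> has_real_derivative deriv \<phi> t) (at t)" if "t \<in> {0<..<1}" for t
    using C that by (auto simp: DERIV_deriv_iff_real_differentiable)
  have "continuous_on {0<..<1} (\<lambda>t. frechet_derivative \<phi> (at t) 1)"
    using C
    by (auto intro!: continuous_at_imp_continuous_on differentiable_imp_continuous_within)
  then show "continuous_on {0<..<1} (deriv \<phi>)"
    by (rule continuous_on_eq) (simp add: frechet_derivative_real[OF D])
  show "1 \<le> \<phi> t \<and> \<phi> t \<le> R" if "t \<in> {0..1}" for t
    using that assms strict_mono_on_leD[of "{0..1}" \<phi> 0 t] strict_mono_on_leD[of "{0..1}" \<phi> t 1]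
    by (auto simp: Q_plus_def)
qed

lemma root_term_pos: "\<mu> > 0 \<Longrightarrow> root_term \<mu> s > 0"
  unfolding root_term_def by (smt (verit) real_sqrt_gt_zero zero_le_power2)

lemma root_term_nonzero [simp]: "\<mu> > 0 \<Longrightarrow> root_term \<mu> s \<noteq> 0"
  using root_term_pos[of \<mu> s] by auto

lemma root_term_square: "\<mu> > 0 \<Longrightarrow> (root_term \<mu> s)\<^sup>2 = \<mu> + (s\<^sup>2 - 1)\<^sup>2 + (s - 1)\<^sup>2"
  unfolding root_term_def by simp

lemma continuous_on_root_term [continuous_intros]:
  "continuous_on S f \<Longrightarrow> continuous_on S (\<lambda>x. root_term \<mu> (f x))"
  unfolding root_term_def by (intro continuous_intros)

text \<open>The antiderivative of \<open>f\<close> composed with \<open>\<phi>\<close> is continuous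
  up to 0 and 1 and differentiable inside, which is what the interior form of the fundamental
  theorem asks. \<open>D\<close> may blow up at the ends; integrability of the product is part of
  the conclusion.\<close>

lemma has_integral_compose_times_derivative:
  fixes f \<phi> :: "real \<Rightarrow> real"
  assumes f: "continuous_on {a..b} f" and "\<phi> ` {0..1} \<subseteq> {a..b}" "continuous_on {0..1} \<phi>"
    and D: "\<And>t. t \<in> {0<..<1} \<Longrightarrow> (\<phi> has_real_derivative D t) (at t)"
  shows "((\<lambda>t. f (\<phi> t) * D t) has_integral integral {a..\<phi> 1} f - integral {a..\<phi> 0} f) {0..1}"
proof (rule fundamental_theorem_of_calculus_interior)
  have "continuous_on {a..b} (\<lambda>x. integral {a..x} f)"
    using f by (intro indefinite_integral_continuous_1 integrable_continuous_real)
  then show "continuous_on {0..1} (\<lambda>t. integral {a..\<phi> t} f)"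
    using assms continuous_on_compose2 by blast
  fix t :: real assume t: "t \<in> {0<..<1}"
  \<comment> \<open>\<open>\<phi> t\<close> may be an endpoint of the interval, where the
    antiderivative has only a one-sided derivative. Restricting that derivative to the image of
    \<open>\<phi>\<close> fits the chain rule for derivatives within a set.\<close>
  have "((\<lambda>x. integral {a..x} f) has_real_derivative f (\<phi> t)) (at (\<phi> t) within {a..b})"
    using t assms(2) by (intro integral_has_real_derivative f) (auto simp: image_subset_iff)
  then have "((\<lambda>x. integral {a..x} f) has_real_derivative f (\<phi> t)) (at (\<phi> t) within \<phi> ` {0<..<1})"
    by (rule DERIV_subset) (use assms(2) in auto)
  then have "((\<lambda>t. integral {a..\<phi> t} f) has_real_derivative f (\<phi> t) * D t) (at t within {0<..<1})"
    using DERIV_image_chain[of "\<lambda>x. integral {a..x} f" _ \<phi> t "{0<..<1}" "D t"]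
      has_field_derivative_at_within[OF D[OF t]] by (simp add: o_def)
  then show "((\<lambda>t. integral {a..\<phi> t} f) has_vector_derivative f (\<phi> t) * D t) (at t)"
    using t by (simp add: has_real_derivative_iff_has_vector_derivative[symmetric]
        at_within_open[of t "{0<..<1}"])
qed simp

text \<open>The square whose nonnegativity calibrates the reduced problem: it vanishes exactly along the
  differential equation, and the cross term integrates to a quantity independent of \<open>\<phi>\<close>.\<close>

lemma calibration_has_integral:
  assumes \<phi>: "\<phi> \<in> Q_plus R" and "R > 1" "l > 0" "\<mu> > 0"
    and int: "(\<lambda>t. (deriv \<phi> t / \<phi> t)\<^sup>2) integrable_on {0..1}"
  shows "((\<lambda>t. (sqrt l * (deriv \<phi> t / \<phi> t) - root_term \<mu> (\<phi> t))\<^sup>2) has_integral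
    l * integral {0..1} (\<lambda>t. (deriv \<phi> t / \<phi> t)\<^sup>2) + \<mu> + J \<phi>
    - 2 * sqrt l * integral {1..R} (\<lambda>s. root_term \<mu> s / s)) {0..1}"
proof -
  note Q = Q_plusD[OF \<phi>]
  have 1: "((\<lambda>t. root_term \<mu> (\<phi> t) / \<phi> t * deriv \<phi> t) has_integral
      integral {1..\<phi> 1} (\<lambda>s. root_term \<mu> s / s) - integral {1..\<phi> 0} (\<lambda>s. root_term \<mu> s / s)) {0..1}"
    by (rule has_integral_compose_times_derivative[where b = R])
      (use Q in \<open>auto intro!: continuous_intros\<close>)
  have 2: "((\<lambda>t. ((\<phi> t)\<^sup>2 - 1)\<^sup>2) has_integral integral {0..1} (\<lambda>t. ((\<phi> t)\<^sup>2 - 1)\<^sup>2)) {0..1}"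
    "((\<lambda>t. (\<phi> t - 1)\<^sup>2) has_integral integral {0..1} (\<lambda>t. (\<phi> t - 1)\<^sup>2)) {0..1}"
    using Q(1) by (auto intro!: integrable_integral integrable_continuous_real continuous_intros)
  have 3: "((\<lambda>t. l * (deriv \<phi> t / \<phi> t)\<^sup>2 + \<mu> + (((\<phi> t)\<^sup>2 - 1)\<^sup>2 + (\<phi> t - 1)\<^sup>2)
      - 2 * sqrt l * (root_term \<mu> (\<phi> t) / \<phi> t * deriv \<phi> t)) has_integral
    l * integral {0..1} (\<lambda>t. (deriv \<phi> t / \<phi> t)\<^sup>2) + \<mu> * (1 - 0) + J \<phi>
    - 2 * sqrt l * (integral {1..R} (\<lambda>s. root_term \<mu> s / s) - 0)) {0..1}"
    unfolding J_def using 1 Q(2,3)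
    by (intro has_integral_diff has_integral_add has_integral_mult_right 2 integrable_integral[OF int])
      (use has_integral_const_real[of \<mu> 0 1] in auto)
  have "(sqrt l * (deriv \<phi> t / \<phi> t) - root_term \<mu> (\<phi> t))\<^sup>2 = l * (deriv \<phi> t / \<phi> t)\<^sup>2 + \<mu> +
     (((\<phi> t)\<^sup>2 - 1)\<^sup>2 + (\<phi> t - 1)\<^sup>2) - 2 * sqrt l * (root_term \<mu> (\<phi> t) / \<phi> t * deriv \<phi> t)" for t
    using \<open>l > 0\<close> root_term_square[OF \<open>\<mu> > 0\<close>, of "\<phi> t"]
    by (simp only: power2_diff power_mult_distrib real_sqrt_pow2[OF less_imp_le]) (simp add: field_simps)
  then show ?thesis using 3 by simp
qed

text \<open>A zero integral forces a nonnegative function to vanish at a point only where it is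
  continuous, and continuity is available inside (0,1). Hence the passage to a compact interval
  around \<open>t\<close> within (0,1).\<close>

lemma ode_of_calibration_zero:
  assumes \<phi>: "\<phi> \<in> Q_plus R"
    and int: "((\<lambda>t. (sqrt l * (deriv \<phi> t / \<phi> t) - root_term \<mu> (\<phi> t))\<^sup>2) has_integral 0) {0..1}"
    and t: "t \<in> {0<..<1}"
  shows "sqrt l * deriv \<phi> t = \<phi> t * root_term \<mu> (\<phi> t)"
proof -
  let ?f = "\<lambda>t. (sqrt l * (deriv \<phi> t / \<phi> t) - root_term \<mu> (\<phi> t))\<^sup>2"
  note Q = Q_plusD[OF \<phi>]
  obtain a b where ab: "0 < a" "a < t" "t < b" "b < 1"
    using t by (meson dense greaterThanLessThan_iff)
  have sub: "{a..b} \<subseteq> {0<..<1}" "{a..b} \<subseteq> {0..1}" using ab by auto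
  have pos: "\<phi> x > 0" if "x \<in> {a..b}" for x
    using Q(7)[of x] that sub by fastforce
  have c: "continuous_on (cbox a b) ?f"
    using continuous_on_subset[OF Q(6) sub(1)] continuous_on_subset[OF Q(1) sub(2)] pos
    by (auto intro!: continuous_intros simp: less_imp_neq[THEN not_sym])
  have "?f integrable_on {a..b}"
    using c integrable_continuous_real by simp
  then have "(?f has_integral integral {a..b} ?f) {a..b}" by (rule integrable_integral)
  moreover from this have "integral {a..b} ?f \<le> 0"
    by (intro has_integral_subset_le[OF sub(2) _ int]) auto
  moreover have "integral {a..b} ?f \<ge> 0"
    by (intro Henstock_Kurzweil_Integration.integral_nonneg) (use c integrable_continuous_real in auto)
  ultimately have "(?f has_integral 0) (cbox a b)" by simp
  from has_integral_0_cbox_imp_0[OF c _ this, of t] ab have "?f t = 0" by auto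
  then show ?thesis using pos[of t] ab by (simp add: field_simps)
qed

text \<open>The equation is separable: along any solution the integral of 1/(s r(s)) from 1 to the
  current position equals t / sqrt l. That integral is strictly increasing in its upper limit, so
  the time determines the position.\<close>

lemma ode_solution_unique:
  assumes \<phi>: "\<phi> \<in> Q_plus R" "\<psi> \<in> Q_plus R" and "l > 0" "\<mu> > 0"
    and odes: "\<And>t. t \<in> {0<..<1} \<Longrightarrow> sqrt l * deriv \<phi> t = \<phi> t * root_term \<mu> (\<phi> t)"
      "\<And>t. t \<in> {0<..<1} \<Longrightarrow> sqrt l * deriv \<psi> t = \<psi> t * root_term \<mu> (\<psi> t)"
    and t: "t \<in> {0..1}"
  shows "\<phi> t = \<psi> t"
proof -
  define f where "f = (\<lambda>s. 1 / (s * root_term \<mu> s))"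
  have fc: "continuous_on {1..b} f" for b
    unfolding f_def using root_term_pos[OF \<open>\<mu> > 0\<close>]
    by (auto intro!: continuous_intros simp: less_imp_neq[THEN not_sym])
  have T: "integral {1..\<eta> t} f = t / sqrt l"
    if \<eta>: "\<eta> \<in> Q_plus R" and ode: "\<And>t. t \<in> {0<..<1} \<Longrightarrow> sqrt l * deriv \<eta> t = \<eta> t * root_term \<mu> (\<eta> t)"
    for \<eta>
  proof -
    note Q = Q_plusD[OF \<eta>]
    \<comment> \<open>The substitution rule is stated over [0,1], so the time interval [0,t] is
      rescaled to it.\<close>
    let ?g = "\<lambda>u. \<eta> (t * u)"
    have g: "((\<lambda>u. f (?g u) * (deriv \<eta> (t * u) * t)) has_integral integral {1..?g 1} f - integral {1..?g 0} f) {0..1}"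
      if "0 < t"
    proof (rule has_integral_compose_times_derivative[OF fc])
      show "?g ` {0..1} \<subseteq> {1..R}" using Q(7) t by (auto simp: mult_le_one)
      show "continuous_on {0..1} ?g"
        by (rule continuous_on_compose2[OF Q(1)]) (use t in \<open>auto intro!: continuous_intros mult_le_one\<close>)
      fix u :: real assume u: "u \<in> {0<..<1}"
      have "t * u < 1 * 1" using u t \<open>0 < t\<close> by (intro mult_le_less_imp_less) auto
      then have "(\<eta> has_real_derivative deriv \<eta> (t * u)) (at (t * u))"
        using Q(5) u \<open>0 < t\<close> by auto
      then show "(?g has_real_derivative deriv \<eta> (t * u) * t) (at u)"
        by (rule DERIV_chain2) (auto intro!: derivative_eq_intros)
    qed
    have eq: "f (?g u) * (deriv \<eta> (t * u) * t) = t / sqrt l" if "0 < t" "u \<in> {0<..<1}" for u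
    proof -
      have "t * u < 1 * 1" using that t by (intro mult_le_less_imp_less) auto
      then have tu: "t * u \<in> {0<..<1}" using that by auto
      then have "\<eta> (t * u) > 0" using Q(7)[of "t * u"] by auto
      moreover have "deriv \<eta> (t * u) = \<eta> (t * u) * root_term \<mu> (\<eta> (t * u)) / sqrt l"
        using ode[OF tu] \<open>l > 0\<close> by (simp add: field_simps)
      ultimately show ?thesis
        using root_term_pos[OF \<open>\<mu> > 0\<close>, of "\<eta> (t * u)"] by (simp add: f_def)
    qed
    show ?thesis
    proof (cases "t = 0")
      case False
      then have "0 < t" using t by auto
      have "((\<lambda>u::real. t / sqrt l) has_integral integral {1..?g 1} f - integral {1..?g 0} f) {0..1}"
        by (rule has_integral_spike_finite[OF _ _ g[OF \<open>0 < t\<close>], of "{0, 1}"])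
          (use eq[OF \<open>0 < t\<close>] in auto)
      moreover have "((\<lambda>u::real. t / sqrt l) has_integral t / sqrt l) {0..1}"
        using has_integral_const_real[of "t / sqrt l" 0 1] by simp
      ultimately have "t / sqrt l = integral {1..?g 1} f - integral {1..?g 0} f"
        using has_integral_unique by blast
      then show ?thesis using Q(2) by simp
    qed (simp add: Q)
  qed
  have mono: "integral {1..x} f < integral {1..y} f" if "1 \<le> x" "x < y" for x y
  proof -
    have "integral {1..x} f + integral {x..y} f = integral {1..y} f"
      using that by (intro Henstock_Kurzweil_Integration.integral_combine integrable_continuous_real fc) auto
    moreover have "0 < integral {x..y} f"
    proof -
      have c: "continuous_on {x..y} f" by (rule continuous_on_subset[OF fc[of y]]) (use that in auto)
      have p: "0 < f s" if "s \<in> {x..y}" for s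
        using that \<open>1 \<le> x\<close> root_term_pos[OF \<open>\<mu> > 0\<close>, of s] by (simp add: f_def)
      have "integral {x..y} f \<noteq> 0"
        using integral_eq_0_iff[OF c \<open>x < y\<close>] p that by (metis atLeastAtMost_iff less_eq_real_def less_irrefl)
      moreover have "integral {x..y} f \<ge> 0"
        using p by (intro Henstock_Kurzweil_Integration.integral_nonneg integrable_continuous_real c) (auto simp: less_imp_le)
      ultimately show ?thesis by simp
    qed
    ultimately show ?thesis by simp
  qed
  have "integral {1..\<phi> t} f = integral {1..\<psi> t} f"
    using T[OF \<phi>(1) odes(1)] T[OF \<phi>(2) odes(2)] by simp
  then show ?thesis
    using mono[of "\<phi> t" "\<psi> t"] mono[of "\<psi> t" "\<phi> t"] Q_plusD(7)[OF \<phi>(1) t] Q_plusD(7)[OF \<phi>(2) t]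
    by force
qed

section \<open>Solving the initial value problem\<close>

lemma Ck_on_2_realI:
  fixes f :: "real \<Rightarrow> real"
  assumes "open S" "\<And>x. x \<in> S \<Longrightarrow> (f has_real_derivative f' x) (at x)"
    "\<And>x. x \<in> S \<Longrightarrow> (f' has_real_derivative f'' x) (at x)" "continuous_on S f''"
  shows "Ck_on 2 f S"
proof -
  have 1: "Ck_on (Suc 0) (\<lambda>x. f' x * v) S" for v
  proof -
    have d: "((\<lambda>x. f' x * v) has_real_derivative f'' x * v) (at x)" if "x \<in> S" for x
      using assms(3)[OF that] by (auto intro!: derivative_eq_intros)
    have "continuous_on S (\<lambda>x. frechet_derivative (\<lambda>x. f' x * v) (at x) w)" for w
      by (rule continuous_on_eq[of S "\<lambda>x. f'' x * v * w"])
        (use assms(4) frechet_derivative_real[OF d] in \<open>auto intro!: continuous_intros\<close>)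
    moreover have "(\<lambda>x. f' x * v) differentiable (at x)" if "x \<in> S" for x
      using d[OF that] real_differentiable_def by blast
    ultimately show ?thesis by (simp only: Ck_on.simps) blast
  qed
  have "Ck_on (Suc 0) (\<lambda>x. frechet_derivative f (at x) v) S" for v
    using 1[of v] by (rule Ck_on_cong[OF assms(1), THEN iffD1, rotated])
      (simp add: frechet_derivative_real[OF assms(2)])
  then show ?thesis
    unfolding numeral_2_eq_2 Ck_on.simps(2)[of "Suc 0"]
    using assms(2) real_differentiable_def by blast
qed

lemma root_term_has_real_derivative:
  assumes "\<mu> > 0"
  shows "(root_term \<mu> has_real_derivative (2 * s * (s\<^sup>2 - 1) + (s - 1)) / root_term \<mu> s) (at s)"
proof -
  have "\<mu> + (s\<^sup>2 - 1)\<^sup>2 + (s - 1)\<^sup>2 > 0" using assms by (smt (verit) zero_le_power2)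
  then have "((\<lambda>s. sqrt (\<mu> + (s\<^sup>2 - 1)\<^sup>2 + (s - 1)\<^sup>2)) has_real_derivative
    (2 * s * (s\<^sup>2 - 1) + (s - 1)) / sqrt (\<mu> + (s\<^sup>2 - 1)\<^sup>2 + (s - 1)\<^sup>2)) (at s)"
    by (auto intro!: derivative_eq_intros simp: field_simps)
  then show ?thesis unfolding root_term_def .
qed

text \<open>The solution is the inverse of the time function T(x), which is sqrt l times the
  integral of 1/(s r(s)) from 1 to x. The assumption \<open>sys\<close> says exactly that T(R) = 1,
  hence \<open>\<psi> 1 = R\<close>.\<close>

lemma exists_ode_solution:
  assumes R: "R > 1" and "l > 0" "\<mu> > 0"
    and sys: "integral {1..R} (\<lambda>s. 1 / (s * root_term \<mu> s)) = 1 / sqrt l"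
  obtains \<psi> where "\<psi> \<in> Q_plus R"
    "\<forall>t\<in>{0..1}. (\<psi> has_real_derivative 1 / sqrt l * \<psi> t * root_term \<mu> (\<psi> t)) (at t)"
proof -
  define f where "f = (\<lambda>s. 1 / (s * root_term \<mu> s))"
  \<comment> \<open>The integral over {1..x} is 0 for x < 1, so T is written as a difference of
    integrals starting at 1/4. Extending T beyond both 1 and R makes the derivative of the inverse
    two-sided even at the times 0 and 1; inverting on [1/2, R+1] leaves room inside (1/4, R+2),
    where T is differentiable.\<close>
  define T where "T = (\<lambda>x. sqrt l * (integral {1/4..x} f - integral {1/4..1} f))"
  note rp = root_term_pos[OF \<open>\<mu> > 0\<close>]
  have f_pos: "0 < f s" if "0 < s" for s using that rp by (simp add: f_def)
  have fc: "continuous_on {1/4..R+2} f"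
    unfolding f_def using rp
    by (auto intro!: continuous_intros simp: less_imp_neq[THEN not_sym])
  have TD: "(T has_real_derivative sqrt l * f x) (at x)" if "1/4 < x" "x < R + 2" for x
  proof -
    have "((\<lambda>x. integral {1/4..x} f) has_real_derivative f x) (at x within {1/4..R+2})"
      using that by (intro integral_has_real_derivative fc) auto
    then have "((\<lambda>x. integral {1/4..x} f) has_real_derivative f x) (at x)"
      using that by (simp add: at_within_Icc_at)
    then show ?thesis unfolding T_def by (auto intro!: derivative_eq_intros)
  qed
  have T_mono: "T x < T y" if "1/4 < x" "x < y" "y < R + 2" for x y
  proof (rule DERIV_pos_imp_increasing[OF \<open>x < y\<close>])
    fix z assume "x \<le> z" "z \<le> y"
    then have "1/4 < z" "z < R + 2" using that by auto
    moreover from this have "0 < sqrt l * f z" using f_pos[of z] \<open>l > 0\<close> by simp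
    ultimately show "\<exists>D. (T has_real_derivative D) (at z) \<and> 0 < D" using TD by blast
  qed
  have T_cont: "continuous_on {1/2..R+1} T"
    by (intro continuous_at_imp_continuous_on ballI DERIV_isCont[OF TD]) auto
  have T1: "T 1 = 0" by (simp add: T_def)
  have TR: "T R = 1"
  proof -
    have "integral {1/4..1} f + integral {1..R} f = integral {1/4..R} f"
      using R by (intro Henstock_Kurzweil_Integration.integral_combine integrable_continuous_real
        continuous_on_subset[OF fc]) auto
    moreover have "sqrt l * integral {1..R} f = 1"
      using sys \<open>l > 0\<close> by (simp add: f_def)
    moreover from calculation(1) have "integral {1/4..R} f - integral {1/4..1} f = integral {1..R} f"
      by simp
    ultimately show ?thesis by (simp add: T_def)
  qed
  define \<psi> where "\<psi> = inv_into {1/2..R+1} T"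
  have inj: "inj_on T {1/2..R+1}"
    by (rule linorder_inj_onI) (use T_mono in \<open>force+\<close>)
  have \<psi>T: "\<psi> (T x) = x" if "x \<in> {1/2..R+1}" for x
    using that inj by (simp add: \<psi>_def)
  have T\<psi>: "\<exists>x. 1/2 < x \<and> x < R + 1 \<and> \<psi> y = x \<and> T x = y" if y: "T (1/2) < y" "y < T (R+1)" for y
  proof -
    obtain x where x: "1/2 \<le> x" "x \<le> R + 1" "T x = y"
      using IVT'[of T "1/2" y "R+1"] y T_cont R by auto
    moreover have "x \<noteq> 1/2" "x \<noteq> R + 1" using x(3) y by blast+
    ultimately show ?thesis using \<psi>T[of x] by (intro exI[of _ x]) auto
  qed
  have \<psi>D: "(\<psi> has_real_derivative 1 / sqrt l * \<psi> y * root_term \<mu> (\<psi> y)) (at y)"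
    if y: "T (1/2) < y" "y < T (R+1)" for y
  proof -
    obtain x where x: "1/2 < x" "x < R + 1" "\<psi> y = x" "T x = y" using T\<psi>[OF y] by auto
    have "isCont \<psi> (T x)"
      by (rule isCont_inverse_function2[of "1/2" x "R+1"])
        (use x \<psi>T in \<open>auto intro: DERIV_isCont[OF TD]\<close>)
    then have "isCont \<psi> y" using x by simp
    then have "(\<psi> has_real_derivative inverse (sqrt l * f (\<psi> y))) (at y)"
      using x y T\<psi> f_pos[of x] \<open>l > 0\<close>
      by (intro DERIV_inverse_function[where f = T and a = "T (1/2)" and b = "T (R+1)"] TD) auto
    then show ?thesis using x by (simp add: f_def field_simps)
  qed
  have rng: "T (1/2) < y \<and> y < T (R+1)" if "y \<in> {0..1}" for y
    using T_mono[of "1/2" 1] T_mono[of R "R+1"] R T1 TR that by auto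
  have \<psi>_cont: "continuous_on {0..1} \<psi>"
    using rng by (intro continuous_at_imp_continuous_on ballI DERIV_isCont[OF \<psi>D]) auto
  have "\<psi> \<in> Q_plus R"
    unfolding Q_plus_def mem_Collect_eq
  proof (intro conjI)
    show "\<psi> 0 = 1" "\<psi> 1 = R" using \<psi>T[of 1] \<psi>T[of R] T1 TR R by auto
    show "continuous_on {0..1} \<psi>" by (fact \<psi>_cont)
    show "strict_mono_on {0..1} \<psi>"
    proof (rule strict_mono_onI)
      fix r s :: real assume rs: "r \<in> {0..1}" "s \<in> {0..1}" "r < s"
      obtain x where x: "1/2 < x" "x < R + 1" "\<psi> r = x" "T x = r" using T\<psi> rng[OF rs(1)] by blast
      obtain y where y: "1/2 < y" "y < R + 1" "\<psi> s = y" "T y = s" using T\<psi> rng[OF rs(2)] by blast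
      show "\<psi> r < \<psi> s" using x y rs(3) T_mono[of y x] by (cases x y rule: linorder_cases) auto
    qed
    \<comment> \<open>The equation is autonomous, so it yields the second derivative by itself:
      \<open>\<psi>' = G(\<psi>)\<close> gives \<open>\<psi>'' = G'(\<psi>) G(\<psi>)\<close>, which
      is continuous.\<close>
    define G where "G = (\<lambda>s. 1 / sqrt l * s * root_term \<mu> s)"
    define G' where "G' = (\<lambda>s. 1 / sqrt l * s * ((2 * s * (s\<^sup>2 - 1) + (s - 1)) / root_term \<mu> s)
      + 1 / sqrt l * root_term \<mu> s)"
    have GD: "(G has_real_derivative G' s) (at s)" for s
      unfolding G_def G'_def
      by (rule DERIV_mult'[OF DERIV_cmult_Id root_term_has_real_derivative[OF \<open>\<mu> > 0\<close>]])
    have D: "(\<psi> has_real_derivative G (\<psi> y)) (at y)" if "y \<in> {0<..<1}" for y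
      using \<psi>D[of y] rng[of y] that by (simp add: G_def)
    show "Ck_on 2 \<psi> {0<..<1}"
    proof (rule Ck_on_2_realI)
      show "((\<lambda>y. G (\<psi> y)) has_real_derivative G' (\<psi> y) * G (\<psi> y)) (at y)" if "y \<in> {0<..<1}" for y
        by (rule DERIV_chain2[OF GD D[OF that]])
      show "continuous_on {0<..<1} (\<lambda>y. G' (\<psi> y) * G (\<psi> y))"
        unfolding G_def G'_def using \<open>l > 0\<close> \<open>\<mu> > 0\<close>
        by (intro continuous_intros continuous_on_subset[OF \<psi>_cont]) auto
    qed (use D in auto)
  qed
  then show ?thesis using that \<psi>D rng by blast
qed

section \<open>Existence of the multipliers\<close>

lemma exists_multiplier_pair:
  assumes R: "R > 1" and A: "A > (ln R)\<^sup>2"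
  shows "\<exists>l \<mu>. l > 0 \<and> \<mu> > 0 \<and> solves_multiplier_system R A l \<mu>"
proof -
  \<comment> \<open>The first equation of the system forces 1 / sqrt l to be a(mu). Substituting
    this into the second leaves a(mu) b(mu) = A in the single unknown mu.\<close>
  define a where "a = (\<lambda>\<mu>. integral {1..R} (\<lambda>s. 1 / (s * root_term \<mu> s)))"
  define b where "b = (\<lambda>\<mu>. integral {1..R} (\<lambda>s. root_term \<mu> s / s))"
  have nz: "root_term \<mu> s > 0" if "\<mu> > 0" for \<mu> s by (rule root_term_pos[OF that])
  have "A > 0" using A by (smt (verit) zero_le_power2)
  have a_cont: "continuous_on {0<..} a"
  proof -
    have "continuous_on {0<..} (\<lambda>\<mu>. integral (cbox 1 R) (\<lambda>s. 1 / (s * root_term \<mu> s)))"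
    proof (intro integral_continuous_on_param)
      have "continuous_on ({0<..} \<times> cbox 1 R) (\<lambda>x. 1 / (snd x * root_term (fst x) (snd x)))"
      proof (intro continuous_intros ballI)
        show "continuous_on ({0<..} \<times> cbox 1 R) (\<lambda>x. root_term (fst x) (snd x))"
          unfolding root_term_def by (intro continuous_intros)
        fix x :: "real \<times> real" assume "x \<in> {0<..} \<times> cbox 1 R"
        then show "snd x * root_term (fst x) (snd x) \<noteq> 0" using nz[of "fst x" "snd x"] by auto
      qed
      then show "continuous_on ({0<..} \<times> cbox 1 R) (\<lambda>(\<mu>, s). 1 / (s * root_term \<mu> s))"
        by (simp add: split_beta)
    qed
    then show ?thesis by (simp add: a_def)
  qed
  have b_cont: "continuous_on {0<..} b"
  proof -
    have "continuous_on {0<..} (\<lambda>\<mu>. integral (cbox 1 R) (\<lambda>s. root_term \<mu> s / s))"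
      by (intro integral_continuous_on_param)
        (auto simp: split_beta root_term_def intro!: continuous_intros)
    then show ?thesis by (simp add: b_def)
  qed
  have ln: "((\<lambda>s. c / s) has_integral c * ln R) {1..R}" for c :: real
  proof -
    have "((\<lambda>s. c / s) has_integral c * ln R - c * ln 1) {1..R}"
      using R by (intro fundamental_theorem_of_calculus)
        (auto simp: has_real_derivative_iff_has_vector_derivative[symmetric] intro!: derivative_eq_intros)
    then show ?thesis by simp
  qed
  have a_int: "((\<lambda>s. 1 / (s * root_term \<mu> s)) has_integral a \<mu>) {1..R}" if "\<mu> > 0" for \<mu>
    unfolding a_def using that
    by (intro integrable_integral integrable_continuous_real) (auto intro!: continuous_intros)
  have b_int: "((\<lambda>s. root_term \<mu> s / s) has_integral b \<mu>) {1..R}" if "\<mu> > 0" for \<mu>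
    unfolding b_def
    by (intro integrable_integral integrable_continuous_real) (auto intro!: continuous_intros)
  have "ln R > 0" using R by simp
  obtain m1 where m1: "m1 > 0" "a m1 * b m1 \<le> A"
  proof -
    \<comment> \<open>\<open>G\<close> is the maximum of the potential on [1,R]. The value
      \<open>m\<close> solves (ln R)^2 (m + G) / m = A and is positive because A > (ln R)^2.\<close>
    define G where "G = (R\<^sup>2 - 1)\<^sup>2 + (R - 1)\<^sup>2"
    define m where "m = (ln R)\<^sup>2 * G / (A - (ln R)\<^sup>2)"
    have "G > 0" unfolding G_def using R by (intro add_nonneg_pos) auto
    then have m: "m > 0" using A \<open>ln R > 0\<close> by (auto simp: m_def intro!: divide_pos_pos mult_pos_pos)
    have up: "root_term m s \<le> sqrt (m + G)" if "s \<in> {1..R}" for s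
    proof -
      have "s\<^sup>2 \<ge> 1" "s\<^sup>2 \<le> R\<^sup>2" using that by (auto intro: power_mono)
      then have "(s\<^sup>2 - 1)\<^sup>2 \<le> (R\<^sup>2 - 1)\<^sup>2" "(s - 1)\<^sup>2 \<le> (R - 1)\<^sup>2"
        using that by (auto intro!: power_mono)
      then show ?thesis by (simp add: root_term_def G_def)
    qed
    have lo: "sqrt m \<le> root_term m s" for s by (simp add: root_term_def)
    have "a m \<le> 1 / sqrt m * ln R"
    proof (rule has_integral_le[OF a_int[OF m] ln])
      fix s assume s: "s \<in> {1..R}"
      have "1 / root_term m s \<le> 1 / sqrt m" using lo[of s] m by (intro divide_left_mono) (auto simp: nz)
      then have "1 / root_term m s / s \<le> 1 / sqrt m / s"
        using s by (intro divide_right_mono) auto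
      then show "1 / (s * root_term m s) \<le> 1 / sqrt m / s"
        by (simp add: mult.commute)
    qed
    moreover have "b m \<le> sqrt (m + G) * ln R"
      by (rule has_integral_le[OF b_int[OF m] ln]) (use up in \<open>auto intro: divide_right_mono\<close>)
    moreover have "b m \<ge> 0"
      by (rule has_integral_nonneg[OF b_int[OF m]]) (use nz[OF m] in \<open>auto simp: less_imp_le\<close>)
    ultimately have "a m * b m \<le> (1 / sqrt m * ln R) * (sqrt (m + G) * ln R)"
      using m \<open>ln R > 0\<close> by (intro mult_mono) auto
    also have "\<dots> = (ln R)\<^sup>2 * (sqrt (m + G) / sqrt m)" by (simp add: power2_eq_square)
    \<comment> \<open>The bound sqrt x <= x for x >= 1 removes the root, so that the right side
      becomes the expression that \<open>m\<close> was chosen to match.\<close>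
    also have "\<dots> \<le> (ln R)\<^sup>2 * ((m + G) / m)"
    proof -
      have "1 \<le> (m + G) / m" using m \<open>G > 0\<close> by simp
      then have "sqrt ((m + G) / m) \<le> (m + G) / m"
        by (intro real_le_lsqrt) (auto simp only: self_le_power zero_less_numeral)
      then show ?thesis by (intro mult_left_mono) (auto simp: real_sqrt_divide)
    qed
    also have "\<dots> = A"
    proof -
      have "m * (A - (ln R)\<^sup>2) = (ln R)\<^sup>2 * G" using A by (simp add: m_def)
      then have "(ln R)\<^sup>2 * (m + G) = A * m" by (simp add: algebra_simps)
      then show ?thesis using m by (simp add: field_simps)
    qed
    finally show ?thesis using that m by blast
  qed
  obtain m0 where m0: "m0 > 0" "a m0 * b m0 \<ge> A"
  proof -
    \<comment> \<open>For mu near 0 the product is made large by a(mu): at mu = 0 the root vanishes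
      linearly at s = 1, so 1/(s r(s)) has a logarithmic singularity there. The slope
      \<open>K\<close> works because (s+1)^2 + 1 <= (R+2)^2 on [1,R]; \<open>b0\<close>, the
      integral of 1 - 1/s, bounds b(mu) from below; and \<open>w\<close> is the offset for which the
      logarithm reaches A / b0.\<close>
    define K where "K = R + 2"
    define b0 where "b0 = R - 1 - ln R"
    have "b0 > 0" using ln_less_self[of R] R ln_eq_minus_one[of R] ln_le_minus_one[of R]
      unfolding b0_def by force
    define w where "w = K * (R - 1) * exp (- (R * K * A / b0))"
    have w: "w > 0" using R by (simp add: w_def K_def)
    have rt: "root_term (w\<^sup>2) s \<le> w + K * (s - 1)" if "s \<in> {1..R}" for s
    proof -
      have "(s + 1)\<^sup>2 \<le> (R + 1)\<^sup>2" using that by (auto intro: power_mono)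
      then have "((s + 1)\<^sup>2 + 1) * (s - 1)\<^sup>2 \<le> K\<^sup>2 * (s - 1)\<^sup>2"
        using R by (intro mult_right_mono[OF _ zero_le_power2]) (simp add: K_def power2_sum)
      also have "((s + 1)\<^sup>2 + 1) * (s - 1)\<^sup>2 = (s\<^sup>2 - 1)\<^sup>2 + (s - 1)\<^sup>2"
        by (simp add: power2_eq_square algebra_simps)
      moreover have "0 \<le> 2 * w * (K * (s - 1))" using w that R by (simp add: K_def)
      ultimately have "w\<^sup>2 + (s\<^sup>2 - 1)\<^sup>2 + (s - 1)\<^sup>2 \<le> (w + K * (s - 1))\<^sup>2"
        unfolding power2_sum power_mult_distrib by linarith
      then show ?thesis
        unfolding root_term_def using w that R by (intro real_le_lsqrt) (auto simp: K_def)
    qed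
    have w2: "w\<^sup>2 > 0" using w by simp
    \<comment> \<open>An antiderivative of 1/(R (w + K (s-1))), the explicit minorant of 1/(s r(s))
      obtained from \<open>rt\<close> and s <= R.\<close>
    define h where "h = (\<lambda>s. ln (w + K * (s - 1)) / (R * K))"
    have "((\<lambda>s. 1 / (R * (w + K * (s - 1)))) has_integral h R - h 1) {1..R}"
    proof (rule fundamental_theorem_of_calculus)
      fix s assume s: "s \<in> {1..R}"
      have "w + K * (s - 1) > 0" using w s R by (auto simp: K_def intro: add_pos_nonneg)
      then show "(h has_vector_derivative 1 / (R * (w + K * (s - 1)))) (at s within {1..R})"
        using R unfolding h_def
        by (auto simp: has_real_derivative_iff_has_vector_derivative[symmetric] K_def
          intro!: derivative_eq_intros)
    qed (use R in auto)
    then have "h R - h 1 \<le> a (w\<^sup>2)"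
    proof (rule has_integral_le[OF _ a_int[OF w2]])
      fix s assume s: "s \<in> {1..R}"
      have "w + K * (s - 1) > 0" using w s R by (auto simp: K_def intro: add_pos_nonneg)
      moreover have "s * root_term (w\<^sup>2) s \<le> R * (w + K * (s - 1))"
        using rt[OF s] s R nz[OF w2, of s] by (intro mult_mono) auto
      ultimately show "1 / (R * (w + K * (s - 1))) \<le> 1 / (s * root_term (w\<^sup>2) s)"
        using nz[OF w2, of s] s R by (intro divide_left_mono) (auto intro!: mult_pos_pos simp: order_less_le_trans)
    qed
    moreover have "A / b0 \<le> h R - h 1"
    proof -
      have "0 < K * (R - 1)" using R by (simp add: K_def)
      then have "ln (K * (R - 1)) \<le> ln (w + K * (R - 1))"
        using w by (intro ln_mono) auto
      moreover have "ln w = ln (K * (R - 1)) - R * K * A / b0"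
        using R unfolding w_def by (subst ln_mult_pos) (auto simp: K_def)
      ultimately have "R * K * A / b0 \<le> ln (w + K * (R - 1)) - ln w" by linarith
      then have "R * K * A / b0 / (R * K) \<le> (ln (w + K * (R - 1)) - ln w) / (R * K)"
        using R by (intro divide_right_mono) (auto simp: K_def)
      then show ?thesis using R by (simp add: h_def K_def diff_divide_distrib)
    qed
    moreover have "b0 \<le> b (w\<^sup>2)"
    proof (rule has_integral_le[OF _ b_int[OF w2]])
      show "((\<lambda>s. 1 - 1 / s) has_integral b0) {1..R}"
        unfolding b0_def using has_integral_const_real[of "1::real" 1 R] ln[of 1] R
        by (intro has_integral_diff) simp_all
      fix s assume s: "s \<in> {1..R}"
      have "s - 1 \<le> root_term (w\<^sup>2) s"
        unfolding root_term_def by (rule real_le_rsqrt) simp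
      then have "(s - 1) / s \<le> root_term (w\<^sup>2) s / s" using s by (intro divide_right_mono) auto
      then show "1 - 1 / s \<le> root_term (w\<^sup>2) s / s" using s by (simp add: diff_divide_distrib)
    qed
    ultimately have "A / b0 * b0 \<le> a (w\<^sup>2) * b (w\<^sup>2)"
      using \<open>A > 0\<close> \<open>b0 > 0\<close> by (intro mult_mono) (auto intro: order.trans[of _ "A / b0"])
    then show ?thesis using that[OF w2] \<open>b0 > 0\<close> by simp
  qed
  have "\<exists>\<mu>>0. a \<mu> * b \<mu> = A"
  proof -
    have "connected ((\<lambda>\<mu>. a \<mu> * b \<mu>) ` {0<..})"
      by (intro connected_continuous_image continuous_intros a_cont b_cont) auto
    then have "A \<in> (\<lambda>\<mu>. a \<mu> * b \<mu>) ` {0<..}"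
      using m0 m1 by (elim connectedD_interval) auto
    then show ?thesis by auto
  qed
  then obtain \<mu> where \<mu>: "\<mu> > 0" "a \<mu> * b \<mu> = A" by blast
  have "a \<mu> \<ge> 0"
    by (rule has_integral_nonneg[OF a_int[OF \<mu>(1)]]) (use nz[OF \<mu>(1)] in \<open>auto simp: less_imp_le\<close>)
  then have "a \<mu> > 0" using \<mu>(2) \<open>A > 0\<close> by (cases "a \<mu> = 0") auto
  moreover have "integral {1..R} (\<lambda>s. 1 / (s * root_term \<mu> s)) = a \<mu>"
    "integral {1..R} (\<lambda>s. root_term \<mu> s / s) = b \<mu>" by (simp_all add: a_def b_def)
  ultimately have "solves_multiplier_system R A (1 / (a \<mu>)\<^sup>2) \<mu>"
    using \<mu> by (simp add: solves_multiplier_system_def real_sqrt_divide)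
  then show ?thesis using \<mu>(1) \<open>a \<mu> > 0\<close> by (intro exI[of _ "1 / (a \<mu>)\<^sup>2"] exI[of _ \<mu>]) simp
qed

section \<open>Feasible functions and the comparison argument\<close>

lemma J_feasible_imp_integrable:
  assumes "\<phi> \<in> J_feasible R A" "A \<ge> 0"
  shows "(\<lambda>t. (deriv \<phi> t / \<phi> t)\<^sup>2) integrable_on {0..1}"
    and "integral {0..1} (\<lambda>t. (deriv \<phi> t / \<phi> t)\<^sup>2) \<le> A"
    and "integrable (lebesgue_on {0<..<1}) (\<lambda>t. (deriv \<phi> t / \<phi> t)\<^sup>2)"
proof -
  have \<phi>: "\<phi> \<in> Q_plus R"
    and le: "(\<integral>\<^sup>+ t. ennreal ((deriv \<phi> t / \<phi> t)\<^sup>2) \<partial>lebesgue_on {0<..<1}) \<le> ennreal A"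
    using assms by (auto simp: J_feasible_def)
  note Q = Q_plusD[OF \<phi>]
  have "\<phi> t \<noteq> 0" if "t \<in> {0<..<1}" for t using Q(7)[of t] that by auto
  then have "continuous_on {0<..<1} (\<lambda>t. (deriv \<phi> t / \<phi> t)\<^sup>2)"
    by (intro continuous_intros Q(6) continuous_on_subset[OF Q(1), of "{0<..<1}"]) auto
  then have m: "(\<lambda>t. (deriv \<phi> t / \<phi> t)\<^sup>2) \<in> borel_measurable (lebesgue_on {0<..<1})"
    by (intro continuous_imp_measurable_on_sets_lebesgue) auto
  then show i: "integrable (lebesgue_on {0<..<1}) (\<lambda>t. (deriv \<phi> t / \<phi> t)\<^sup>2)"
    using le by (intro integrableI_nonneg) (auto intro: le_less_trans)
  show "(\<lambda>t. (deriv \<phi> t / \<phi> t)\<^sup>2) integrable_on {0..1}"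
    unfolding integrable_on_Icc_iff_Ioo using i by (intro integrable_on_lebesgue_on) auto
  have "ennreal (integral {0<..<1} (\<lambda>t. (deriv \<phi> t / \<phi> t)\<^sup>2)) \<le> ennreal A"
    using le lebesgue_integral_eq_integral[OF i] nn_integral_eq_integral[OF i] by simp
  then show "integral {0..1} (\<lambda>t. (deriv \<phi> t / \<phi> t)\<^sup>2) \<le> A"
    using assms(2) by (simp add: integral_open_interval_real)
qed

text \<open>For \<open>\<psi>\<close> the calibrating square vanishes identically and the second
  multiplier equation makes the constraint an equality. For a feasible \<open>\<phi>\<close> the
  square has nonnegative integral with the same boundary term, and \<open>l > 0\<close> gives the
  slack of the constraint the favourable sign, so comparing the two identities yields the
  minimum.\<close>

lemma J_minimum_of_ode:
  assumes R: "R > 1" and "A > 0" and l: "l > 0" and \<mu>: "\<mu> > 0"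
    and sys: "solves_multiplier_system R A l \<mu>"
    and \<psi>: "\<psi> \<in> Q_plus R"
    and ode: "\<forall>t\<in>{0..1}. (\<psi> has_real_derivative 1 / sqrt l * \<psi> t * root_term \<mu> (\<psi> t)) (at t)"
  shows "\<psi> \<in> J_feasible R A"
    and "\<And>\<phi>. \<phi> \<in> J_feasible R A \<Longrightarrow> J \<psi> \<le> J \<phi>"
    and "\<And>\<phi> t. \<phi> \<in> J_feasible R A \<Longrightarrow> J \<phi> \<le> J \<psi> \<Longrightarrow> t \<in> {0..1} \<Longrightarrow> \<phi> t = \<psi> t"
proof -
  note Q = Q_plusD[OF \<psi>]
  let ?b = "integral {1..R} (\<lambda>s. root_term \<mu> s / s)"
  have d: "deriv \<psi> t = 1 / sqrt l * \<psi> t * root_term \<mu> (\<psi> t)" if "t \<in> {0..1}" for t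
    using DERIV_imp_deriv ode that by blast
  have pos: "\<psi> t > 0" if "t \<in> {0..1}" for t using Q(7)[OF that] by simp
  have c: "deriv \<psi> t / \<psi> t = 1 / sqrt l * root_term \<mu> (\<psi> t)" if "t \<in> {0..1}" for t
    using d[OF that] pos[OF that] by simp
  have "((\<lambda>t. (deriv \<psi> t / \<psi> t)\<^sup>2) has_integral A) {0..1}"
  proof -
    \<comment> \<open>The differential equation turns one factor of (psi'/psi)^2 into r(psi) / sqrt
      l; what remains is an exact derivative, and its integral is the left side of the second
      multiplier equation.\<close>
    have "((\<lambda>t. root_term \<mu> (\<psi> t) / \<psi> t * deriv \<psi> t) has_integral
      integral {1..\<psi> 1} (\<lambda>s. root_term \<mu> s / s) - integral {1..\<psi> 0} (\<lambda>s. root_term \<mu> s / s)) {0..1}"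
      by (rule has_integral_compose_times_derivative[where b = R])
        (use Q in \<open>auto intro!: continuous_intros\<close>)
    then have "((\<lambda>t. 1 / sqrt l * (root_term \<mu> (\<psi> t) / \<psi> t * deriv \<psi> t)) has_integral 1 / sqrt l * ?b) {0..1}"
      using Q(2,3) by (intro has_integral_mult_right) simp
    moreover have "1 / sqrt l * ?b = A" using sys by (simp add: solves_multiplier_system_def)
    moreover have "1 / sqrt l * (root_term \<mu> (\<psi> t) / \<psi> t * deriv \<psi> t) = (deriv \<psi> t / \<psi> t)\<^sup>2"
      if "t \<in> {0..1}" for t
    proof -
      have "1 / sqrt l * (root_term \<mu> (\<psi> t) / \<psi> t * deriv \<psi> t) =
          (1 / sqrt l * root_term \<mu> (\<psi> t)) * (deriv \<psi> t / \<psi> t)" by simp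
      then show ?thesis unfolding c[OF that, symmetric] by (simp only: power2_eq_square)
    qed
    ultimately show ?thesis
      using has_integral_eq by (metis (no_types, lifting))
  qed
  note hA = this
  have i: "integrable (lebesgue_on {0<..<1}) (\<lambda>t. (deriv \<psi> t / \<psi> t)\<^sup>2)"
  proof -
    have "(\<lambda>t. (deriv \<psi> t / \<psi> t)\<^sup>2) absolutely_integrable_on {0<..<1}"
      using hA by (intro nonnegative_absolutely_integrable_1) (auto simp: integrable_on_Icc_iff_Ioo[symmetric])
    then show ?thesis by (simp add: absolutely_integrable_imp_integrable)
  qed
  have "integral {0<..<1} (\<lambda>t. (deriv \<psi> t / \<psi> t)\<^sup>2) = A"
    using hA by (simp add: has_integral_Icc_iff_Ioo integral_unique)
  then show feas: "\<psi> \<in> J_feasible R A"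
    using \<psi> nn_integral_eq_integral[OF i] lebesgue_integral_eq_integral[OF i]
    by (simp add: J_feasible_def)
  have ode': "sqrt l * deriv \<psi> t = \<psi> t * root_term \<mu> (\<psi> t)" if "t \<in> {0<..<1}" for t
    using d[of t] that l by simp
  have zero: "l * A + \<mu> + J \<psi> - 2 * sqrt l * ?b = 0"
  proof -
    have "((\<lambda>t. (sqrt l * (deriv \<psi> t / \<psi> t) - root_term \<mu> (\<psi> t))\<^sup>2) has_integral 0) {0..1}"
      by (rule has_integral_is_0) (use c l in auto)
    moreover have "((\<lambda>t. (sqrt l * (deriv \<psi> t / \<psi> t) - root_term \<mu> (\<psi> t))\<^sup>2) has_integral
        l * A + \<mu> + J \<psi> - 2 * sqrt l * ?b) {0..1}"
      using calibration_has_integral[OF \<psi> R l \<mu>] hA by (auto simp: integral_unique)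
    ultimately show ?thesis using has_integral_unique by blast
  qed
  have cal: "\<exists>I\<le>A. ((\<lambda>t. (sqrt l * (deriv \<phi> t / \<phi> t) - root_term \<mu> (\<phi> t))\<^sup>2) has_integral
        l * I + \<mu> + J \<phi> - 2 * sqrt l * ?b) {0..1}" if "\<phi> \<in> J_feasible R A" for \<phi>
    using J_feasible_imp_integrable[OF that] calibration_has_integral[OF _ R l \<mu>, of \<phi>] that \<open>A > 0\<close>
    by (auto simp: J_feasible_def)
  show "J \<psi> \<le> J \<phi>" if \<phi>: "\<phi> \<in> J_feasible R A" for \<phi>
  proof -
    obtain I where I: "I \<le> A" "((\<lambda>t. (sqrt l * (deriv \<phi> t / \<phi> t) - root_term \<mu> (\<phi> t))\<^sup>2) has_integral
        l * I + \<mu> + J \<phi> - 2 * sqrt l * ?b) {0..1}" using cal[OF \<phi>] by blast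
    have "l * I + \<mu> + J \<phi> - 2 * sqrt l * ?b \<ge> 0" by (rule has_integral_nonneg[OF I(2)]) simp
    moreover have "l * I \<le> l * A" using I l by simp
    ultimately show ?thesis using zero by simp
  qed
  show "\<phi> t = \<psi> t" if \<phi>: "\<phi> \<in> J_feasible R A" and le: "J \<phi> \<le> J \<psi>" and t: "t \<in> {0..1}" for \<phi> t
  proof -
    obtain I where I: "I \<le> A" "((\<lambda>t. (sqrt l * (deriv \<phi> t / \<phi> t) - root_term \<mu> (\<phi> t))\<^sup>2) has_integral
        l * I + \<mu> + J \<phi> - 2 * sqrt l * ?b) {0..1}" using cal[OF \<phi>] by blast
    have "l * I + \<mu> + J \<phi> - 2 * sqrt l * ?b \<ge> 0" by (rule has_integral_nonneg[OF I(2)]) simp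
    moreover have "l * I \<le> l * A" using I l by simp
    \<comment> \<open>Since J of \<open>\<phi>\<close> does not exceed J of \<open>\<psi>\<close>,
      the identity \<open>zero\<close> bounds the integral of the square above by 0 as well.\<close>
    ultimately have "l * I + \<mu> + J \<phi> - 2 * sqrt l * ?b = 0" using zero le by linarith
    then have z: "((\<lambda>t. (sqrt l * (deriv \<phi> t / \<phi> t) - root_term \<mu> (\<phi> t))\<^sup>2) has_integral 0) {0..1}"
      using I(2) by simp
    have \<phi>Q: "\<phi> \<in> Q_plus R" using \<phi> by (simp add: J_feasible_def)
    show ?thesis
      by (rule ode_solution_unique[OF \<phi>Q \<psi> l \<mu> ode_of_calibration_zero[OF \<phi>Q z] ode' t])
  qed
qed

text \<open>Two multiplier pairs would both produce the minimiser of \<open>J\<close>; comparing the two differential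
  equations at the endpoint values \<open>1\<close> and \<open>R\<close> identifies the pairs.\<close>

lemma multiplier_pair_unique:
  assumes R: "R > 1" and A: "A > 0" and l: "l > 0" "l' > 0" and \<mu>: "\<mu> > 0" "\<mu>' > 0"
    and sys: "solves_multiplier_system R A l \<mu>" "solves_multiplier_system R A l' \<mu>'"
  shows "l' = l \<and> \<mu>' = \<mu>"
proof -
  obtain \<psi> where \<psi>: "\<psi> \<in> Q_plus R"
    "\<forall>t\<in>{0..1}. (\<psi> has_real_derivative 1 / sqrt l * \<psi> t * root_term \<mu> (\<psi> t)) (at t)"
    using exists_ode_solution[OF R l(1) \<mu>(1)] sys(1) by (auto simp: solves_multiplier_system_def)
  obtain \<eta> where \<eta>: "\<eta> \<in> Q_plus R"
    "\<forall>t\<in>{0..1}. (\<eta> has_real_derivative 1 / sqrt l' * \<eta> t * root_term \<mu>' (\<eta> t)) (at t)"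
    using exists_ode_solution[OF R l(2) \<mu>(2)] sys(2) by (auto simp: solves_multiplier_system_def)
  note m1 = J_minimum_of_ode[OF R A l(1) \<mu>(1) sys(1) \<psi>]
  note m2 = J_minimum_of_ode[OF R A l(2) \<mu>(2) sys(2) \<eta>]
  have eq: "\<eta> t = \<psi> t" if "t \<in> {0..1}" for t
    by (rule m1(3)[OF m2(1) m2(2)[OF m1(1)] that])
  have key: "root_term \<mu> (\<psi> t) / sqrt l = root_term \<mu>' (\<psi> t) / sqrt l'" if t: "t \<in> {0..1}" for t
  proof -
    have "(\<eta> has_vector_derivative 1 / sqrt l' * \<eta> t * root_term \<mu>' (\<eta> t)) (at t)"
      using \<eta>(2) t by (simp add: has_real_derivative_iff_has_vector_derivative)
    \<comment> \<open>The two solutions are known to agree on [0,1] only. Their derivatives are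
      therefore compared within that interval, which still covers the times 0 and 1 where the values
      1 and R are taken.\<close>
    then have "(\<eta> has_vector_derivative 1 / sqrt l' * \<eta> t * root_term \<mu>' (\<eta> t)) (at t within {0..1})"
      by (rule has_vector_derivative_at_within)
    then have 1: "(\<psi> has_vector_derivative 1 / sqrt l' * \<eta> t * root_term \<mu>' (\<eta> t)) (at t within {0..1})"
      by (rule has_vector_derivative_transform[OF t, rotated]) (simp add: eq)
    have "(\<psi> has_vector_derivative 1 / sqrt l * \<psi> t * root_term \<mu> (\<psi> t)) (at t)"
      using \<psi>(2) t by (simp add: has_real_derivative_iff_has_vector_derivative)
    then have 2: "(\<psi> has_vector_derivative 1 / sqrt l * \<psi> t * root_term \<mu> (\<psi> t)) (at t within {0..1})"
      by (rule has_vector_derivative_at_within)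
    have "1 / sqrt l' * \<eta> t * root_term \<mu>' (\<eta> t) = 1 / sqrt l * \<psi> t * root_term \<mu> (\<psi> t)"
      by (rule vector_derivative_unique_within_closed_interval[of 0 1 t \<psi>]) (use 1 2 t in auto)
    then have "\<psi> t * (root_term \<mu> (\<psi> t) / sqrt l) = \<psi> t * (root_term \<mu>' (\<psi> t) / sqrt l')"
      by (simp add: eq[OF t])
    then show ?thesis using Q_plusD(7)[OF \<psi>(1) t] by (simp only: mult_cancel_left) auto
  qed
  have key2: "(\<mu> + (s\<^sup>2 - 1)\<^sup>2 + (s - 1)\<^sup>2) / l = (\<mu>' + (s\<^sup>2 - 1)\<^sup>2 + (s - 1)\<^sup>2) / l'"
    if "s = 1 \<or> s = R" for s
  proof -
    have "root_term \<mu> s / sqrt l = root_term \<mu>' s / sqrt l'"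
      using key[of 0] key[of 1] that Q_plusD(2,3)[OF \<psi>(1)] by auto
    then have "(root_term \<mu> s / sqrt l)\<^sup>2 = (root_term \<mu>' s / sqrt l')\<^sup>2" by simp
    then show ?thesis using l by (simp add: power_divide root_term_square[OF \<mu>(1)] root_term_square[OF \<mu>(2)])
  qed
  \<comment> \<open>At s = 1 the potential is 0, which identifies mu / l; at s = R it is
    \<open>G\<close> > 0, and subtracting the first identity leaves G / l.\<close>
  define G where "G = (R\<^sup>2 - 1)\<^sup>2 + (R - 1)\<^sup>2"
  have "G > 0" unfolding G_def using R by (intro add_nonneg_pos) auto
  have "\<mu> / l = \<mu>' / l'" using key2[of 1] by simp
  moreover have "(\<mu> + G) / l = (\<mu>' + G) / l'" using key2[of R] by (simp add: G_def add.assoc)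
  ultimately have "G / l = G / l'" by (simp add: add_divide_distrib)
  then have "l = l'" using \<open>G > 0\<close> l by (simp add: field_simps)
  then show ?thesis using \<open>\<mu> / l = \<mu>' / l'\<close> l by auto
qed

section \<open>Smooth functions and their partial derivatives\<close>

lemma Ck_on_Suc_imp: "Ck_on (Suc k) f U \<Longrightarrow> Ck_on k f U"
proof (induction k arbitrary: f)
  case 0
  then show ?case
    by (auto intro!: continuous_at_imp_continuous_on differentiable_imp_continuous_within)
next
  case (Suc k)
  show ?case
    unfolding Ck_on.simps(2)[of k]
    using Suc.prems Suc.IH unfolding Ck_on.simps(2)[of "Suc k"] by blast
qed

lemma Ck_on_bounded_linear:
  assumes "bounded_linear L"
  shows "Ck_on k L U"
proof (cases k)
  case 0
  then show ?thesis using assms by (auto intro: linear_continuous_on)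
next
  case (Suc j)
  have D: "(L has_derivative L) (at x)" for x
    using assms by (rule bounded_linear_imp_has_derivative)
  show ?thesis
    unfolding Suc Ck_on.simps frechet_derivative_at[OF D, symmetric]
    using D Ck_on_const by (blast intro: differentiableI)
qed

lemma Ck_on_SucI:
  assumes "\<And>x. (f has_derivative f' x) (at x)" "\<And>v. Ck_on k (\<lambda>x. f' x v) UNIV"
  shows "Ck_on (Suc k) f UNIV"
  using assms by (auto simp: frechet_derivative_at[OF assms(1), symmetric] intro: differentiableI)

lemma Ck_on_SucD:
  assumes "Ck_on (Suc k) f UNIV"
  shows "(f has_derivative frechet_derivative f (at x)) (at x)"
    "Ck_on k (\<lambda>x. frechet_derivative f (at x) v) UNIV"
  using assms by (auto simp: frechet_derivative_works)

lemma Ck_on_linear_compose: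
  assumes "bounded_linear L" "Ck_on k f UNIV"
  shows "Ck_on k (\<lambda>x. L (f x)) UNIV"
  using assms(2)
proof (induction k arbitrary: f)
  case 0
  then show ?case using assms(1) by (auto intro: bounded_linear.continuous_on)
next
  case (Suc k)
  show ?case
  proof (rule Ck_on_SucI)
    show "((\<lambda>x. L (f x)) has_derivative (\<lambda>v. L (frechet_derivative f (at x) v))) (at x)" for x
      by (rule bounded_linear.has_derivative[OF assms(1) Ck_on_SucD(1)[OF Suc.prems]])
    show "Ck_on k (\<lambda>x. L (frechet_derivative f (at x) v)) UNIV" for v
      by (rule Suc.IH[OF Ck_on_SucD(2)[OF Suc.prems]])
  qed
qed

lemma Ck_on_compose_linear:
  assumes "bounded_linear L" "Ck_on k f UNIV"
  shows "Ck_on k (\<lambda>x. f (L x)) UNIV"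
  using assms(2)
proof (induction k arbitrary: f)
  case 0
  have "continuous_on UNIV L" by (rule linear_continuous_on[OF assms(1)])
  then show ?case using 0 by (auto intro: continuous_on_compose2)
next
  case (Suc k)
  show ?case
  proof (rule Ck_on_SucI)
    show "((\<lambda>x. f (L x)) has_derivative (\<lambda>v. frechet_derivative f (at (L x)) (L v))) (at x)" for x
      by (rule has_derivative_compose[OF bounded_linear_imp_has_derivative[OF assms(1)]
            Ck_on_SucD(1)[OF Suc.prems]])
    show "Ck_on k (\<lambda>x. frechet_derivative f (at (L x)) (L v)) UNIV" for v
      by (rule Suc.IH[OF Ck_on_SucD(2)[OF Suc.prems]])
  qed
qed

lemma Ck_on_add:
  assumes "Ck_on k f UNIV" "Ck_on k g UNIV"
  shows "Ck_on k (\<lambda>x. f x + g x) UNIV"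
  using assms
proof (induction k arbitrary: f g)
  case 0
  then show ?case by (auto intro: continuous_intros)
next
  case (Suc k)
  show ?case
  proof (rule Ck_on_SucI)
    show "((\<lambda>x. f x + g x) has_derivative
        (\<lambda>v. frechet_derivative f (at x) v + frechet_derivative g (at x) v)) (at x)" for x
      by (intro has_derivative_add Ck_on_SucD(1)[OF Suc.prems(1)] Ck_on_SucD(1)[OF Suc.prems(2)])
    show "Ck_on k (\<lambda>x. frechet_derivative f (at x) v + frechet_derivative g (at x) v) UNIV" for v
      by (intro Suc.IH Ck_on_SucD(2)[OF Suc.prems(1)] Ck_on_SucD(2)[OF Suc.prems(2)])
  qed
qed

text \<open>Each summand of the product rule pairs the derivative of one factor with the other
  factor itself, so the induction also needs the undifferentiated factors at the lower
  order.\<close>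

lemma Ck_on_scaleR:
  assumes "Ck_on k f UNIV" "Ck_on k g UNIV"
  shows "Ck_on k (\<lambda>x. f x *\<^sub>R g x) UNIV"
  using assms
proof (induction k arbitrary: f g)
  case 0
  then show ?case by (auto intro: continuous_intros)
next
  case (Suc k)
  show ?case
  proof (rule Ck_on_SucI)
    show "((\<lambda>x. f x *\<^sub>R g x) has_derivative
        (\<lambda>v. f x *\<^sub>R frechet_derivative g (at x) v + frechet_derivative f (at x) v *\<^sub>R g x)) (at x)" for x
      by (rule has_derivative_scaleR[OF Ck_on_SucD(1)[OF Suc.prems(1)] Ck_on_SucD(1)[OF Suc.prems(2)]])
    show "Ck_on k (\<lambda>x. f x *\<^sub>R frechet_derivative g (at x) v + frechet_derivative f (at x) v *\<^sub>R g x) UNIV" for v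
      by (rule Ck_on_add[OF Suc.IH[OF Ck_on_Suc_imp[OF Suc.prems(1)] Ck_on_SucD(2)[OF Suc.prems(2)]]
            Suc.IH[OF Ck_on_SucD(2)[OF Suc.prems(1)] Ck_on_Suc_imp[OF Suc.prems(2)]]])
  qed
qed

definition smooth :: "('a::euclidean_space \<Rightarrow> 'b::euclidean_space) \<Rightarrow> bool" where
  "smooth f \<longleftrightarrow> (\<forall>k. Ck_on k f UNIV)"

lemma smooth_bounded_linear: "bounded_linear L \<Longrightarrow> smooth L"
  by (simp add: smooth_def Ck_on_bounded_linear)

lemma smooth_linear_compose: "bounded_linear L \<Longrightarrow> smooth f \<Longrightarrow> smooth (\<lambda>x. L (f x))"
  by (simp add: smooth_def Ck_on_linear_compose)

lemma smooth_compose_linear: "bounded_linear L \<Longrightarrow> smooth f \<Longrightarrow> smooth (\<lambda>x. f (L x))"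
  by (simp add: smooth_def Ck_on_compose_linear)

lemma smooth_add: "smooth f \<Longrightarrow> smooth g \<Longrightarrow> smooth (\<lambda>x. f x + g x)"
  by (simp add: smooth_def Ck_on_add)

lemma smooth_scaleR: "smooth f \<Longrightarrow> smooth g \<Longrightarrow> smooth (\<lambda>x. f x *\<^sub>R g x)"
  by (simp add: smooth_def Ck_on_scaleR)

lemma smooth_mult: "smooth f \<Longrightarrow> smooth g \<Longrightarrow> smooth (\<lambda>x. f x * g x :: real)"
  using smooth_scaleR[of f g] by simp

lemma smooth_cmult: "smooth f \<Longrightarrow> smooth (\<lambda>x. c * f x :: real)"
  by (rule smooth_linear_compose[OF bounded_linear_mult_right])

lemma smooth_component: "smooth f \<Longrightarrow> smooth (\<lambda>x. f x $ i :: real)"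
  for f :: "'a::euclidean_space \<Rightarrow> real^'n"
  by (rule smooth_linear_compose[OF bounded_linear_vec_nth])

lemma smooth_diff: "smooth f \<Longrightarrow> smooth g \<Longrightarrow> smooth (\<lambda>x. f x - g x :: real)"
  using smooth_add[OF _ smooth_cmult[of g "-1"], of f] by simp

lemma smooth_has_derivative:
  "smooth f \<Longrightarrow> (f has_derivative frechet_derivative f (at x)) (at x)"
  unfolding smooth_def using Ck_on_SucD(1) by blast

lemma smooth_continuous_on: "smooth f \<Longrightarrow> continuous_on S f"
  unfolding smooth_def by (metis Ck_on.simps(1) continuous_on_subset subset_UNIV)

lemma smooth_partial_deriv: "smooth f \<Longrightarrow> smooth (partial_deriv i f)"
  unfolding smooth_def partial_deriv_def[abs_def] using Ck_on_SucD(2) by blast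

lemma partial_deriv_eqI:
  "(f has_derivative f') (at x) \<Longrightarrow> partial_deriv i f x = f' (axis i 1)"
  by (simp add: partial_deriv_def frechet_derivative_at[symmetric])

lemma partial_deriv_diff:
  assumes "smooth f" "smooth g"
  shows "partial_deriv i (\<lambda>x. f x - g x) = (\<lambda>x. partial_deriv i f x - partial_deriv i g x)"
proof
  fix x
  show "partial_deriv i (\<lambda>x. f x - g x) x = partial_deriv i f x - partial_deriv i g x"
    using partial_deriv_eqI[OF has_derivative_diff[OF smooth_has_derivative[OF assms(1)]
      smooth_has_derivative[OF assms(2)]], of i x] by (simp add: partial_deriv_def)
qed

lemma partial_deriv_mult:
  assumes "smooth f" "smooth g"
  shows "partial_deriv i (\<lambda>x. f x * g x) x = f x * partial_deriv i g x + partial_deriv i f x * g x"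
  using partial_deriv_eqI[OF has_derivative_mult[OF smooth_has_derivative[OF assms(1)]
      smooth_has_derivative[OF assms(2)]], of i x] by (simp add: partial_deriv_def)

lemma partial_deriv_cmult:
  assumes "smooth f"
  shows "partial_deriv i (\<lambda>x. c * f x) = (\<lambda>x. c * partial_deriv i f x)"
proof
  fix x
  show "partial_deriv i (\<lambda>x. c * f x) x = c * partial_deriv i f x"
    using partial_deriv_eqI[OF has_derivative_mult_right[OF smooth_has_derivative[OF assms]], of i c x]
    by (simp add: partial_deriv_def)
qed

lemma partial_deriv_dilate:
  assumes "smooth f"
  shows "partial_deriv i (\<lambda>x. f (s *\<^sub>R x)) = (\<lambda>x. s * partial_deriv i f (s *\<^sub>R x))"
proof
  fix x
  have lin: "linear (frechet_derivative f (at (s *\<^sub>R x)))"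
    using smooth_has_derivative[OF assms] has_derivative_linear by blast
  have "((\<lambda>x. f (s *\<^sub>R x)) has_derivative (\<lambda>v. frechet_derivative f (at (s *\<^sub>R x)) (s *\<^sub>R v))) (at x)"
    by (rule has_derivative_compose[OF bounded_linear_imp_has_derivative[OF bounded_linear_scaleR_right]
          smooth_has_derivative[OF assms]])
  from partial_deriv_eqI[OF this]
  show "partial_deriv i (\<lambda>x. f (s *\<^sub>R x)) x = s * partial_deriv i f (s *\<^sub>R x)"
    by (simp add: partial_deriv_def linear_cmul[OF lin])
qed

text \<open>\<open>K\<close> is any set outside which the function vanishes, not the exact support,
  so that one \<open>K\<close> can serve a function together with its derivatives and
  products.\<close>

definition supported_in :: "(real^2) set \<Rightarrow> (real^2 \<Rightarrow> 'b::zero) \<Rightarrow> bool" where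
  "supported_in K f \<longleftrightarrow> (\<forall>x. x \<notin> K \<longrightarrow> f x = 0)"

lemma supported_inD: "supported_in K f \<Longrightarrow> x \<notin> K \<Longrightarrow> f x = 0"
  by (simp add: supported_in_def)

lemma supported_in_partial_deriv:
  assumes "closed K" "supported_in K f"
  shows "supported_in K (partial_deriv i f)"
  unfolding supported_in_def
proof (intro allI impI)
  fix x assume x: "x \<notin> K"
  have "((\<lambda>x. 0) has_derivative (\<lambda>v. 0)) (at x)" by simp
  then have "(f has_derivative (\<lambda>v. 0)) (at x)"
    by (rule has_derivative_transform_within_open[of _ _ _ _ "- K"])
      (use assms x in \<open>auto simp: supported_in_def\<close>)
  from partial_deriv_eqI[OF this] show "partial_deriv i f x = 0" by simp
qed

text \<open>Every multi-derivative of order at most \<open>k\<close> arises from \<open>D\<^sup>(\<^sup>0\<^sup>,\<^sup>0\<^sup>)\<close> by single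
  partial derivatives without leaving the set of multi-indices.\<close>

lemma multi_index_induct [consumes 1, case_names zero step]:
  assumes "\<alpha> \<in> multi_indices k" and "P (0, 0)"
    and step: "\<And>\<alpha> \<beta> i. \<alpha> \<in> multi_indices k \<Longrightarrow> \<beta> \<in> multi_indices k \<Longrightarrow> P \<alpha> \<Longrightarrow>
      fst \<beta> + snd \<beta> = Suc (fst \<alpha> + snd \<alpha>) \<Longrightarrow>
      (\<And>f. multi_deriv \<beta> f = partial_deriv i (multi_deriv \<alpha> f)) \<Longrightarrow> P \<beta>"
  shows "P \<alpha>"
proof -
  obtain a b where \<alpha>: "\<alpha> = (a, b)" "a + b \<le> k" using assms(1) by (auto simp: multi_indices_def)
  \<comment> \<open>\<open>multi_deriv\<close> applies the second partial derivative first and the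
    first one outermost. Raising the second index before the first therefore adds each new
    derivative on the outside.\<close>
  have 0: "P (0, b)" if "b \<le> k" for b
    using that
  proof (induction b)
    case (Suc b)
    show ?case
      by (rule step[of "(0, b)" _ 2]) (use Suc in \<open>auto simp: multi_indices_def multi_deriv_def\<close>)
  qed (rule assms(2))
  have "P (a, b)" if "a + b \<le> k" for a b
    using that
  proof (induction a)
    case (Suc a)
    show ?case
      by (rule step[of "(a, b)" _ 1]) (use Suc in \<open>auto simp: multi_indices_def multi_deriv_def\<close>)
  qed (use 0 in simp)
  then show ?thesis using \<alpha> by simp
qed

lemma multi_deriv_zero [simp]: "multi_deriv (0, 0) f = f"
  by (simp add: multi_deriv_def)

text \<open>Allows the bounded induction over multi-indices to be used for a single
  \<open>\<alpha>\<close>, with its own order as the bound.\<close>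

lemma multi_index_self: "\<alpha> \<in> multi_indices (fst \<alpha> + snd \<alpha>)"
  by (cases \<alpha>) (simp add: multi_indices_def)

lemma smooth_multi_deriv: "smooth f \<Longrightarrow> smooth (multi_deriv \<alpha> f)"
  by (induction rule: multi_index_induct[OF multi_index_self[of \<alpha>]]) (auto intro: smooth_partial_deriv)

lemma multi_deriv_diff:
  assumes "smooth f" "smooth g"
  shows "multi_deriv \<alpha> (\<lambda>x. f x - g x) = (\<lambda>x. multi_deriv \<alpha> f x - multi_deriv \<alpha> g x)"
  by (induction rule: multi_index_induct[OF multi_index_self[of \<alpha>]])
    (auto simp: partial_deriv_diff smooth_multi_deriv assms)

lemma multi_deriv_cmult:
  assumes "smooth f"
  shows "multi_deriv \<alpha> (\<lambda>x. c * f x) = (\<lambda>x. c * multi_deriv \<alpha> f x)"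
  by (induction rule: multi_index_induct[OF multi_index_self[of \<alpha>]])
    (auto simp: partial_deriv_cmult smooth_multi_deriv assms)

lemma multi_deriv_dilate:
  assumes "smooth f"
  shows "multi_deriv \<alpha> (\<lambda>x. f (s *\<^sub>R x)) = (\<lambda>x. s ^ (fst \<alpha> + snd \<alpha>) * multi_deriv \<alpha> f (s *\<^sub>R x))"
proof (induction rule: multi_index_induct[OF multi_index_self[of \<alpha>]])
  case (2 \<alpha> \<beta> i)
  have "smooth (\<lambda>x. multi_deriv \<alpha> f (s *\<^sub>R x))"
    by (rule smooth_compose_linear[OF bounded_linear_scaleR_right smooth_multi_deriv[OF assms]])
  then show ?case
    using 2 by (simp add: partial_deriv_cmult partial_deriv_dilate smooth_multi_deriv assms mult.assoc mult.left_commute)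
qed simp

lemma supported_in_multi_deriv:
  assumes "closed K" "supported_in K f"
  shows "supported_in K (multi_deriv \<alpha> f)"
  by (induction rule: multi_index_induct[OF multi_index_self[of \<alpha>]])
    (auto intro: supported_in_partial_deriv assms)

section \<open>Weak derivatives of time-dependent multiples of a fixed field\<close>

lemma compact_support_integrable:
  fixes f :: "real^2 \<Rightarrow> real"
  assumes "continuous_on UNIV f" "compact K" "supported_in K f"
  shows "integrable lborel f"
proof -
  have "integrable lborel (\<lambda>x. indicator K x *\<^sub>R f x)"
    by (rule borel_integrable_compact[OF assms(2)]) (use assms(1) continuous_on_subset in blast)
  moreover have "(\<lambda>x. indicator K x *\<^sub>R f x) = f"
    using assms(3) by (auto simp: indicator_def fun_eq_iff supported_in_def)
  ultimately show ?thesis by simp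
qed

lemma compact_support_bounded:
  fixes f :: "real^2 \<Rightarrow> real"
  assumes "continuous_on UNIV f" "compact K" "supported_in K f"
  obtains B where "B \<ge> 0" "\<And>x. \<bar>f x\<bar> \<le> B"
proof -
  have "compact (f ` K)"
    using assms by (intro compact_continuous_image) (auto intro: continuous_on_subset)
  then obtain B where "\<forall>y\<in>f ` K. norm y \<le> B" using compact_imp_bounded bounded_iff by blast
  then have "\<bar>f x\<bar> \<le> max B 0" for x using supported_inD[OF assms(3), of x] by (cases "x \<in> K") auto
  then show ?thesis using that[of "max B 0"] by auto
qed

text \<open>By translation invariance the difference quotients have integral zero.\<close>

lemma integral_partial_deriv_eq_0:
  assumes f: "smooth f" and K: "compact K" "supported_in K f"
  shows "integral\<^sup>L lborel (partial_deriv i f) = 0"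
proof -
  define e :: "real^2" where "e = axis i 1"
  have ne: "norm e = 1" by (simp add: e_def norm_axis_1)
  obtain B where B: "B \<ge> 0" "\<And>x. \<bar>partial_deriv i f x\<bar> \<le> B"
    using compact_support_bounded[OF smooth_continuous_on[OF smooth_partial_deriv[OF f]] K(1)
      supported_in_partial_deriv[OF compact_imp_closed[OF K(1)] K(2)]] by metis
  obtain r where r: "K \<subseteq> cball 0 r" using compact_imp_bounded[OF K(1)] by (auto simp: bounded_iff subset_iff)
  define q where "q = (\<lambda>n x. (f (x + (1 / real (Suc n)) *\<^sub>R e) - f x) * real (Suc n))"
  have cf: "continuous_on UNIV f" by (rule smooth_continuous_on[OF f])
  have fm: "f \<in> borel_measurable borel" by (rule borel_measurable_continuous_onI[OF cf])
  have fi: "integrable lborel f" by (rule compact_support_integrable[OF cf K])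
  have line: "((\<lambda>s. f (x + s *\<^sub>R e)) has_real_derivative partial_deriv i f (x + s *\<^sub>R e)) (at s)" for x s
  proof -
    have "((\<lambda>s. x + s *\<^sub>R e) has_derivative (\<lambda>h. h *\<^sub>R e)) (at s)"
      by (auto intro!: derivative_eq_intros)
    from has_derivative_compose[OF this smooth_has_derivative[OF f]]
    have "((\<lambda>s. f (x + s *\<^sub>R e)) has_derivative
        (\<lambda>h. frechet_derivative f (at (x + s *\<^sub>R e)) (h *\<^sub>R e))) (at s)" .
    moreover have "frechet_derivative f (at y) (h *\<^sub>R e) = partial_deriv i f y * h" for y h
      using linear_cmul[OF has_derivative_linear[OF smooth_has_derivative[OF f]]]
      by (simp add: partial_deriv_def e_def)
    ultimately show ?thesis by (simp add: has_field_derivative_def)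
  qed
  have "(\<lambda>n. integral\<^sup>L lborel (q n)) \<longlonglongrightarrow> integral\<^sup>L lborel (partial_deriv i f)"
  \<comment> \<open>The mean value theorem bounds each difference quotient by the bound
    \<open>B\<close> of the derivative, and steps of length at most 1 keep the supports inside the
    ball of radius r + 1.\<close>
  proof (rule integral_dominated_convergence[where w = "\<lambda>x. B * indicator (cball 0 (r + 1)) x"])
    show "partial_deriv i f \<in> borel_measurable lborel"
      using borel_measurable_continuous_onI[OF smooth_continuous_on[OF smooth_partial_deriv[OF f]]]
      by simp
    show "q n \<in> borel_measurable lborel" for n
    proof -
      have "continuous_on UNIV (q n)"
        unfolding q_def by (intro continuous_intros continuous_on_compose2[OF cf]) auto
      from borel_measurable_continuous_onI[OF this] show ?thesis by simp
    qed
    show "integrable lborel (\<lambda>x. B * indicator (cball 0 (r + 1)) x)"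
      by (intro integrable_mult_right integrable_real_indicator) (use emeasure_lborel_cball_finite[of 0 "r + 1"] in \<open>auto simp: less_top\<close>)
    show "AE x in lborel. (\<lambda>n. q n x) \<longlonglongrightarrow> partial_deriv i f x"
    proof (rule AE_I2)
      fix x
      have "((\<lambda>h. (f (x + h *\<^sub>R e) - f x) / h) \<longlongrightarrow> partial_deriv i f x) (at 0)"
        using line[of x 0] by (simp add: has_field_derivative_iff)
      moreover have "filterlim (\<lambda>n. 1 / real (Suc n)) (at 0) sequentially"
        using LIMSEQ_Suc[OF lim_1_over_n[where 'a = real]]
        by (auto simp: filterlim_at divide_inverse)
      ultimately have "(\<lambda>n. (f (x + (1 / real (Suc n)) *\<^sub>R e) - f x) / (1 / real (Suc n))) \<longlonglongrightarrow> partial_deriv i f x"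
        by (rule filterlim_compose)
      then show "(\<lambda>n. q n x) \<longlonglongrightarrow> partial_deriv i f x" by (simp add: q_def)
    qed
    show "AE x in lborel. norm (q n x) \<le> B * indicator (cball 0 (r + 1)) x" for n
    proof (rule AE_I2)
      fix x
      have h: "0 < 1 / real (Suc n)" "1 / real (Suc n) \<le> 1" by (auto simp: field_simps)
      show "norm (q n x) \<le> B * indicator (cball 0 (r + 1)) x"
      proof (cases "x \<in> cball 0 (r + 1)")
        case True
        obtain z where "f (x + (1 / real (Suc n)) *\<^sub>R e) - f (x + 0 *\<^sub>R e)
            = (1 / real (Suc n) - 0) * partial_deriv i f (x + z *\<^sub>R e)"
          using MVT2[OF h(1), of "\<lambda>s. f (x + s *\<^sub>R e)" "\<lambda>s. partial_deriv i f (x + s *\<^sub>R e)"] line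
          by blast
        then have "q n x = partial_deriv i f (x + z *\<^sub>R e)" by (simp add: q_def)
        then show ?thesis using B True by simp
      next
        case False
        have "norm x \<le> norm (x + (1 / real (Suc n)) *\<^sub>R e) + norm ((1 / real (Suc n)) *\<^sub>R e)"
          using norm_triangle_ineq4[of "x + (1 / real (Suc n)) *\<^sub>R e" "(1 / real (Suc n)) *\<^sub>R e"] by simp
        moreover have "norm ((1 / real (Suc n)) *\<^sub>R e) \<le> 1" using h ne by simp
        moreover have "norm x > r + 1" using False by simp
        ultimately have "norm (x + (1 / real (Suc n)) *\<^sub>R e) > r" "norm x > r" by linarith+
        then have "x + (1 / real (Suc n)) *\<^sub>R e \<notin> K" "x \<notin> K" using r by auto
        then show ?thesis using False by (simp add: q_def supported_inD[OF K(2)])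
      qed
    qed
  qed
  moreover have "integral\<^sup>L lborel (q n) = 0" for n
  proof -
    have "distr lborel borel ((+) ((1 / real (Suc n)) *\<^sub>R e)) = lborel" by (rule lborel_distr_plus)
    then have eq: "integral\<^sup>L lborel f = integral\<^sup>L lborel (\<lambda>x. f ((1 / real (Suc n)) *\<^sub>R e + x))"
      using integral_distr[of "(+) ((1 / real (Suc n)) *\<^sub>R e)" lborel borel f] fm by simp
    have "integrable lborel (\<lambda>x. f ((1 / real (Suc n)) *\<^sub>R e + x))"
      using integrable_distr_eq[of "(+) ((1 / real (Suc n)) *\<^sub>R e)" lborel borel f] fm fi
        lborel_distr_plus[of "(1 / real (Suc n)) *\<^sub>R e"] by simp
    then show ?thesis using fi eq by (simp add: q_def add.commute)
  qed
  ultimately have "(\<lambda>n. 0) \<longlonglongrightarrow> integral\<^sup>L lborel (partial_deriv i f)" by simp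
  then show ?thesis using LIMSEQ_unique[OF tendsto_const] by fastforce
qed

lemma integral_lebesgue_on_eq_lborel:
  fixes f :: "real^2 \<Rightarrow> real"
  assumes "continuous_on UNIV f" "K \<subseteq> \<Omega>" "supported_in K f" "\<Omega> \<in> sets lebesgue"
  shows "integral\<^sup>L (lebesgue_on \<Omega>) f = integral\<^sup>L lborel f"
proof -
  have "integral\<^sup>L (lebesgue_on \<Omega>) f = integral\<^sup>L lebesgue (\<lambda>x. indicator \<Omega> x *\<^sub>R f x)"
    using assms(4) by (simp add: integral_restrict_space)
  also have "(\<lambda>x. indicator \<Omega> x *\<^sub>R f x) = f"
    using assms(2,3) by (auto simp: indicator_def fun_eq_iff supported_in_def)
  also have "integral\<^sup>L lebesgue f = integral\<^sup>L lborel f"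
    using borel_measurable_continuous_onI[OF assms(1)] by (intro integral_completion) auto
  finally show ?thesis .
qed

text \<open>The product inherits compact support from \<open>f\<close>, so its partial derivative
  has integral 0, and the product rule splits that integral into the two terms.\<close>

lemma integration_by_parts:
  assumes f: "smooth f" and g: "smooth g" and K: "compact K" "K \<subseteq> \<Omega>" "supported_in K f"
    and \<Omega>: "\<Omega> \<in> sets lebesgue"
  shows "(LINT x|lebesgue_on \<Omega>. partial_deriv i f x * g x) = - (LINT x|lebesgue_on \<Omega>. f x * partial_deriv i g x)"
proof -
  have z: "supported_in K (\<lambda>x. partial_deriv i f x * g x)" "supported_in K (\<lambda>x. f x * partial_deriv i g x)"
    "supported_in K (\<lambda>x. f x * g x)"
    using K(3) supported_in_partial_deriv[OF compact_imp_closed[OF K(1)] K(3), of i]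
    by (auto simp: supported_in_def)
  have c: "continuous_on UNIV (\<lambda>x. partial_deriv i f x * g x)" "continuous_on UNIV (\<lambda>x. f x * partial_deriv i g x)"
    by (intro smooth_continuous_on smooth_mult smooth_partial_deriv f g)+
  have "0 = integral\<^sup>L lborel (partial_deriv i (\<lambda>x. f x * g x))"
    by (rule integral_partial_deriv_eq_0[OF smooth_mult[OF f g] K(1) z(3), symmetric])
  also have "partial_deriv i (\<lambda>x. f x * g x) = (\<lambda>x. f x * partial_deriv i g x + partial_deriv i f x * g x)"
    by (rule ext) (rule partial_deriv_mult[OF f g])
  also have "integral\<^sup>L lborel \<dots> = integral\<^sup>L lborel (\<lambda>x. f x * partial_deriv i g x)
      + integral\<^sup>L lborel (\<lambda>x. partial_deriv i f x * g x)"
    by (intro Bochner_Integration.integral_add compact_support_integrable[OF c(2) K(1) z(2)]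
        compact_support_integrable[OF c(1) K(1) z(1)])
  finally show ?thesis
    using integral_lebesgue_on_eq_lborel[OF c(1) K(2) z(1) \<Omega>]
      integral_lebesgue_on_eq_lborel[OF c(2) K(2) z(2) \<Omega>] by simp
qed

section \<open>Limits in L2 and closability\<close>

lemma ennreal_tendsto_0_of_square:
  fixes X :: "nat \<Rightarrow> ennreal"
  assumes "(\<lambda>n. (X n)\<^sup>2) \<longlonglongrightarrow> 0"
  shows "X \<longlonglongrightarrow> 0"
proof (rule order_tendstoI)
  fix a :: ennreal assume "0 < a"
  then have "0 < a\<^sup>2" by (simp add: ennreal_zero_less_mult_iff power2_eq_square)
  then have "\<forall>\<^sub>F n in sequentially. (X n)\<^sup>2 < a\<^sup>2" using assms by (auto simp: order_tendsto_iff)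
  then show "\<forall>\<^sub>F n in sequentially. X n < a"
  proof (rule eventually_mono)
    fix n assume "(X n)\<^sup>2 < a\<^sup>2"
    then show "X n < a" using power_mono[of a "X n" 2] by (meson linorder_not_le zero_le)
  qed
qed simp

text \<open>Cauchy-Schwarz for nonnegative integrals bounds the square of the pairing by a finite
  constant times a null sequence. Working with squares keeps roots of extended reals out of the
  argument.\<close>

lemma L2_pairing_tendsto_0:
  fixes f :: "'a \<Rightarrow> real"
  assumes f: "f \<in> borel_measurable M" "integrable M (\<lambda>x. (f x)\<^sup>2)"
    and g: "\<And>n. g n \<in> borel_measurable M" "(\<lambda>n. \<integral>\<^sup>+x. ennreal ((g n x)\<^sup>2) \<partial>M) \<longlonglongrightarrow> 0"
  shows "(\<lambda>n. \<integral>\<^sup>+x. ennreal \<bar>f x * g n x\<bar> \<partial>M) \<longlonglongrightarrow> 0"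
proof (rule ennreal_tendsto_0_of_square)
  let ?F = "nn_integral M (\<lambda>x. ennreal ((f x)\<^sup>2))"
  have "?F < top" using f(2) by (simp add: integrable_iff_bounded)
  then have lim: "(\<lambda>n. ?F * (\<integral>\<^sup>+x. ennreal ((g n x)\<^sup>2) \<partial>M)) \<longlonglongrightarrow> ?F * 0"
    by (intro ennreal_tendsto_cmult g(2)) auto
  have le: "(\<integral>\<^sup>+x. ennreal \<bar>f x * g n x\<bar> \<partial>M)\<^sup>2 \<le> ?F * (\<integral>\<^sup>+x. ennreal ((g n x)\<^sup>2) \<partial>M)" for n
  proof -
    have "(\<integral>\<^sup>+x. ennreal \<bar>f x\<bar> * ennreal \<bar>g n x\<bar> \<partial>M)\<^sup>2
        \<le> (\<integral>\<^sup>+x. (ennreal \<bar>f x\<bar>)\<^sup>2 \<partial>M) * (\<integral>\<^sup>+x. (ennreal \<bar>g n x\<bar>)\<^sup>2 \<partial>M)"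
      using f(1) g(1)[of n] by (intro Cauchy_Schwarz_nn_integral) auto
    then show ?thesis by (simp add: ennreal_power abs_mult ennreal_mult)
  qed
  show "(\<lambda>n. (\<integral>\<^sup>+x. ennreal \<bar>f x * g n x\<bar> \<partial>M)\<^sup>2) \<longlonglongrightarrow> 0"
    by (rule tendsto_sandwich[OF _ _ tendsto_const]) (use lim le in auto)
qed

lemma L2_product_integrable:
  fixes f g :: "'a \<Rightarrow> real"
  assumes "f \<in> borel_measurable M" "g \<in> borel_measurable M"
    and "integrable M (\<lambda>x. (f x)\<^sup>2)" "integrable M (\<lambda>x. (g x)\<^sup>2)"
  shows "integrable M (\<lambda>x. f x * g x)"
proof (rule Bochner_Integration.integrable_bound)
  show "integrable M (\<lambda>x. (f x)\<^sup>2 + (g x)\<^sup>2)" using assms by simp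
  have "\<bar>a * b\<bar> \<le> a\<^sup>2 + b\<^sup>2" for a b :: real
  proof -
    have "2 * \<bar>a\<bar> * \<bar>b\<bar> \<le> \<bar>a\<bar>\<^sup>2 + \<bar>b\<bar>\<^sup>2" by (rule sum_squares_bound)
    moreover have "0 \<le> \<bar>a\<bar> * \<bar>b\<bar>" by simp
    ultimately show ?thesis unfolding abs_mult by (simp only: power2_abs)
  qed
  then show "AE x in M. norm (f x * g x) \<le> norm ((f x)\<^sup>2 + (g x)\<^sup>2)" by simp
qed (use assms in measurable)

lemma L2_diff_tendsto_0:
  fixes p q :: "nat \<Rightarrow> 'a \<Rightarrow> real"
  assumes "\<And>n. p n \<in> borel_measurable M" "\<And>n. q n \<in> borel_measurable M"
    and "(\<lambda>n. \<integral>\<^sup>+x. ennreal ((p n x)\<^sup>2) \<partial>M) \<longlonglongrightarrow> 0" "(\<lambda>n. \<integral>\<^sup>+x. ennreal ((q n x)\<^sup>2) \<partial>M) \<longlonglongrightarrow> 0"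
  shows "(\<lambda>n. \<integral>\<^sup>+x. ennreal ((p n x - q n x)\<^sup>2) \<partial>M) \<longlonglongrightarrow> 0"
proof -
  have le: "(\<integral>\<^sup>+x. ennreal ((p n x - q n x)\<^sup>2) \<partial>M)
      \<le> 2 * (\<integral>\<^sup>+x. ennreal ((p n x)\<^sup>2) \<partial>M) + 2 * (\<integral>\<^sup>+x. ennreal ((q n x)\<^sup>2) \<partial>M)" for n
  proof -
    have "ennreal ((a - b)\<^sup>2) \<le> 2 * ennreal (a\<^sup>2) + 2 * ennreal (b\<^sup>2)" for a b :: real
    proof -
      have "(a - b)\<^sup>2 + (a + b)\<^sup>2 = 2 * a\<^sup>2 + 2 * b\<^sup>2" by (simp add: power2_eq_square algebra_simps)
      then have "(a - b)\<^sup>2 \<le> 2 * a\<^sup>2 + 2 * b\<^sup>2" by (smt (verit) zero_le_power2)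
      then have "ennreal ((a - b)\<^sup>2) \<le> ennreal (2 * a\<^sup>2 + 2 * b\<^sup>2)" by (rule ennreal_leI)
      then show ?thesis by (simp add: ennreal_plus ennreal_mult)
    qed
    then have "(\<integral>\<^sup>+x. ennreal ((p n x - q n x)\<^sup>2) \<partial>M) \<le> (\<integral>\<^sup>+x. 2 * ennreal ((p n x)\<^sup>2) + 2 * ennreal ((q n x)\<^sup>2) \<partial>M)"
      by (intro nn_integral_mono)
    also have "\<dots> = 2 * (\<integral>\<^sup>+x. ennreal ((p n x)\<^sup>2) \<partial>M) + 2 * (\<integral>\<^sup>+x. ennreal ((q n x)\<^sup>2) \<partial>M)"
      using assms(1,2)[of n] by (subst nn_integral_add) (auto simp: nn_integral_cmult)
    finally show ?thesis .
  qed
  have "(\<lambda>n. 2 * (\<integral>\<^sup>+x. ennreal ((p n x)\<^sup>2) \<partial>M) + 2 * (\<integral>\<^sup>+x. ennreal ((q n x)\<^sup>2) \<partial>M)) \<longlonglongrightarrow> 2 * 0 + 2 * 0"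
    by (intro tendsto_add ennreal_tendsto_cmult assms) auto
  then have lim: "(\<lambda>n. 2 * (\<integral>\<^sup>+x. ennreal ((p n x)\<^sup>2) \<partial>M) + 2 * (\<integral>\<^sup>+x. ennreal ((q n x)\<^sup>2) \<partial>M)) \<longlonglongrightarrow> 0"
    by simp
  show ?thesis
    by (rule tendsto_sandwich[OF _ _ tendsto_const lim]) (use le in auto)
qed

lemma smooth_measurable: "smooth f \<Longrightarrow> f \<in> borel_measurable (lebesgue_on \<Omega>)"
  for f :: "real^2 \<Rightarrow> real"
proof -
  assume "smooth f"
  then have "f \<in> borel_measurable lborel"
    using borel_measurable_continuous_onI[OF smooth_continuous_on] by simp
  then show "f \<in> borel_measurable (lebesgue_on \<Omega>)"
    by (intro measurable_restrict_space1 measurable_completion)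
qed

lemma compact_support_square_integrable:
  assumes "smooth f" "compact K" "supported_in K f" "\<Omega> \<in> sets lebesgue"
  shows "integrable (lebesgue_on \<Omega>) (\<lambda>x. (f x :: real)\<^sup>2)"
proof -
  have c: "continuous_on UNIV (\<lambda>x. (f x)\<^sup>2)"
    using smooth_continuous_on[OF assms(1), of UNIV] by (intro continuous_intros)
  have "integrable lborel (\<lambda>x. (f x)\<^sup>2)"
    by (rule compact_support_integrable[OF c assms(2)]) (use assms(3) in \<open>simp add: supported_in_def\<close>)
  then have "integrable lebesgue (\<lambda>x. (f x)\<^sup>2)" by (simp add: integrable_completion)
  then show ?thesis using assms(4)
    by (simp add: integrable_restrict_space integrable_mult_indicator del: real_scaleR_def)
qed

text \<open>Closability of a partial derivative on test functions.  With \<open>a\<^sub>n = D w\<^sub>n\<close> one has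
  \<open>\<langle>a\<^sub>n, h\<rangle> = lim\<^sub>m \<langle>a\<^sub>n, a\<^sub>m\<rangle> = - lim\<^sub>m \<langle>D a\<^sub>n, w\<^sub>m\<rangle> = 0\<close>, and hence
  \<open>\<langle>h, h\<rangle> = lim\<^sub>n \<langle>a\<^sub>n, h\<rangle> = 0\<close>.\<close>

lemma partial_deriv_closable:
  fixes w :: "nat \<Rightarrow> real^2 \<Rightarrow> real" and h :: "real^2 \<Rightarrow> real"
  assumes \<Omega>: "\<Omega> \<in> sets lebesgue" and w: "\<And>n. smooth (w n)"
    and K: "\<And>n. compact (K n)" "\<And>n. K n \<subseteq> \<Omega>" "\<And>n. supported_in (K n) (w n)"
    and w0: "(\<lambda>n. \<integral>\<^sup>+x. ennreal ((w n x)\<^sup>2) \<partial>lebesgue_on \<Omega>) \<longlonglongrightarrow> 0"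
    and h: "h \<in> borel_measurable (lebesgue_on \<Omega>)" "integrable (lebesgue_on \<Omega>) (\<lambda>x. (h x)\<^sup>2)"
    and Dw: "(\<lambda>n. \<integral>\<^sup>+x. ennreal ((partial_deriv i (w n) x - h x)\<^sup>2) \<partial>lebesgue_on \<Omega>) \<longlonglongrightarrow> 0"
  shows "AE x in lebesgue_on \<Omega>. h x = 0"
proof -
  let ?M = "lebesgue_on \<Omega>"
  define a where "a = (\<lambda>n. partial_deriv i (w n))"
  \<comment> \<open>In the inner limit n is fixed and m tends to infinity, so \<open>b n\<close>, a
    second derivative, is one fixed square integrable function paired with the null sequence
    \<open>w m\<close>.\<close>
  define b where "b = (\<lambda>n. partial_deriv i (a n))"
  have sa: "smooth (a n)" and sb: "smooth (b n)" for n
    by (auto simp: a_def b_def intro: smooth_partial_deriv w)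
  have Ka: "supported_in (K n) (a n)" for n
    unfolding a_def by (rule supported_in_partial_deriv[OF compact_imp_closed[OF K(1)] K(3)])
  have Kb: "supported_in (K n) (b n)" for n
    unfolding b_def by (rule supported_in_partial_deriv[OF compact_imp_closed[OF K(1)] Ka])
  note meas = smooth_measurable[OF sa] smooth_measurable[OF sb] smooth_measurable[OF w] h(1)
  note int = compact_support_square_integrable[OF sa K(1) Ka \<Omega>]
    compact_support_square_integrable[OF sb K(1) Kb \<Omega>] compact_support_square_integrable[OF w K(1,3) \<Omega>]
  have diff_meas: "(\<lambda>x. a n x - h x) \<in> borel_measurable ?M" for n using meas by measurable
  have diff_int: "integrable ?M (\<lambda>x. (a n x - h x)\<^sup>2)" for n
    using int(1)[of n] h(2) L2_product_integrable[OF meas(1) h(1) int(1) h(2), of n]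
    by (simp add: power2_diff mult.assoc)
  have Dw': "(\<lambda>n. \<integral>\<^sup>+x. ennreal ((a n x - h x)\<^sup>2) \<partial>?M) \<longlonglongrightarrow> 0" using Dw by (simp add: a_def)
  have ortho: "(LINT x|?M. a n x * h x) = 0" for n
  proof -
    have le: "ennreal \<bar>LINT x|?M. a n x * h x\<bar>
        \<le> (\<integral>\<^sup>+x. ennreal \<bar>a n x * (a m x - h x)\<bar> \<partial>?M) + (\<integral>\<^sup>+x. ennreal \<bar>b n x * w m x\<bar> \<partial>?M)" for m
    proof -
      have i1: "integrable ?M (\<lambda>x. a n x * (a m x - h x))"
        by (rule L2_product_integrable[OF meas(1) diff_meas int(1) diff_int])
      have i2: "integrable ?M (\<lambda>x. a n x * h x)"
        by (rule L2_product_integrable[OF meas(1) h(1) int(1) h(2)])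
      have i3: "integrable ?M (\<lambda>x. a n x * a m x)"
        by (rule L2_product_integrable[OF meas(1) meas(1) int(1) int(1)])
      have i4: "integrable ?M (\<lambda>x. b n x * w m x)"
        by (rule L2_product_integrable[OF meas(2) meas(3) int(2) int(3)])
      have "(LINT x|?M. a n x * (a m x - h x)) = (LINT x|?M. a n x * a m x) - (LINT x|?M. a n x * h x)"
        using i2 i3 by (simp add: right_diff_distrib)
      moreover have "(LINT x|?M. b n x * w m x) = - (LINT x|?M. a n x * a m x)"
        using integration_by_parts[OF sa w K(1,2) Ka \<Omega>] by (simp add: a_def b_def)
      ultimately have "\<bar>LINT x|?M. a n x * h x\<bar>
          \<le> \<bar>LINT x|?M. a n x * (a m x - h x)\<bar> + \<bar>LINT x|?M. b n x * w m x\<bar>" by linarith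
      then have "ennreal \<bar>LINT x|?M. a n x * h x\<bar>
          \<le> ennreal \<bar>LINT x|?M. a n x * (a m x - h x)\<bar> + ennreal \<bar>LINT x|?M. b n x * w m x\<bar>"
        by (simp flip: ennreal_plus)
      also have "\<dots> \<le> (\<integral>\<^sup>+x. ennreal \<bar>a n x * (a m x - h x)\<bar> \<partial>?M) + (\<integral>\<^sup>+x. ennreal \<bar>b n x * w m x\<bar> \<partial>?M)"
        using integral_norm_bound_ennreal[OF i1] integral_norm_bound_ennreal[OF i4]
        by (intro add_mono) simp_all
      finally show ?thesis .
    qed
    have "(\<lambda>m. (\<integral>\<^sup>+x. ennreal \<bar>a n x * (a m x - h x)\<bar> \<partial>?M) + (\<integral>\<^sup>+x. ennreal \<bar>b n x * w m x\<bar> \<partial>?M)) \<longlonglongrightarrow> 0 + 0"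
      by (intro tendsto_add L2_pairing_tendsto_0 meas diff_meas int Dw' w0)
    then have "ennreal \<bar>LINT x|?M. a n x * h x\<bar> \<le> 0 + 0"
      by (rule LIMSEQ_le_const) (use le in auto)
    then show ?thesis by simp
  qed
  have "ennreal (LINT x|?M. (h x)\<^sup>2) \<le> (\<integral>\<^sup>+x. ennreal \<bar>h x * (a n x - h x)\<bar> \<partial>?M)" for n
  proof -
    have i1: "integrable ?M (\<lambda>x. h x * (a n x - h x))"
      by (rule L2_product_integrable[OF h(1) diff_meas h(2) diff_int])
    have i2: "integrable ?M (\<lambda>x. a n x * h x)"
      by (rule L2_product_integrable[OF meas(1) h(1) int(1) h(2)])
    have "(LINT x|?M. h x * (a n x - h x)) = (LINT x|?M. a n x * h x) - (LINT x|?M. (h x)\<^sup>2)"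
      using i2 h(2) by (simp add: right_diff_distrib power2_eq_square mult.commute)
    then have "ennreal (LINT x|?M. (h x)\<^sup>2) = ennreal \<bar>LINT x|?M. h x * (a n x - h x)\<bar>"
      using ortho[of n] by simp
    also have "\<dots> \<le> (\<integral>\<^sup>+x. ennreal \<bar>h x * (a n x - h x)\<bar> \<partial>?M)"
      using integral_norm_bound_ennreal[OF i1] by simp
    finally show ?thesis .
  qed
  moreover have "(\<lambda>n. \<integral>\<^sup>+x. ennreal \<bar>h x * (a n x - h x)\<bar> \<partial>?M) \<longlonglongrightarrow> 0"
    by (rule L2_pairing_tendsto_0[OF h diff_meas Dw'])
  ultimately have "ennreal (LINT x|?M. (h x)\<^sup>2) \<le> 0"
    using LIMSEQ_le_const by blast
  moreover have "(LINT x|?M. (h x)\<^sup>2) \<ge> 0" by simp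
  ultimately have "(LINT x|?M. (h x)\<^sup>2) = 0" by (simp add: ennreal_eq_0_iff)
  then have "AE x in ?M. (h x)\<^sup>2 = 0"
    using integral_nonneg_eq_0_iff_AE[OF h(2)] by simp
  then show ?thesis by simp
qed

section \<open>Uniqueness of weak derivatives and homogeneity of the Sobolev norm\<close>

lemma test_fields_iff:
  "u \<in> test_fields \<Omega> \<longleftrightarrow> smooth u \<and> (\<exists>K. compact K \<and> K \<subseteq> \<Omega> \<and> supported_in K u)"
  by (simp add: test_fields_def smooth_def supported_in_def)

text \<open>The difference of the two approximating sequences converges, at every multi-index, to
  the difference \<open>d\<close> of the two families. At order 0 both families represent
  \<open>f\<close>, so \<open>d\<close> is null there, and closability of a single partial
  derivative carries nullity from each order to the next.\<close>

lemma sobolev0_derivs_unique: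
  assumes g: "sobolev0_derivs k \<Omega> f g" "sobolev0_derivs k \<Omega> f g'" and \<Omega>: "\<Omega> \<in> sets lebesgue"
    and \<alpha>: "\<alpha> \<in> multi_indices k"
  shows "AE x in lebesgue_on \<Omega>. g \<alpha> x $ i = g' \<alpha> x $ i"
proof -
  let ?M = "lebesgue_on \<Omega>"
  obtain u where u: "\<And>n. u n \<in> test_fields \<Omega>"
    and ul: "\<And>\<beta>. \<beta> \<in> multi_indices k \<Longrightarrow>
      (\<lambda>n. \<integral>\<^sup>+x. ennreal ((multi_deriv \<beta> (\<lambda>y. u n y $ i) x - g \<beta> x $ i)\<^sup>2) \<partial>?M) \<longlonglongrightarrow> 0"
    using g(1) unfolding sobolev0_derivs_def by meson
  obtain u' where u': "\<And>n. u' n \<in> test_fields \<Omega>"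
    and ul': "\<And>\<beta>. \<beta> \<in> multi_indices k \<Longrightarrow>
      (\<lambda>n. \<integral>\<^sup>+x. ennreal ((multi_deriv \<beta> (\<lambda>y. u' n y $ i) x - g' \<beta> x $ i)\<^sup>2) \<partial>?M) \<longlonglongrightarrow> 0"
    using g(2) unfolding sobolev0_derivs_def by meson
  have meas: "(\<lambda>x. g \<beta> x $ i) \<in> borel_measurable ?M" "(\<lambda>x. g' \<beta> x $ i) \<in> borel_measurable ?M"
    and sq: "integrable ?M (\<lambda>x. (g \<beta> x $ i)\<^sup>2)" "integrable ?M (\<lambda>x. (g' \<beta> x $ i)\<^sup>2)"
    if "\<beta> \<in> multi_indices k" for \<beta>
    using g that unfolding sobolev0_derivs_def by auto
  define d where "d = (\<lambda>\<beta> x. g \<beta> x $ i - g' \<beta> x $ i)"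
  define w where "w = (\<lambda>\<beta> n. multi_deriv \<beta> (\<lambda>x. u n x $ i - u' n x $ i))"
  have su: "smooth (\<lambda>x. u n x $ i)" "smooth (\<lambda>x. u' n x $ i)" for n
    using u[of n] u'[of n] by (auto simp: test_fields_iff intro: smooth_component)
  have sw: "smooth (w \<beta> n)" for \<beta> n
    unfolding w_def by (intro smooth_multi_deriv smooth_diff su)
  have dm: "d \<beta> \<in> borel_measurable ?M" if "\<beta> \<in> multi_indices k" for \<beta>
    unfolding d_def using meas[OF that] by measurable
  have dsq: "integrable ?M (\<lambda>x. (d \<beta> x)\<^sup>2)" if "\<beta> \<in> multi_indices k" for \<beta>
    unfolding d_def using sq[OF that] L2_product_integrable[OF meas[OF that] sq[OF that]]
    by (simp add: power2_diff mult.assoc)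
  have wl: "(\<lambda>n. \<integral>\<^sup>+x. ennreal ((w \<beta> n x - d \<beta> x)\<^sup>2) \<partial>?M) \<longlonglongrightarrow> 0" if \<beta>: "\<beta> \<in> multi_indices k" for \<beta>
  proof -
    have m: "(\<lambda>x. multi_deriv \<beta> (\<lambda>y. u n y $ i) x - g \<beta> x $ i) \<in> borel_measurable ?M"
      "(\<lambda>x. multi_deriv \<beta> (\<lambda>y. u' n y $ i) x - g' \<beta> x $ i) \<in> borel_measurable ?M" for n
      using smooth_measurable[OF smooth_multi_deriv[OF su(1)]] smooth_measurable[OF smooth_multi_deriv[OF su(2)]]
        meas[OF \<beta>] by (auto intro: borel_measurable_diff)
    have "(\<lambda>n. \<integral>\<^sup>+x. ennreal (((multi_deriv \<beta> (\<lambda>y. u n y $ i) x - g \<beta> x $ i)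
      - (multi_deriv \<beta> (\<lambda>y. u' n y $ i) x - g' \<beta> x $ i))\<^sup>2) \<partial>?M) \<longlonglongrightarrow> 0"
      by (rule L2_diff_tendsto_0[OF m ul[OF \<beta>] ul'[OF \<beta>]])
    moreover have "(multi_deriv \<beta> (\<lambda>y. u n y $ i) x - g \<beta> x $ i)
      - (multi_deriv \<beta> (\<lambda>y. u' n y $ i) x - g' \<beta> x $ i) = w \<beta> n x - d \<beta> x" for n x
      by (simp add: w_def d_def multi_deriv_diff[OF su])
    ultimately show ?thesis by simp
  qed
  \<comment> \<open>Differentiation does not enlarge the support, so one compact set per n serves
    all multi-indices and hence every step of the induction.\<close>
  have "\<exists>K. compact K \<and> K \<subseteq> \<Omega> \<and> (\<forall>\<beta>. supported_in K (w \<beta> n))" for n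
  proof -
    obtain K K' where K: "compact K" "K \<subseteq> \<Omega>" "supported_in K (u n)" "compact K'" "K' \<subseteq> \<Omega>" "supported_in K' (u' n)"
      using u[of n] u'[of n] by (auto simp: test_fields_iff)
    then have "supported_in (K \<union> K') (\<lambda>x. u n x $ i - u' n x $ i)" by (simp add: supported_in_def)
    then have "supported_in (K \<union> K') (w \<beta> n)" for \<beta>
      unfolding w_def by (intro supported_in_multi_deriv compact_imp_closed compact_Un K)
    then show ?thesis using K by (intro exI[of _ "K \<union> K'"]) auto
  qed
  then obtain K where K: "\<And>n. compact (K n)" "\<And>n. K n \<subseteq> \<Omega>" "\<And>n \<beta>. supported_in (K n) (w \<beta> n)"
    by metis
  have "AE x in ?M. d \<alpha> x = 0"
    using \<alpha>
  proof (induction rule: multi_index_induct)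
    case zero
    have "AE x in ?M. g (0, 0) x = f x" "AE x in ?M. g' (0, 0) x = f x"
      using g unfolding sobolev0_derivs_def by auto
    then show ?case by eventually_elim (simp add: d_def)
  next
    case (step \<alpha> \<beta> j)
    have eq: "w \<beta> n = partial_deriv j (w \<alpha> n)" for n
      unfolding w_def by (rule step)
    show ?case
    proof (rule partial_deriv_closable[OF \<Omega> sw K])
      \<comment> \<open>Since \<open>d \<alpha>\<close> is null by induction, convergence to it is
        convergence to 0, the form in which closability takes its input.\<close>
      have "(\<integral>\<^sup>+x. ennreal ((w \<alpha> n x - d \<alpha> x)\<^sup>2) \<partial>?M) = (\<integral>\<^sup>+x. ennreal ((w \<alpha> n x)\<^sup>2) \<partial>?M)" for n
        using step.IH by (intro nn_integral_cong_AE) (auto elim: eventually_mono)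
      then show "(\<lambda>n. \<integral>\<^sup>+x. ennreal ((w \<alpha> n x)\<^sup>2) \<partial>?M) \<longlonglongrightarrow> 0"
        using wl[OF step(1)] by simp
      show "(\<lambda>n. \<integral>\<^sup>+x. ennreal ((partial_deriv j (w \<alpha> n) x - d \<beta> x)\<^sup>2) \<partial>?M) \<longlonglongrightarrow> 0"
        using wl[OF step(2)] by (simp add: eq)
    qed (use dm dsq step in auto)
  qed
  then show ?thesis by (simp add: d_def)
qed

text \<open>Replaces the chosen weak derivatives by any convenient family; this is how uniqueness
  enters the homogeneity of the norm.\<close>

lemma W0_norm_eq:
  assumes "sobolev0_derivs k \<Omega> f g" "\<Omega> \<in> sets lebesgue"
  shows "W0_norm k \<Omega> f = sqrt (\<Sum>i\<in>UNIV. \<Sum>\<alpha>\<in>multi_indices k. LINT x|lebesgue_on \<Omega>. (g \<alpha> x $ i)\<^sup>2)"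
proof -
  have wd: "sobolev0_derivs k \<Omega> f (weak_deriv k \<Omega> f)"
    unfolding weak_deriv_def by (rule someI[where P = "sobolev0_derivs k \<Omega> f", OF assms(1)])
  have "(LINT x|lebesgue_on \<Omega>. (weak_deriv k \<Omega> f \<alpha> x $ i)\<^sup>2) = (LINT x|lebesgue_on \<Omega>. (g \<alpha> x $ i)\<^sup>2)"
    if \<alpha>: "\<alpha> \<in> multi_indices k" for \<alpha> i
  proof (rule integral_cong_AE)
    show "(\<lambda>x. (weak_deriv k \<Omega> f \<alpha> x $ i)\<^sup>2) \<in> borel_measurable (lebesgue_on \<Omega>)"
      "(\<lambda>x. (g \<alpha> x $ i)\<^sup>2) \<in> borel_measurable (lebesgue_on \<Omega>)"
      using wd assms(1) \<alpha> unfolding sobolev0_derivs_def by (blast intro: borel_measurable_power)+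
    show "AE x in lebesgue_on \<Omega>. (weak_deriv k \<Omega> f \<alpha> x $ i)\<^sup>2 = (g \<alpha> x $ i)\<^sup>2"
      using sobolev0_derivs_unique[OF wd assms \<alpha>, of i] by (rule eventually_mono) simp
  qed
  then show ?thesis by (simp add: W0_norm_def)
qed

lemma sobolev0_derivs_scaleR:
  assumes "sobolev0_derivs k \<Omega> f g"
  shows "sobolev0_derivs k \<Omega> (\<lambda>x. c *\<^sub>R f x) (\<lambda>\<alpha> x. c *\<^sub>R g \<alpha> x)"
proof -
  let ?M = "lebesgue_on \<Omega>"
  obtain u where u: "\<And>n. u n \<in> test_fields \<Omega>"
    and ul: "\<And>\<beta> i. \<beta> \<in> multi_indices k \<Longrightarrow>
      (\<lambda>n. \<integral>\<^sup>+x. ennreal ((multi_deriv \<beta> (\<lambda>y. u n y $ i) x - g \<beta> x $ i)\<^sup>2) \<partial>?M) \<longlonglongrightarrow> 0"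
    using assms unfolding sobolev0_derivs_def by meson
  have meas: "(\<lambda>x. g \<beta> x $ i) \<in> borel_measurable ?M" "integrable ?M (\<lambda>x. (g \<beta> x $ i)\<^sup>2)"
    if "\<beta> \<in> multi_indices k" for \<beta> i
    using assms that unfolding sobolev0_derivs_def by auto
  have su: "smooth (\<lambda>y. u n y $ i)" for n i
    using u[of n] by (auto simp: test_fields_iff intro: smooth_component)
  show ?thesis
    unfolding sobolev0_derivs_def
  proof (intro conjI ballI allI exI)
    have "AE x in ?M. g (0, 0) x = f x" using assms unfolding sobolev0_derivs_def by blast
    then show "AE x in ?M. c *\<^sub>R g (0, 0) x = c *\<^sub>R f x" by (rule eventually_mono) simp
    show "(\<lambda>x. c *\<^sub>R u n x) \<in> test_fields \<Omega>" for n
      using u[of n] smooth_linear_compose[OF bounded_linear_scaleR_right, of "u n" c]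
      by (auto simp: test_fields_iff supported_in_def)
    fix \<alpha> i assume \<alpha>: "\<alpha> \<in> multi_indices k"
    show "(\<lambda>x. (c *\<^sub>R g \<alpha> x) $ i) \<in> borel_measurable ?M" using meas(1)[OF \<alpha>] by simp
    show "integrable ?M (\<lambda>x. ((c *\<^sub>R g \<alpha> x) $ i)\<^sup>2)" using meas(2)[OF \<alpha>] by (simp add: power_mult_distrib)
    have "(\<integral>\<^sup>+x. ennreal ((multi_deriv \<alpha> (\<lambda>y. (c *\<^sub>R u n y) $ i) x - (c *\<^sub>R g \<alpha> x) $ i)\<^sup>2) \<partial>?M)
        = ennreal (c\<^sup>2) * (\<integral>\<^sup>+x. ennreal ((multi_deriv \<alpha> (\<lambda>y. u n y $ i) x - g \<alpha> x $ i)\<^sup>2) \<partial>?M)" for n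
    proof -
      have "(\<lambda>x. multi_deriv \<alpha> (\<lambda>y. u n y $ i) x - g \<alpha> x $ i) \<in> borel_measurable ?M"
        by (intro borel_measurable_diff smooth_measurable smooth_multi_deriv su meas(1) \<alpha>)
      then have "(\<lambda>x. ennreal ((multi_deriv \<alpha> (\<lambda>y. u n y $ i) x - g \<alpha> x $ i)\<^sup>2)) \<in> borel_measurable ?M"
        by simp
      from nn_integral_cmult[OF this, of "ennreal (c\<^sup>2)"] show ?thesis
        by (simp add: multi_deriv_cmult[OF su] power_mult_distrib flip: ennreal_mult right_diff_distrib)
    qed
    moreover have "(\<lambda>n. ennreal (c\<^sup>2) * (\<integral>\<^sup>+x. ennreal ((multi_deriv \<alpha> (\<lambda>y. u n y $ i) x - g \<alpha> x $ i)\<^sup>2) \<partial>?M))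
        \<longlonglongrightarrow> ennreal (c\<^sup>2) * 0"
      by (intro ennreal_tendsto_cmult ul \<alpha>) simp
    ultimately show "(\<lambda>n. \<integral>\<^sup>+x. ennreal ((multi_deriv \<alpha> (\<lambda>y. (c *\<^sub>R u n y) $ i) x - (c *\<^sub>R g \<alpha> x) $ i)\<^sup>2) \<partial>?M) \<longlonglongrightarrow> 0"
      by simp
  qed
qed

lemma W0_scaleR: "f \<in> W0 k \<Omega> \<Longrightarrow> (\<lambda>x. c *\<^sub>R f x) \<in> W0 k \<Omega>"
  unfolding W0_def using sobolev0_derivs_scaleR by blast

lemma W0_norm_scaleR:
  assumes "f \<in> W0 k \<Omega>" "\<Omega> \<in> sets lebesgue"
  shows "W0_norm k \<Omega> (\<lambda>x. c *\<^sub>R f x) = \<bar>c\<bar> * W0_norm k \<Omega> f"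
proof -
  obtain g where g: "sobolev0_derivs k \<Omega> f g" using assms(1) by (auto simp: W0_def)
  show ?thesis
    unfolding W0_norm_eq[OF g assms(2)] W0_norm_eq[OF sobolev0_derivs_scaleR[OF g] assms(2)]
    by (simp add: power_mult_distrib real_sqrt_mult flip: sum_distrib_left)
qed

text \<open>The dilations \<open>x \<mapsto> f ((1 + 1/n) x)\<close> push the support of \<open>f\<close> into the open ball.\<close>

lemma smooth_vanishing_off_ball_in_W0:
  fixes f :: "real^2 \<Rightarrow> real^2"
  assumes f: "smooth f" "supported_in (ball 0 r) f" and r: "r > 0"
  shows "f \<in> W0 k (ball 0 r)"
proof -
  let ?M = "lebesgue_on (ball 0 r) :: (real^2) measure"
  interpret finite_measure ?M by (rule finite_measure_lebesgue_on) simp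
  \<comment> \<open>\<open>f\<close> vanishes off the open ball but may be nonzero arbitrarily close
    to its boundary, so it need not itself be a test field. Factors slightly above 1 shrink the
    support to radius r / s n < r.\<close>
  define s where "s = (\<lambda>n. 1 + 1 / real (Suc n))"
  have s: "1 < s n" "s n \<le> 2" for n by (auto simp: s_def field_simps)
  have s_lim: "s \<longlonglongrightarrow> 1"
    unfolding s_def using tendsto_add[OF tendsto_const LIMSEQ_Suc[OF lim_1_over_n], of 1] by simp
  have sf: "smooth (\<lambda>y. f y $ i)" for i by (rule smooth_component[OF f(1)])
  have supp: "supported_in (cball 0 r) (multi_deriv \<alpha> (\<lambda>y. f y $ i))" for \<alpha> i
    using f(2) by (intro supported_in_multi_deriv) (auto simp: supported_in_def)
  have bd: "\<exists>B\<ge>0. \<forall>x. \<bar>multi_deriv \<alpha> (\<lambda>y. f y $ i) x\<bar> \<le> B" for \<alpha> i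
    using compact_support_bounded[OF smooth_continuous_on[OF smooth_multi_deriv[OF sf]] compact_cball supp]
    by metis
  have meas: "multi_deriv \<alpha> (\<lambda>y. f y $ i) \<in> borel_measurable ?M" for \<alpha> i
    by (rule smooth_measurable[OF smooth_multi_deriv[OF sf]])
  \<comment> \<open>The classical derivatives serve as weak ones. For the dilated fields the chain
    rule contributes the power of s n given by the order, which tends to 1.\<close>
  have "sobolev0_derivs k (ball 0 r) f (\<lambda>\<alpha> x. \<chi> i. multi_deriv \<alpha> (\<lambda>y. f y $ i) x)"
    unfolding sobolev0_derivs_def
  proof (intro conjI ballI allI exI)
    show "AE x in ?M. (\<chi> i. multi_deriv (0, 0) (\<lambda>y. f y $ i) x) = f x" by (simp add: vec_eq_iff)
    show "(\<lambda>x. f (s n *\<^sub>R x)) \<in> test_fields (ball 0 r)" for n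
      unfolding test_fields_iff
    proof (intro conjI exI)
      show "smooth (\<lambda>x. f (s n *\<^sub>R x))" by (rule smooth_compose_linear[OF bounded_linear_scaleR_right f(1)])
      show "cball 0 (r / s n) \<subseteq> (ball 0 r :: (real^2) set)"
      proof
        fix x :: "real^2" assume "x \<in> cball 0 (r / s n)"
        moreover have "r / s n < r" using s(1)[of n] r by (simp add: field_simps)
        ultimately show "x \<in> ball 0 r" by simp
      qed
      show "supported_in (cball 0 (r / s n)) (\<lambda>x. f (s n *\<^sub>R x))"
        using f(2) s(1)[of n] by (auto simp: supported_in_def field_simps)
    qed simp
    fix \<alpha> i
    let ?D = "multi_deriv \<alpha> (\<lambda>y. f y $ i)" and ?m = "fst \<alpha> + snd \<alpha>"
    obtain B where B: "B \<ge> 0" "\<And>x. \<bar>?D x\<bar> \<le> B" using bd by blast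
    show "(\<lambda>x. (\<chi> i. multi_deriv \<alpha> (\<lambda>y. f y $ i) x) $ i) \<in> borel_measurable ?M" using meas by simp
    have "\<bar>?D x\<bar>\<^sup>2 \<le> B\<^sup>2" for x using B by (intro power_mono) auto
    then show "integrable ?M (\<lambda>x. ((\<chi> i. multi_deriv \<alpha> (\<lambda>y. f y $ i) x) $ i)\<^sup>2)"
      using meas by (intro integrable_const_bound[where B = "B\<^sup>2"]) auto
    have D: "multi_deriv \<alpha> (\<lambda>y. f (s n *\<^sub>R y) $ i) x = s n ^ ?m * ?D (s n *\<^sub>R x)" for n x
      using multi_deriv_dilate[OF sf, of \<alpha> "s n" i] by (simp add: fun_eq_iff)
    have "(\<lambda>n. \<integral>\<^sup>+x. ennreal ((s n ^ ?m * ?D (s n *\<^sub>R x) - ?D x)\<^sup>2) \<partial>?M) \<longlonglongrightarrow> (\<integral>\<^sup>+x. 0 \<partial>?M)"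
    \<comment> \<open>A constant dominates on the ball, which has finite measure: the derivative is
      bounded by B and s n by 2.\<close>
    proof (rule nn_integral_dominated_convergence[where w = "\<lambda>x. ennreal ((2 ^ ?m * B + B)\<^sup>2)"])
      have m: "(\<lambda>x. s n ^ ?m * ?D (s n *\<^sub>R x) - ?D x) \<in> borel_measurable ?M" for n
        by (intro smooth_measurable smooth_diff smooth_cmult smooth_multi_deriv sf
            smooth_compose_linear[OF bounded_linear_scaleR_right])
      then show "(\<lambda>x. ennreal ((s n ^ ?m * ?D (s n *\<^sub>R x) - ?D x)\<^sup>2)) \<in> borel_measurable ?M" for n
        by (intro measurable_compose[OF _ measurable_ennreal] borel_measurable_power)
      have "\<bar>s n ^ ?m * ?D (s n *\<^sub>R x) - ?D x\<bar> \<le> 2 ^ ?m * B + B" for n x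
      proof -
        have "\<bar>s n ^ ?m * ?D (s n *\<^sub>R x) - ?D x\<bar> \<le> \<bar>s n ^ ?m\<bar> * \<bar>?D (s n *\<^sub>R x)\<bar> + \<bar>?D x\<bar>"
          using abs_triangle_ineq4[of "s n ^ ?m * ?D (s n *\<^sub>R x)" "?D x"] by (simp add: abs_mult)
        also have "\<dots> \<le> 2 ^ ?m * B + B"
          using s[of n] B by (intro add_mono mult_mono) (auto simp: power_abs intro!: power_mono)
        finally show ?thesis .
      qed
      then have "(s n ^ ?m * ?D (s n *\<^sub>R x) - ?D x)\<^sup>2 \<le> (2 ^ ?m * B + B)\<^sup>2" for n x
        using B(1) by (intro abs_le_square_iff[THEN iffD1]) simp
      then show "AE x in ?M. ennreal ((s n ^ ?m * ?D (s n *\<^sub>R x) - ?D x)\<^sup>2) \<le> ennreal ((2 ^ ?m * B + B)\<^sup>2)" for n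
        by (intro AE_I2 ennreal_leI)
      show "(\<integral>\<^sup>+x. ennreal ((2 ^ ?m * B + B)\<^sup>2) \<partial>?M) < \<infinity>"
      proof -
        have "emeasure ?M (space ?M) < top" using emeasure_finite[of "space ?M"] by (simp only: less_top)
        then show ?thesis by (simp add: ennreal_mult_less_top)
      qed
      show "AE x in ?M. (\<lambda>n. ennreal ((s n ^ ?m * ?D (s n *\<^sub>R x) - ?D x)\<^sup>2)) \<longlonglongrightarrow> 0"
      proof (rule AE_I2)
        fix x
        have "isCont ?D (1 *\<^sub>R x)"
          using smooth_continuous_on[OF smooth_multi_deriv[OF sf], of UNIV] by (simp add: continuous_on_eq_continuous_at)
        then have "(\<lambda>n. ?D (s n *\<^sub>R x)) \<longlonglongrightarrow> ?D (1 *\<^sub>R x)"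
          by (rule isCont_tendsto_compose) (intro tendsto_scaleR s_lim tendsto_const)
        then have "(\<lambda>n. (s n ^ ?m * ?D (s n *\<^sub>R x) - ?D x)\<^sup>2) \<longlonglongrightarrow> (1 ^ ?m * ?D (1 *\<^sub>R x) - ?D x)\<^sup>2"
          by (intro tendsto_intros s_lim)
        then have "(\<lambda>n. ennreal ((s n ^ ?m * ?D (s n *\<^sub>R x) - ?D x)\<^sup>2)) \<longlonglongrightarrow> ennreal ((1 ^ ?m * ?D (1 *\<^sub>R x) - ?D x)\<^sup>2)"
          by (rule tendsto_ennrealI)
        then show "(\<lambda>n. ennreal ((s n ^ ?m * ?D (s n *\<^sub>R x) - ?D x)\<^sup>2)) \<longlonglongrightarrow> 0" by simp
      qed
    qed simp_all
    then show "(\<lambda>n. \<integral>\<^sup>+x. ennreal ((multi_deriv \<alpha> (\<lambda>y. f (s n *\<^sub>R y) $ i) x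
        - (\<chi> i. multi_deriv \<alpha> (\<lambda>y. f y $ i) x) $ i)\<^sup>2) \<partial>?M) \<longlonglongrightarrow> 0"
      by (simp add: D)
  qed
  then show ?thesis unfolding W0_def by blast
qed

text \<open>With a fixed spatial profile the Bochner conditions become scalar ones: simple functions
  approximating \<open>c\<close>, multiplied by \<open>f\<close>, are simple maps into the Sobolev
  space, and homogeneity turns their distance to the field into a scalar distance times the norm of
  \<open>f\<close>.\<close>

lemma bochner_L2_W0_scaleR_const:
  assumes f: "f \<in> W0 k \<Omega>" "\<Omega> \<in> sets lebesgue" and c: "continuous_on {0<..<1} c"
    and int: "integrable (lebesgue_on {0<..<1}) (\<lambda>t. (c t)\<^sup>2)"
  shows "(\<lambda>t x. c t *\<^sub>R f x) \<in> bochner_L2_W0 k \<Omega>"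
proof -
  let ?I = "lebesgue_on {0<..<1::real}"
  have "c \<in> borel_measurable ?I"
    by (rule continuous_imp_measurable_on_sets_lebesgue[OF c]) simp
  then obtain F where F: "\<And>n. simple_function ?I (F n)" "\<And>t. t \<in> space ?I \<Longrightarrow> (\<lambda>n. F n t) \<longlonglongrightarrow> c t"
    using borel_measurable_implies_sequence_metric[of c ?I 0] by blast
  have "(\<lambda>n. W0_norm k \<Omega> (\<lambda>x. F n t *\<^sub>R f x - c t *\<^sub>R f x)) \<longlonglongrightarrow> 0" if "t \<in> space ?I" for t
  proof -
    have "(\<lambda>n. \<bar>F n t - c t\<bar> * W0_norm k \<Omega> f) \<longlonglongrightarrow> \<bar>c t - c t\<bar> * W0_norm k \<Omega> f"
      by (intro tendsto_intros F(2) that)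
    then show ?thesis
      by (simp add: W0_norm_scaleR[OF f] flip: scaleR_left_diff_distrib)
  qed
  then have "AE t in ?I. (\<lambda>n. W0_norm k \<Omega> (\<lambda>x. F n t *\<^sub>R f x - c t *\<^sub>R f x)) \<longlonglongrightarrow> 0"
    by (rule AE_I2)
  moreover have "simple_function ?I (\<lambda>t x. F n t *\<^sub>R f x)" for n
    using simple_function_compose[OF F(1), of "\<lambda>a x. a *\<^sub>R f x" n] by (simp add: comp_def)
  moreover have "integrable ?I (\<lambda>t. (W0_norm k \<Omega> (\<lambda>x. c t *\<^sub>R f x))\<^sup>2)"
    using int by (simp add: W0_norm_scaleR[OF f] power_mult_distrib)
  ultimately show ?thesis
    unfolding bochner_L2_W0_def mem_Collect_eq using W0_scaleR[OF f(1)]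
    by (intro conjI exI[of _ "\<lambda>n t x. F n t *\<^sub>R f x"]) auto
qed

lemma bochner_L2_W0_norm_scaleR_const:
  assumes "f \<in> W0 k \<Omega>" "\<Omega> \<in> sets lebesgue"
  shows "bochner_L2_W0_norm k \<Omega> (\<lambda>t x. c t *\<^sub>R f x)
    = sqrt (LINT t|lebesgue_on {0<..<1}. (c t)\<^sup>2) * W0_norm k \<Omega> f"
proof -
  have "W0_norm k \<Omega> f \<ge> 0"
    unfolding W0_norm_def by (auto intro!: sum_nonneg)
  then show ?thesis
    by (simp add: bochner_L2_W0_norm_def W0_norm_scaleR[OF assms] power_mult_distrib real_sqrt_mult)
qed

lemma bochner_L2_W0_scaleR_const_imp_integrable:
  assumes "f \<in> W0 k \<Omega>" "\<Omega> \<in> sets lebesgue" "W0_norm k \<Omega> f \<noteq> 0"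
    and "(\<lambda>t x. c t *\<^sub>R f x) \<in> bochner_L2_W0 k \<Omega>"
  shows "integrable (lebesgue_on {0<..<1}) (\<lambda>t. (c t)\<^sup>2)"
  using assms(3,4) by (simp add: bochner_L2_W0_def W0_norm_scaleR[OF assms(1,2)] power_mult_distrib)

section \<open>The distortion energy of radial morphs\<close>

lemma rot90_nth [simp]: "rot90 X $ 1 = - X $ 2" "rot90 X $ 2 = X $ 1"
  by (simp_all add: rot90_def)

lemma rot90_scaleR: "rot90 (c *\<^sub>R X) = c *\<^sub>R rot90 X"
  by (simp add: vec_eq_iff forall_2)

lemma rot90_rot90: "rot90 (rot90 X) = - X"
  by (simp add: vec_eq_iff forall_2)

lemma inner_vec2: "X \<bullet> Y = X $ 1 * Y $ 1 + X $ 2 * Y $ 2" for X Y :: "real^2"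
  by (simp add: inner_vec_def sum_2)

lemma norm_rot90 [simp]: "norm (rot90 X) = norm X"
  by (simp add: norm_eq_sqrt_inner inner_vec2 algebra_simps)

text \<open>Differentiating |gamma|^2 = 1 makes a tangent vector orthogonal to \<open>p\<close>,
  hence in the plane a multiple of \<open>rot90 p\<close>. Conversely each multiple is the velocity
  of a uniform rotation, which stays on the circle at all real times, as
  \<open>tangent_space\<close> demands.\<close>

lemma tangent_space_circle:
  assumes "p \<in> S1"
  shows "tangent_space S1 p = span {rot90 p}"
proof (intro equalityI subsetI)
  have pp: "p \<bullet> p = 1" using assms by (simp add: dot_square_norm)
  fix X assume "X \<in> tangent_space S1 p"
  then obtain \<gamma> :: "real \<Rightarrow> real^2" where \<gamma>: "\<And>s. \<gamma> s \<in> S1" "\<gamma> 0 = p" "(\<gamma> has_vector_derivative X) (at 0)"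
    by (auto simp: tangent_space_def)
  have "((\<lambda>s. \<gamma> s \<bullet> \<gamma> s) has_derivative (\<lambda>h. \<gamma> 0 \<bullet> (h *\<^sub>R X) + (h *\<^sub>R X) \<bullet> \<gamma> 0)) (at 0)"
    using \<gamma>(3) by (intro has_derivative_inner) (simp_all add: has_vector_derivative_def)
  moreover have "(\<lambda>s. \<gamma> s \<bullet> \<gamma> s) = (\<lambda>s. 1)" using \<gamma>(1) by (simp add: dot_square_norm)
  ultimately have "((\<lambda>s::real. 1::real) has_derivative (\<lambda>h. \<gamma> 0 \<bullet> (h *\<^sub>R X) + (h *\<^sub>R X) \<bullet> \<gamma> 0)) (at 0)"
    by simp
  then have "(\<lambda>h. \<gamma> 0 \<bullet> (h *\<^sub>R X) + (h *\<^sub>R X) \<bullet> \<gamma> 0) = (\<lambda>h. 0)"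
    by (rule has_derivative_unique[OF _ has_derivative_const])
  from fun_cong[OF this, of 1] have pX: "p \<bullet> X = 0" using \<gamma>(2) by (simp add: inner_commute)
  have "X = (X \<bullet> rot90 p) *\<^sub>R rot90 p"
  proof -
    have e: "p$1 * p$1 + p$2 * p$2 = 1" "p$1 * X$1 + p$2 * X$2 = 0" using pp pX by (simp_all add: inner_vec2)
    have "X$1 = (X$2 * p$1 - X$1 * p$2) * - p$2" "X$2 = (X$2 * p$1 - X$1 * p$2) * p$1"
      using e by algebra+
    then show ?thesis by (simp add: vec_eq_iff forall_2 inner_vec2)
  qed
  then show "X \<in> span {rot90 p}" by (metis insertI1 span_base span_scale)
next
  have pp: "p \<bullet> p = 1" using assms by (simp add: dot_square_norm)
  fix X assume "X \<in> span {rot90 p}"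
  then obtain c where X: "X = c *\<^sub>R rot90 p" by (auto simp: span_singleton)
  let ?\<gamma> = "\<lambda>s. cos (c * s) *\<^sub>R p + sin (c * s) *\<^sub>R rot90 p"
  have "?\<gamma> s \<in> S1" for s
  proof -
    have "p$1 * p$1 + p$2 * p$2 = 1" using pp by (simp add: inner_vec2)
    moreover have "cos (c * s) * cos (c * s) + sin (c * s) * sin (c * s) = 1"
      by (metis power2_eq_square sin_cos_squared_add2)
    moreover have "(a * x - b * y) * (a * x - b * y) + (a * y + b * x) * (a * y + b * x)
        = (a * a + b * b) * (x * x + y * y)" for a b x y :: real by algebra
    ultimately have "?\<gamma> s \<bullet> ?\<gamma> s = 1" unfolding inner_vec2 by simp
    then show ?thesis by (simp add: norm_eq_1)
  qed
  moreover have "(?\<gamma> has_vector_derivative X) (at 0)"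
    unfolding X by (auto intro!: derivative_eq_intros)
  ultimately show "X \<in> tangent_space S1 p"
    unfolding tangent_space_def by (intro CollectI exI[of _ ?\<gamma>]) auto
qed

text \<open>The basis selected by choice can only be {e} or {-e}, and which one is unknown.
  \<open>B\<close> is a plain function here rather than a bilinear form, so its value is prescribed
  at both vectors.\<close>

lemma tensor_norm_sq_line:
  assumes "norm e = 1" "B e e = \<beta>" "B (- e) (- e) = \<beta>"
  shows "tensor_norm_sq (span {e}) B = \<beta>\<^sup>2"
proof -
  let ?P = "\<lambda>E. pairwise orthogonal E \<and> (\<forall>e\<in>E. norm e = 1) \<and> span E = span {e}"
  define E where "E = (SOME E. ?P E)"
  have P: "?P E"
    unfolding E_def by (rule someI[where P = ?P and x = "{e}"]) (simp add: assms)
  have sub: "E \<subseteq> {e, - e}"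
  proof
    fix x assume x: "x \<in> E"
    then have "x \<in> span {e}" using P span_base by blast
    then obtain c where c: "x = c *\<^sub>R e" by (auto simp: span_singleton)
    have "norm x = 1" using P x by blast
    then have "\<bar>c\<bar> = 1" using c assms(1) by simp
    then show "x \<in> {e, - e}" using c by (auto simp: abs_if split: if_splits)
  qed
  have "E \<noteq> {}"
  proof
    assume "E = {}"
    then have "e \<in> {0}" using P span_base[of e "{e}"] by auto
    then show False using assms(1) by simp
  qed
  moreover have "\<not> (e \<in> E \<and> - e \<in> E)"
  proof
    assume "e \<in> E \<and> - e \<in> E"
    moreover have "e \<noteq> - e" 
    proof
      assume "e = - e"
      then have "e + e = 0" by (metis add.right_inverse)
      then have "2 *\<^sub>R e = 0" by (simp only: scaleR_2)
      then show False using assms(1) by simp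
    qed
    ultimately have "orthogonal e (- e)" using P by (auto simp: pairwise_def)
    then show False using assms(1) by (simp add: orthogonal_def dot_square_norm)
  qed
  ultimately have "E = {e} \<or> E = {- e}" using sub by blast
  then show ?thesis
    unfolding tensor_norm_sq_def E_def[symmetric] Let_def using assms by auto
qed

text \<open>Any two derivatives within \<open>S\<close> give the same velocity of f along a curve in
  \<open>S\<close> with velocity \<open>X\<close>, because a function of one real variable has a
  unique derivative. This removes the arbitrariness of \<open>frechet_derivative\<close> on a thin
  set.\<close>

lemma tangent_map_eq:
  assumes f: "(f has_derivative f') (at p within S)" and X: "X \<in> tangent_space S p"
  shows "tangent_map S f p X = f' X"
proof -
  obtain \<gamma> :: "real \<Rightarrow> real^2" where \<gamma>: "\<And>s. \<gamma> s \<in> S" "\<gamma> 0 = p" "(\<gamma> has_vector_derivative X) (at 0)"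
    using X by (auto simp: tangent_space_def)
  have *: "((\<lambda>s. f (\<gamma> s)) has_vector_derivative D X) (at 0)" if D: "(f has_derivative D) (at p within S)" for D
  proof -
    have "(f has_derivative D) (at (\<gamma> 0) within range \<gamma>)"
      using D \<gamma>(1,2) by (auto intro: has_derivative_subset)
    from diff_chain_within[OF \<gamma>(3)[unfolded has_vector_derivative_def] this]
    show ?thesis
      using linear_cmul[OF has_derivative_linear[OF D]] by (simp add: has_vector_derivative_def comp_def)
  qed
  have "(f has_derivative tangent_map S f p) (at p within S)"
    using f differentiable_def frechet_derivative_works by blast
  from vector_derivative_unique_at[OF *[OF this] *[OF f]] show ?thesis .
qed

text \<open>Supplies tangent vectors of the image curve, so that tangent maps on it can be
  evaluated.\<close>

lemma tangent_space_image:
  assumes f: "(f has_derivative f') (at p within S)" and X: "X \<in> tangent_space S p"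
  shows "f' X \<in> tangent_space (f ` S) (f p)"
proof -
  obtain \<gamma> :: "real \<Rightarrow> real^2" where \<gamma>: "\<And>s. \<gamma> s \<in> S" "\<gamma> 0 = p" "(\<gamma> has_vector_derivative X) (at 0)"
    using X by (auto simp: tangent_space_def)
  have "(f has_derivative f') (at (\<gamma> 0) within range \<gamma>)"
    using f \<gamma>(1,2) by (auto intro: has_derivative_subset)
  from diff_chain_within[OF \<gamma>(3)[unfolded has_vector_derivative_def] this]
  have "((\<lambda>s. f (\<gamma> s)) has_vector_derivative f' X) (at 0)"
    using linear_cmul[OF has_derivative_linear[OF f]] by (simp add: has_vector_derivative_def comp_def)
  then show ?thesis
    unfolding tangent_space_def using \<gamma> by (intro CollectI exI[of _ "\<lambda>s. f (\<gamma> s)"]) auto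
qed

section \<open>Distortion of a dilation of the unit circle\<close>

context
  fixes f :: "real^2 \<Rightarrow> real^2" and c :: real
  assumes c: "c > 0" and f: "\<And>p. p \<in> S1 \<Longrightarrow> f p = c *\<^sub>R p"
begin

lemma dilation_has_derivative: "p \<in> S1 \<Longrightarrow> (f has_derivative (\<lambda>v. c *\<^sub>R v)) (at p within S1)"
  by (rule has_derivative_transform[OF _ f]) (auto intro!: derivative_eq_intros)

lemma dilation_tangent_map:
  "p \<in> S1 \<Longrightarrow> X \<in> tangent_space S1 p \<Longrightarrow> tangent_map S1 f p X = c *\<^sub>R X"
  using tangent_map_eq[OF dilation_has_derivative] by blast

lemma unit_tangent_mem: "p \<in> S1 \<Longrightarrow> rot90 p \<in> tangent_space S1 p" "p \<in> S1 \<Longrightarrow> - rot90 p \<in> tangent_space S1 p"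
  by (auto simp: tangent_space_circle span_base span_neg)

lemma metric_distortion_dilation:
  assumes p: "p \<in> S1"
  shows "metric_distortion f p = (c\<^sup>2 - 1)\<^sup>2"
proof -
  note t = dilation_tangent_map[OF p unit_tangent_mem(1)[OF p]] dilation_tangent_map[OF p unit_tangent_mem(2)[OF p]]
  show ?thesis
    unfolding metric_distortion_def tangent_space_circle[OF p]
    using p by (intro tensor_norm_sq_line) (simp_all add: t first_form_def dot_square_norm power2_eq_square)
qed

lemma push_orientation_dilation:
  assumes q: "q \<in> f ` S1"
  shows "push_orientation S1 rot90 f q = (1 / c) *\<^sub>R rot90 q"
proof -
  obtain p where p: "p \<in> S1" "q = c *\<^sub>R p" using q f by auto
  have "inj_on f S1" using c f by (auto intro!: inj_onI)
  then have "inv_into S1 f q = p" using p f by (metis inv_into_f_f)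
  then show ?thesis
    using p c dilation_tangent_map[OF p(1) unit_tangent_mem(1)[OF p(1)]]
    by (simp add: push_orientation_def rot90_scaleR)
qed

text \<open>On the image circle of radius c the unit normal at q is -q/c, with differential -1/c.
  Evaluated on c X this gives the pulled-back form -c |X|^2, against -|X|^2 on the unit circle; the
  difference on a unit tangent is 1 - c.\<close>

lemma curvature_distortion_dilation:
  assumes p: "p \<in> S1"
  shows "curvature_distortion f p = (c - 1)\<^sup>2"
proof -
  let ?\<tau> = "push_orientation S1 rot90 f"
  have N: "((\<lambda>q. rot90 (?\<tau> q)) has_derivative (\<lambda>v. - (1 / c) *\<^sub>R v)) (at (f p) within f ` S1)"
  proof (rule has_derivative_transform)
    show "((\<lambda>q. - (1 / c) *\<^sub>R q) has_derivative (\<lambda>v. - (1 / c) *\<^sub>R v)) (at (f p) within f ` S1)"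
      by (auto intro!: derivative_eq_intros)
  qed (use p in \<open>auto simp: push_orientation_dilation rot90_scaleR rot90_rot90\<close>)
  have N1: "((\<lambda>q. rot90 (rot90 q)) has_derivative (\<lambda>v. - v)) (at p within S1)"
    unfolding rot90_rot90 by (auto intro!: derivative_eq_intros)
  have II: "second_form (f ` S1) ?\<tau> (f p) (tangent_map S1 f p X) (tangent_map S1 f p X) - second_form S1 rot90 p X X
      = (1 - c) * (X \<bullet> X)" if X: "X \<in> tangent_space S1 p" for X
  proof -
    have "tangent_map (f ` S1) (\<lambda>q. rot90 (?\<tau> q)) (f p) (c *\<^sub>R X) = - (1 / c) *\<^sub>R (c *\<^sub>R X)"
      by (rule tangent_map_eq[OF N tangent_space_image[OF dilation_has_derivative[OF p] X]])
    moreover have "tangent_map S1 (\<lambda>q. rot90 (rot90 q)) p X = - X"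
      by (rule tangent_map_eq[OF N1 X])
    ultimately show ?thesis
      using c by (simp add: second_form_def dilation_tangent_map[OF p X] algebra_simps)
  qed
  have "curvature_distortion f p = (1 - c)\<^sup>2"
    unfolding curvature_distortion_def tangent_space_circle[OF p]
    using p by (intro tensor_norm_sq_line) (simp_all add: II unit_tangent_mem dot_square_norm)
  then show ?thesis by (simp add: power2_commute)
qed

end

text \<open>For radial morphs the distortions are constant along the circle, so the total mass of
  \<open>arc_measure\<close>, the length of the parameter interval, is what enters the
  energy.\<close>

lemma nn_integral_arc_measure_const:
  assumes "\<And>p. p \<in> S1 \<Longrightarrow> g p = K"
  shows "(\<integral>\<^sup>+p. g p \<partial>arc_measure) = ennreal (2 * pi) * K"
proof -
  let ?c = "\<lambda>\<theta>. vector [cos \<theta>, sin \<theta>] :: real^2"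
  have sp: "space arc_measure = S1" by (simp add: arc_measure_def space_restrict_space)
  have S1: "?c \<theta> \<in> S1" for \<theta>
    by (simp add: norm_eq_sqrt_inner inner_vec2 flip: power2_eq_square)
  have c: "?c = (\<lambda>\<theta>. \<chi> i. if i = 1 then cos \<theta> else sin \<theta>)"
    by (simp add: fun_eq_iff vec_eq_iff forall_2)
  have "continuous_on UNIV (\<lambda>\<theta>::real. if i = 1 then cos \<theta> else sin \<theta>)" for i :: 2
    by (cases "i = 1") (auto intro!: continuous_intros)
  then have "continuous_on UNIV ?c" unfolding c by (rule continuous_on_vec_lambda)
  then have "?c \<in> borel_measurable borel" by (rule borel_measurable_continuous_onI)
  then have "?c \<in> borel_measurable (lebesgue_on {0..<2*pi})"
    by (intro measurable_restrict_space1 measurable_completion) simp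
  then have meas: "?c \<in> measurable (lebesgue_on {0..<2*pi}) (restrict_space borel S1)"
    using S1 by (intro measurable_restrict_space2) auto
  have "emeasure arc_measure S1 = emeasure (lebesgue_on {0..<2*pi}) (?c -` S1 \<inter> space (lebesgue_on {0..<2*pi}))"
    unfolding arc_measure_def by (rule emeasure_distr[OF meas]) (auto simp: sets_restrict_space)
  also have "?c -` S1 \<inter> space (lebesgue_on {0..<2*pi}) = {0..<2*pi}"
    using S1 by (auto simp: space_restrict_space)
  also have "emeasure (lebesgue_on {0..<2*pi}) {0..<2*pi} = ennreal (2 * pi)"
    by (simp add: emeasure_restrict_space)
  finally have e: "emeasure arc_measure S1 = ennreal (2 * pi)" .
  have "(\<integral>\<^sup>+p. g p \<partial>arc_measure) = (\<integral>\<^sup>+p. K \<partial>arc_measure)"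
    by (rule nn_integral_cong) (simp add: sp assms)
  then show ?thesis using e sp by (simp add: mult.commute)
qed

lemma nn_integral_unit_interval:
  fixes h :: "real \<Rightarrow> real"
  assumes "continuous_on {0..1} h" "\<And>t. t \<in> {0..1} \<Longrightarrow> 0 \<le> h t"
  shows "(\<integral>\<^sup>+t. ennreal (h t) \<partial>lebesgue_on {0..1}) = ennreal (integral {0..1} h)"
proof -
  have i: "integrable (lebesgue_on {0..1}) h"
    by (rule continuous_imp_integrable_real[OF assms(1)])
  have "(\<integral>\<^sup>+t. ennreal (h t) \<partial>lebesgue_on {0..1}) = ennreal (integral\<^sup>L (lebesgue_on {0..1}) h)"
    by (rule nn_integral_eq_integral[OF i]) (use assms(2) in \<open>auto intro: AE_I2\<close>)
  moreover have "{0..1::real} \<in> sets lebesgue" by simp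
  ultimately show ?thesis using lebesgue_integral_eq_integral[OF i] by simp
qed

lemma distortion_energy_radial:
  assumes \<phi>: "\<phi> \<in> Q_plus R" and F: "\<forall>p\<in>S1. \<forall>t\<in>{0..1}. F p t = \<phi> t *\<^sub>R p"
  shows "distortion_energy F = ennreal (2 * pi * J \<phi>)"
proof -
  note Q = Q_plusD[OF \<phi>]
  have c1: "continuous_on {0..1} (\<lambda>t. ((\<phi> t)\<^sup>2 - 1)\<^sup>2)" "continuous_on {0..1} (\<lambda>t. (\<phi> t - 1)\<^sup>2)"
    by (intro continuous_intros Q(1))+
  have pos: "0 < \<phi> t" if "t \<in> {0..1}" for t using Q(7)[OF that] by linarith
  have m: "(\<integral>\<^sup>+p. ennreal (metric_distortion (\<lambda>p. F p t) p) \<partial>arc_measure) = ennreal (2 * pi * ((\<phi> t)\<^sup>2 - 1)\<^sup>2)"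
    if t: "t \<in> {0..1}" for t
    using nn_integral_arc_measure_const[of "\<lambda>p. ennreal (metric_distortion (\<lambda>p. F p t) p)"]
      metric_distortion_dilation[OF pos[OF t], of "\<lambda>p. F p t"] F t by (simp add: ennreal_mult)
  have k: "(\<integral>\<^sup>+p. ennreal (curvature_distortion (\<lambda>p. F p t) p) \<partial>arc_measure) = ennreal (2 * pi * (\<phi> t - 1)\<^sup>2)"
    if t: "t \<in> {0..1}" for t
    using nn_integral_arc_measure_const[of "\<lambda>p. ennreal (curvature_distortion (\<lambda>p. F p t) p)"]
      curvature_distortion_dilation[OF pos[OF t], of "\<lambda>p. F p t"] F t by (simp add: ennreal_mult)
  have "(\<integral>\<^sup>+t. (\<integral>\<^sup>+p. ennreal (metric_distortion (\<lambda>p. F p t) p) \<partial>arc_measure) \<partial>lebesgue_on {0..1})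
      = (\<integral>\<^sup>+t. ennreal (2 * pi * ((\<phi> t)\<^sup>2 - 1)\<^sup>2) \<partial>lebesgue_on {0..1})"
    by (rule nn_integral_cong) (simp add: m)
  also have "\<dots> = ennreal (2 * pi * integral {0..1} (\<lambda>t. ((\<phi> t)\<^sup>2 - 1)\<^sup>2))"
    using nn_integral_unit_interval[of "\<lambda>t. 2 * pi * ((\<phi> t)\<^sup>2 - 1)\<^sup>2"] c1
    by (simp add: continuous_on_mult_left)
  moreover have "(\<integral>\<^sup>+t. (\<integral>\<^sup>+p. ennreal (curvature_distortion (\<lambda>p. F p t) p) \<partial>arc_measure) \<partial>lebesgue_on {0..1})
      = (\<integral>\<^sup>+t. ennreal (2 * pi * (\<phi> t - 1)\<^sup>2) \<partial>lebesgue_on {0..1})"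
    by (rule nn_integral_cong) (simp add: k)
  moreover have "\<dots> = ennreal (2 * pi * integral {0..1} (\<lambda>t. (\<phi> t - 1)\<^sup>2))"
    using nn_integral_unit_interval[of "\<lambda>t. 2 * pi * (\<phi> t - 1)\<^sup>2"] c1
    by (simp add: continuous_on_mult_left)
  moreover have "integral {0..1} (\<lambda>t. ((\<phi> t)\<^sup>2 - 1)\<^sup>2) \<ge> 0" "integral {0..1} (\<lambda>t. (\<phi> t - 1)\<^sup>2) \<ge> 0"
    using c1 by (auto intro!: Henstock_Kurzweil_Integration.integral_nonneg integrable_continuous_real)
  ultimately show ?thesis
    unfolding distortion_energy_def J_def by (simp add: ring_distribs flip: ennreal_plus)
qed

section \<open>Radial maps as morphs, and the norm constraint\<close>

lemma Ck_diffeo_dilation: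
  assumes "c > 0"
  shows "Ck_diffeo_onto_image k (\<lambda>p. c *\<^sub>R p) S"
proof -
  have inj: "inj_on (\<lambda>p. c *\<^sub>R p) S" using assms by (auto intro!: inj_onI)
  have "inv_into S (\<lambda>p. c *\<^sub>R p) y = (1 / c) *\<^sub>R y" if "y \<in> (\<lambda>p. c *\<^sub>R p) ` S" for y
    using that inj assms by (auto simp: inv_into_f_f)
  then show ?thesis
    unfolding Ck_diffeo_onto_image_def Ck_map_def
    using inj Ck_on_bounded_linear[OF bounded_linear_scaleR_right, of k c UNIV]
      Ck_on_bounded_linear[OF bounded_linear_scaleR_right, of k "1 / c" UNIV]
    by (metis IntD2 UNIV_I open_UNIV)
qed

lemma Lipschitz_imp_absolutely_continuous_on:
  assumes L: "L \<ge> 0" "\<And>x y. x \<in> S \<Longrightarrow> y \<in> S \<Longrightarrow> dist (f x) (f y) \<le> L * \<bar>x - y\<bar>"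
  shows "absolutely_continuous_on S f"
  unfolding absolutely_continuous_on_def
proof (intro allI impI)
  fix \<epsilon> :: real assume "\<epsilon> > 0"
  \<comment> \<open>Dividing by L + 1 rather than L keeps the choice of delta meaningful when L =
    0.\<close>
  have "(\<Sum>(a,b)\<in>I. dist (f a) (f b)) < \<epsilon>"
    if I: "\<forall>(a,b)\<in>I. a \<le> b \<and> {a..b} \<subseteq> S" "(\<Sum>(a,b)\<in>I. b - a) < \<epsilon> / (L + 1)" for I
  proof -
    have "(\<Sum>(a,b)\<in>I. dist (f a) (f b)) \<le> (\<Sum>(a,b)\<in>I. L * (b - a))"
    proof (rule sum_mono)
      fix x assume "x \<in> I"
      then obtain a b where "x = (a, b)" "a \<le> b" "{a..b} \<subseteq> S" using I(1) by (cases x) auto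
      then show "(case x of (a, b) \<Rightarrow> dist (f a) (f b)) \<le> (case x of (a, b) \<Rightarrow> L * (b - a))"
        using L(2)[of a b] by (auto simp: subset_iff)
    qed
    also have "\<dots> = L * (\<Sum>(a,b)\<in>I. b - a)" by (simp add: sum_distrib_left split_beta)
    also have "\<dots> \<le> L * (\<epsilon> / (L + 1))" using I(2) L(1) by (intro mult_left_mono) auto
    also have "\<dots> < \<epsilon>" using \<open>\<epsilon> > 0\<close> L(1) by (simp add: field_simps)
    finally show ?thesis .
  qed
  then show "\<exists>\<delta>>0. \<forall>I. finite I \<and> (\<forall>(a,b)\<in>I. a \<le> b \<and> {a..b} \<subseteq> S) \<and>
        disjoint_family_on (\<lambda>(a,b). {a<..<b}) I \<and> (\<Sum>(a,b)\<in>I. b - a) < \<delta> \<longrightarrow>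
        (\<Sum>(a,b)\<in>I. dist (f a) (f b)) < \<epsilon>"
    using \<open>\<epsilon> > 0\<close> L(1) by (intro exI[of _ "\<epsilon> / (L + 1)"]) auto
qed

text \<open>Meant for the minimiser, whose derivative extends continuously to 0 and 1: this bounds
  the derivative and makes each path Lipschitz, hence absolutely continuous. For competitors, being
  a morph is part of their membership in \<open>admissible_morphs\<close>.\<close>

lemma radial_morph_in_morphs_3ac:
  assumes \<psi>: "\<psi> \<in> Q_plus R" and R: "R > 1"
    and D: "\<forall>t\<in>{0..1}. (\<psi> has_real_derivative D t) (at t)" "continuous_on {0..1} D"
  shows "(\<lambda>p t. \<psi> t *\<^sub>R p) \<in> morphs_3ac S1 (sphere 0 R)"
proof -
  note Q = Q_plusD[OF \<psi>]
  have "compact (D ` {0..1})" by (intro compact_continuous_image D(2)) simp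
  then obtain L where L: "L > 0" "\<And>t. t \<in> {0..1} \<Longrightarrow> norm (D t) \<le> L"
    using compact_imp_bounded bounded_pos by (metis imageI)
  have lip: "norm (\<psi> x - \<psi> y) \<le> L * norm (x - y)" if "x \<in> {0..1}" "y \<in> {0..1}" for x y
    by (rule field_differentiable_bound[of "{0..1}" \<psi> D])
      (use D(1) L that in \<open>auto intro: has_field_derivative_at_within\<close>)
  show ?thesis
    unfolding morphs_3ac_def mem_Collect_eq
  proof (intro conjI ballI)
    show "continuous_on (S1 \<times> {0..1}) (\<lambda>(p, t). \<psi> t *\<^sub>R p)"
      unfolding split_beta
      by (intro continuous_intros continuous_on_compose2[OF Q(1)]) auto
    show "\<psi> 0 *\<^sub>R p = p" for p :: "real^2" by (simp add: Q(2))
    show "(\<lambda>p. \<psi> 1 *\<^sub>R p) ` S1 = sphere (0 :: real^2) R"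
      using R sphere_scale[of R "0::real^2" 1] by (simp add: Q(3))
    show "absolutely_continuous_on {0..1} (\<lambda>t. \<psi> t *\<^sub>R p)" if p: "p \<in> S1" for p :: "real^2"
    proof (rule Lipschitz_imp_absolutely_continuous_on)
      fix x y :: real assume xy: "x \<in> {0..1}" "y \<in> {0..1}"
      have "dist (\<psi> x *\<^sub>R p) (\<psi> y *\<^sub>R p) = norm (\<psi> x - \<psi> y)"
        using p by (simp add: dist_norm flip: scaleR_left_diff_distrib)
      then show "dist (\<psi> x *\<^sub>R p) (\<psi> y *\<^sub>R p) \<le> L * \<bar>x - y\<bar>" using lip[OF xy] p by simp
    qed (use L in simp)
    show "Ck_diffeo_onto_image 3 (\<lambda>p. \<psi> t *\<^sub>R p) S1" if "t \<in> {0..1}" for t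
      by (rule Ck_diffeo_dilation) (use Q(7)[OF that] in linarith)
  qed
qed

text \<open>Trajectories starting on the unit circle stay at radius at most R < R + 1, where the
  bump equals 1, and there the factor 1/psi of the field cancels the radius.\<close>

lemma generates_radial_field:
  assumes \<psi>: "\<psi> \<in> Q_plus R" and \<rho>: "is_bump R \<rho>"
  shows "generates S1 (\<lambda>p t. \<psi> t *\<^sub>R p) (radial_field \<rho> \<psi>)"
  unfolding generates_def
proof (intro ballI conjI AE_I2)
  note Q = Q_plusD[OF \<psi>]
  fix p :: "real^2" assume p: "p \<in> S1"
  show "\<psi> 0 *\<^sub>R p = p" by (simp add: Q(2))
  fix t :: real assume "t \<in> space (lebesgue_on {0<..<1})"
  then have t: "t \<in> {0<..<1}" by simp
  then have b: "1 \<le> \<psi> t" "\<psi> t \<le> R" using Q(7)[of t] by auto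
  then have "\<rho> (\<psi> t *\<^sub>R p) = 1" using \<rho> p by (auto simp: is_bump_def)
  then have "radial_field \<rho> \<psi> t (\<psi> t *\<^sub>R p) = deriv \<psi> t *\<^sub>R p"
    using b by (simp add: radial_field_def)
  moreover have "((\<lambda>t. \<psi> t *\<^sub>R p) has_vector_derivative deriv \<psi> t *\<^sub>R p) (at t)"
    using has_vector_derivative_scaleR[OF Q(5)[OF t] has_vector_derivative_const[of p]] by simp
  ultimately show "((\<lambda>t. \<psi> t *\<^sub>R p) has_vector_derivative radial_field \<rho> \<psi> t (\<psi> t *\<^sub>R p)) (at t)" by simp
qed

text \<open>The field is the scalar c = phi'/phi times the fixed profile rho id, so its norm is the
  L2 norm of c times the norm W of the profile, and \<open>A_const\<close> is P^2 / W^2.\<close>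

lemma radial_field_H5_iff:
  assumes \<phi>: "\<phi> \<in> Q_plus R" and R: "R > 1" and P: "P > 0" and \<rho>: "is_bump R \<rho>" and A: "A_const R \<rho> P > 0"
  shows "radial_field \<rho> \<phi> \<in> H5 R \<and> H5_norm R (radial_field \<rho> \<phi>) \<le> P \<longleftrightarrow> \<phi> \<in> J_feasible R (A_const R \<rho> P)"
proof -
  define f where "f = (\<lambda>x. \<rho> x *\<^sub>R x)"
  define c where "c = (\<lambda>t. deriv \<phi> t / \<phi> t)"
  define W where "W = W0_norm 5 (Omega R) f"
  have v: "radial_field \<rho> \<phi> = (\<lambda>t x. c t *\<^sub>R f x)"
    by (simp add: radial_field_def f_def c_def fun_eq_iff)
  have "smooth \<rho>" using \<rho> by (simp add: smooth_def is_bump_def)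
  then have "smooth f"
    unfolding f_def by (rule smooth_scaleR[OF _ smooth_bounded_linear[OF bounded_linear_ident]])
  moreover have "supported_in (ball 0 (R + 2)) f"
    using \<rho> by (auto simp: f_def supported_in_def is_bump_def Omega_def)
  ultimately have f: "f \<in> W0 5 (Omega R)"
    unfolding Omega_def using R by (intro smooth_vanishing_off_ball_in_W0) auto
  have \<Omega>: "Omega R \<in> sets lebesgue" by (simp add: Omega_def)
  have A_eq: "A_const R \<rho> P = P\<^sup>2 / W\<^sup>2" by (simp add: A_const_def W_def f_def)
  \<comment> \<open>Division by zero yields 0 in HOL, so positivity of \<open>A_const\<close>
    already excludes a vanishing norm.\<close>
  have "W \<noteq> 0" using A A_eq by auto
  moreover have "W \<ge> 0" unfolding W_def W0_norm_def by (auto intro!: sum_nonneg)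
  ultimately have W: "W > 0" by simp
  note Q = Q_plusD[OF \<phi>]
  have "\<phi> t \<noteq> 0" if "t \<in> {0<..<1}" for t using Q(7)[of t] that by auto
  then have cc: "continuous_on {0<..<1} c"
    unfolding c_def by (intro continuous_intros Q(6) continuous_on_subset[OF Q(1), of "{0<..<1}"]) auto
  let ?int = "integrable (lebesgue_on {0<..<1}) (\<lambda>t. (c t)\<^sup>2)"
  have H: "radial_field \<rho> \<phi> \<in> H5 R \<longleftrightarrow> ?int"
    unfolding v using bochner_L2_W0_scaleR_const[OF f \<Omega> cc] bochner_L2_W0_scaleR_const_imp_integrable[OF f \<Omega>]
      \<open>W \<noteq> 0\<close> unfolding W_def by blast
  have nrm: "H5_norm R (radial_field \<rho> \<phi>) \<le> P \<longleftrightarrow> (LINT t|lebesgue_on {0<..<1}. (c t)\<^sup>2) \<le> A_const R \<rho> P"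
  proof -
    let ?i = "LINT t|lebesgue_on {0<..<1}. (c t)\<^sup>2"
    have "?i \<ge> 0" by simp
    have "H5_norm R (radial_field \<rho> \<phi>) \<le> P \<longleftrightarrow> sqrt ?i \<le> P / W"
      unfolding v bochner_L2_W0_norm_scaleR_const[OF f \<Omega>] W_def[symmetric] using W
      by (simp add: field_simps)
    also have "\<dots> \<longleftrightarrow> sqrt ?i \<le> sqrt ((P / W)\<^sup>2)" using P W by simp
    finally show ?thesis by (simp add: A_eq power_divide)
  qed
  \<comment> \<open>The Lebesgue integral of a non-integrable function is 0 by convention, so the
    inequality for \<open>LINT\<close> means something only together with integrability. On the side
    of the field, integrability is carried by membership in \<open>H5\<close>; in
    \<open>J_feasible\<close>, by finiteness of the nonnegative integral.\<close>
  have "\<phi> \<in> J_feasible R (A_const R \<rho> P) \<longleftrightarrow> ?int \<and> (LINT t|lebesgue_on {0<..<1}. (c t)\<^sup>2) \<le> A_const R \<rho> P"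
  proof (cases ?int)
    case True
    then show ?thesis
      using \<phi> nn_integral_eq_integral[OF True] A by (simp add: J_feasible_def c_def)
  next
    case False
    then show ?thesis using J_feasible_imp_integrable(3)[of \<phi> R "A_const R \<rho> P"] A by (auto simp: c_def)
  qed
  then show ?thesis using H nrm by blast
qed

section \<open>Transfer of the reduced problem to morphs\<close>

theorem theorem1p6:
  fixes R P :: real and \<rho> :: "real^2 \<Rightarrow> real"
  assumes "R > 1" and "P > 0" and "is_bump R \<rho>"
    and "A_const R \<rho> P > (ln R)\<^sup>2"
  shows "\<exists>\<psi>\<in>Q_plus R.
     (let H = (\<lambda>p t. \<psi> t *\<^sub>R p) in
        is_arg_min distortion_energy (\<lambda>F. F \<in> admissible_morphs R \<rho> P) H \<and>
        (\<forall>F. is_arg_min distortion_energy (\<lambda>F. F \<in> admissible_morphs R \<rho> P) F \<longrightarrow>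
             (\<forall>p\<in>S1. \<forall>t\<in>{0..1}. F p t = H p t))) \<and>
     is_arg_min J (\<lambda>\<phi>. \<phi> \<in> J_feasible R (A_const R \<rho> P)) \<psi> \<and>
     (\<forall>\<phi>. is_arg_min J (\<lambda>\<phi>. \<phi> \<in> J_feasible R (A_const R \<rho> P)) \<phi> \<longrightarrow>
          (\<forall>t\<in>{0..1}. \<phi> t = \<psi> t)) \<and>
     (\<exists>l \<mu>. l > 0 \<and> \<mu> > 0 \<and> solves_multiplier_system R (A_const R \<rho> P) l \<mu> \<and>
        (\<forall>l' \<mu>'. l' > 0 \<and> \<mu>' > 0 \<and> solves_multiplier_system R (A_const R \<rho> P) l' \<mu>' \<longrightarrow>
           l' = l \<and> \<mu>' = \<mu>) \<and>
        \<psi> 0 = 1 \<and>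
        (\<forall>t\<in>{0..1}. (\<psi> has_real_derivative 1 / sqrt l * \<psi> t * root_term \<mu> (\<psi> t))
                       (at t within {0..1})))"
proof -
  define A where "A = A_const R \<rho> P"
  have A: "A > (ln R)\<^sup>2" using assms(4) by (simp add: A_def)
  then have A0: "A > 0" by (smt (verit) zero_le_power2)
  obtain l \<mu> where l: "l > 0" and \<mu>: "\<mu> > 0" and sys: "solves_multiplier_system R A l \<mu>"
    using exists_multiplier_pair[OF assms(1) A] by blast
  obtain \<psi> where \<psi>: "\<psi> \<in> Q_plus R"
    and ode: "\<forall>t\<in>{0..1}. (\<psi> has_real_derivative 1 / sqrt l * \<psi> t * root_term \<mu> (\<psi> t)) (at t)"
    using exists_ode_solution[OF assms(1) l \<mu>] sys by (auto simp: solves_multiplier_system_def)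
  note min = J_minimum_of_ode[OF assms(1) A0 l \<mu> sys \<psi> ode]
  note iff = radial_field_H5_iff[OF _ assms(1-3) A0[unfolded A_def], folded A_def]
  let ?H = "\<lambda>p t. \<psi> t *\<^sub>R p :: real^2"
  have J_nonneg: "J \<phi> \<ge> 0" if "\<phi> \<in> Q_plus R" for \<phi>
    unfolding J_def using Q_plusD(1)[OF that]
    by (intro add_nonneg_nonneg Henstock_Kurzweil_Integration.integral_nonneg
        integrable_continuous_real continuous_intros) auto
  have H: "?H \<in> admissible_morphs R \<rho> P"
  proof -
    have "?H \<in> morphs_3ac S1 (sphere 0 R)"
      by (rule radial_morph_in_morphs_3ac[OF \<psi> assms(1) ode])
        (intro continuous_intros Q_plusD(1)[OF \<psi>])
    then show ?thesis
      unfolding admissible_morphs_def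
      using \<psi> generates_radial_field[OF \<psi> assms(3)] iff[OF \<psi>] min(1) by auto
  qed
  \<comment> \<open>Every admissible morph reduces to a feasible radial function that determines its
    energy, so minimality and uniqueness can be read off from J.\<close>
  have radial: "\<exists>\<phi>\<in>J_feasible R A. (\<forall>p\<in>S1. \<forall>t\<in>{0..1}. F p t = \<phi> t *\<^sub>R p) \<and>
      distortion_energy F = ennreal (2 * pi * J \<phi>)" if "F \<in> admissible_morphs R \<rho> P" for F
    using that iff distortion_energy_radial unfolding admissible_morphs_def by blast
  have energy_H: "distortion_energy ?H = ennreal (2 * pi * J \<psi>)"
    by (rule distortion_energy_radial[OF \<psi>]) simp
  have H_min: "distortion_energy ?H \<le> distortion_energy F" if "F \<in> admissible_morphs R \<rho> P" for F
    using radial[OF that] energy_H min(2) by (auto intro!: ennreal_leI)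
  have H_unique: "\<forall>p\<in>S1. \<forall>t\<in>{0..1}. F p t = ?H p t"
    if F: "F \<in> admissible_morphs R \<rho> P" "distortion_energy F \<le> distortion_energy ?H" for F
  proof -
    obtain \<phi> where \<phi>: "\<phi> \<in> J_feasible R A" "\<forall>p\<in>S1. \<forall>t\<in>{0..1}. F p t = \<phi> t *\<^sub>R p"
      "distortion_energy F = ennreal (2 * pi * J \<phi>)" using radial[OF F(1)] by blast
    \<comment> \<open>\<open>ennreal\<close> truncates negative reals, so the comparison is
      reflected back to the reals through nonnegativity of J at \<open>\<psi>\<close>.\<close>
    have "2 * pi * J \<phi> \<le> 2 * pi * J \<psi>"
      using F(2) \<phi>(3) energy_H J_nonneg[OF \<psi>] by (simp add: ennreal_le_iff)
    then have "J \<phi> \<le> J \<psi>" by simp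
    then show ?thesis using \<phi>(2) min(3)[OF \<phi>(1)] by simp
  qed
  have ode': "\<forall>t\<in>{0..1}. (\<psi> has_real_derivative 1 / sqrt l * \<psi> t * root_term \<mu> (\<psi> t)) (at t within {0..1})"
    using ode has_field_derivative_at_within by blast
  have mult_unique: "\<forall>l' \<mu>'. l' > 0 \<and> \<mu>' > 0 \<and> solves_multiplier_system R A l' \<mu>' \<longrightarrow> l' = l \<and> \<mu>' = \<mu>"
    using multiplier_pair_unique[OF assms(1) A0 l _ \<mu> _ sys] by blast
  \<comment> \<open>\<open>is_arg_min\<close> excludes strictly smaller values; since the extended
    reals are linearly ordered, this is the same as the inequality \<open>H_min\<close>.\<close>
  have H_arg: "is_arg_min distortion_energy (\<lambda>F. F \<in> admissible_morphs R \<rho> P) ?H"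
    unfolding is_arg_min_def using H H_min leD by blast
  have H_arg_unique: "\<forall>F. is_arg_min distortion_energy (\<lambda>F. F \<in> admissible_morphs R \<rho> P) F \<longrightarrow>
      (\<forall>p\<in>S1. \<forall>t\<in>{0..1}. F p t = ?H p t)"
    unfolding is_arg_min_def using H H_unique linorder_not_le by metis
  have J_arg: "is_arg_min J (\<lambda>\<phi>. \<phi> \<in> J_feasible R A) \<psi>"
    unfolding is_arg_min_def using min(1,2) leD by blast
  have J_arg_unique: "\<forall>\<phi>. is_arg_min J (\<lambda>\<phi>. \<phi> \<in> J_feasible R A) \<phi> \<longrightarrow> (\<forall>t\<in>{0..1}. \<phi> t = \<psi> t)"
    unfolding is_arg_min_def using min(1,3) linorder_not_le by metis
  have "\<exists>l \<mu>. l > 0 \<and> \<mu> > 0 \<and> solves_multiplier_system R A l \<mu> \<and>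
      (\<forall>l' \<mu>'. l' > 0 \<and> \<mu>' > 0 \<and> solves_multiplier_system R A l' \<mu>' \<longrightarrow> l' = l \<and> \<mu>' = \<mu>) \<and>
      \<psi> 0 = 1 \<and>
      (\<forall>t\<in>{0..1}. (\<psi> has_real_derivative 1 / sqrt l * \<psi> t * root_term \<mu> (\<psi> t)) (at t within {0..1}))"
    by (intro exI[of _ l] exI[of _ \<mu>] conjI l \<mu> sys mult_unique Q_plusD(2)[OF \<psi>] ode')
  then show ?thesis
    unfolding A_def[symmetric] Let_def
    by (intro bexI[OF _ \<psi>] conjI H_arg H_arg_unique J_arg J_arg_unique)
qed

end
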